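(* For finitely presentable groups $G_1$ and $G_2$, one has $T_\infty(G_1*G_2)=T_\infty(G_1)+T_\infty(G_2)$, where $G_1*G_2$ is the free product.
   Context: For a finitely presentable group $G$, the presentation length is $T(G)=\min_{\mathcal P}\sum_{i=1}^m\max\{0,|r_i|-2\}$, the minimum being over all finite presentations $\mathcal P=\langle x_1,\dots,x_n\mid r_1,\dots,r_m\rangle$ of $G$, where $|r_i|$ is the word length of $r_i$. The stable presentation length is $T_\infty(G)=\inf_H T(H)/[G:H]$, the infimum being over all finite index subgroups $H$ of $G$. *)

theory Defs
  imports Complex_Main "HOL-Algebra.Coset"
begin

section \<open>Free groups\<close>

text \<open>
  A letter \<^term>\<open>(x, True)\<close> stands for the generator \<open>x\<close>, and \<^term>\<open>(x, False)\<close> for its inverse.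
  The elements of the free group are the reduced words.
\<close>

type_synonym 'x letter = "'x \<times> bool"

definition letter_inv :: "'x letter \<Rightarrow> 'x letter"
  where "letter_inv l = (fst l, \<not> snd l)"

definition words :: "'x set \<Rightarrow> 'x letter list set"
  where "words X = lists (X \<times> UNIV)"

definition reduced :: "'x letter list \<Rightarrow> bool"
  where "reduced = successively (\<lambda>k l. l \<noteq> letter_inv k)"

text \<open>Left multiplication of a reduced word by a single letter.\<close>

fun letter_mult :: "'x letter \<Rightarrow> 'x letter list \<Rightarrow> 'x letter list"
  where
    "letter_mult l [] = [l]"
  | "letter_mult l (k # w) = (if k = letter_inv l then w else l # k # w)"

definition free_reduce :: "'x letter list \<Rightarrow> 'x letter list"
  where "free_reduce w = foldr letter_mult w []"

definition free_group :: "'x set \<Rightarrow> 'x letter list monoid"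
  where "free_group X =
    \<lparr>carrier = {w \<in> words X. reduced w}, mult = foldr letter_mult, one = []\<rparr>"

lemma letter_inv_inv [simp]: "letter_inv (letter_inv l) = l"
  by (simp add: letter_inv_def)

lemma letter_inv_mem [simp]: "letter_inv l \<in> X \<times> UNIV \<longleftrightarrow> l \<in> X \<times> UNIV"
  by (cases l) (auto simp: letter_inv_def)

lemma reduced_Nil [simp]: "reduced []"
  by (simp add: reduced_def)

lemma reduced_Cons:
  "reduced (l # w) \<longleftrightarrow> reduced w \<and> (w = [] \<or> hd w \<noteq> letter_inv l)"
  by (cases w) (auto simp: reduced_def)

lemma reduced_letter_mult: "reduced w \<Longrightarrow> reduced (letter_mult l w)"
  by (cases w) (auto simp: reduced_Cons)

lemma words_letter_mult: "l \<in> X \<times> UNIV \<Longrightarrow> w \<in> words X \<Longrightarrow> letter_mult l w \<in> words X"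
  by (cases w) (auto simp: words_def)

lemma letter_mult_inv: "reduced w \<Longrightarrow> letter_mult l (letter_mult (letter_inv l) w) = w"
proof (cases w)
  case (Cons k v)
  assume "reduced w"
  then show ?thesis using Cons by (cases v) (auto simp: reduced_Cons)
qed simp

lemma letter_mult_reduced: "reduced (l # w) \<Longrightarrow> letter_mult l w = l # w"
  by (cases w) (auto simp: reduced_Cons)

lemma reduced_foldr: "reduced v \<Longrightarrow> reduced (foldr letter_mult u v)"
  by (induction u) (auto simp: reduced_letter_mult)

lemma words_foldr: "u \<in> words X \<Longrightarrow> v \<in> words X \<Longrightarrow> foldr letter_mult u v \<in> words X"
  by (induction u) (auto simp: words_def words_letter_mult[unfolded words_def])

lemma foldr_letter_mult:
  "reduced u \<Longrightarrow> reduced w \<Longrightarrow>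
    foldr letter_mult (letter_mult l u) w = letter_mult l (foldr letter_mult u w)"
  by (cases u) (auto simp: letter_mult_inv reduced_foldr)

lemma foldr_letter_mult_assoc:
  "reduced v \<Longrightarrow> reduced w \<Longrightarrow>
    foldr letter_mult (foldr letter_mult u v) w = foldr letter_mult u (foldr letter_mult v w)"
  by (induction u) (auto simp: foldr_letter_mult reduced_foldr)

lemma free_reduce_reduced: "reduced w \<Longrightarrow> free_reduce w = w"
  unfolding free_reduce_def
  by (induction w) (auto simp: letter_mult_reduced reduced_Cons)

lemma foldr_letter_mult_inverse:
  "reduced w \<Longrightarrow> foldr letter_mult (map letter_inv (rev u)) (foldr letter_mult u w) = w"
proof (induction u)
  case (Cons l u)
  then show ?case
    using letter_mult_inv[of "foldr letter_mult u w" "letter_inv l"] reduced_foldr[of w u] by simp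
qed simp

lemma free_reduce_in_free_group:
  "w \<in> words X \<Longrightarrow> free_reduce w \<in> carrier (free_group X)"
  using words_foldr[of w X "[]"]
  by (simp add: free_reduce_def free_group_def reduced_foldr words_def)

lemma group_free_group: "group (free_group X)"
proof (rule groupI)
  fix u assume "u \<in> carrier (free_group X)"
  then have u: "u \<in> words X" "reduced u" by (auto simp: free_group_def)
  define v where "v = free_reduce (map letter_inv (rev u))"
  have v: "v \<in> carrier (free_group X)"
    unfolding v_def using u(1)
    by (intro free_reduce_in_free_group)
      (simp add: words_def in_lists_conv_set del: mem_Sigma_iff mem_Times_iff)
  have "foldr letter_mult v u
      = foldr letter_mult (map letter_inv (rev u)) (foldr letter_mult u [])"
    using u foldr_letter_mult_assoc[of "[]" u "map letter_inv (rev u)"]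
      free_reduce_reduced[of u]
    by (simp add: v_def free_reduce_def)
  also have "\<dots> = []" by (rule foldr_letter_mult_inverse) simp
  finally show "\<exists>v\<in>carrier (free_group X). v \<otimes>\<^bsub>free_group X\<^esub> u = \<one>\<^bsub>free_group X\<^esub>"
    using v by (auto simp: free_group_def)
qed (auto simp: free_group_def words_foldr reduced_foldr foldr_letter_mult_assoc,
     auto simp: words_def)


section \<open>Finite presentations and presentation length\<close>

definition normal_closure :: "('a, 'c) monoid_scheme \<Rightarrow> 'a set \<Rightarrow> 'a set"
  where "normal_closure G S = \<Inter>{N. N \<lhd> G \<and> S \<subseteq> N}"

text \<open>
  The group \<open>\<langle>x\<^sub>0, \<dots>, x\<^bsub>n-1\<^esub> | r\<^sub>1, \<dots>, r\<^sub>m\<rangle>\<close>.  Relators are arbitrary words, not necessarily reduced.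
\<close>

definition presented_group :: "nat \<Rightarrow> nat letter list list \<Rightarrow> nat letter list set monoid"
  where "presented_group n rs =
    free_group {..<n} Mod normal_closure (free_group {..<n}) (free_reduce ` set rs)"

definition is_presentation ::
    "('a, 'c) monoid_scheme \<Rightarrow> nat \<Rightarrow> nat letter list list \<Rightarrow> bool"
  where "is_presentation G n rs \<longleftrightarrow> set rs \<subseteq> words {..<n} \<and> presented_group n rs \<cong> G"

definition finitely_presentable :: "('a, 'c) monoid_scheme \<Rightarrow> bool"
  where "finitely_presentable G \<longleftrightarrow> group G \<and> (\<exists>n rs. is_presentation G n rs)"

text \<open>Truncated subtraction on \<^typ>\<open>nat\<close> makes \<^term>\<open>length r - 2\<close> equal to \<open>max {0, |r| - 2}\<close>.\<close>

definition presentation_length :: "('a, 'c) monoid_scheme \<Rightarrow> nat"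
  where "presentation_length G =
    (LEAST k. \<exists>n rs. is_presentation G n rs \<and> k = (\<Sum>r\<leftarrow>rs. length r - 2))"

text \<open>
  If \<^term>\<open>G\<close> is finitely presentable, then so are its finite index subgroups, so that
  \<^const>\<open>presentation_length\<close> is only applied to finitely presentable groups here.
  The index of \<^term>\<open>H\<close> is the number of its right cosets.
\<close>

definition stable_presentation_length :: "('a, 'c) monoid_scheme \<Rightarrow> real"
  where "stable_presentation_length G =
    (INF H \<in> {H. subgroup H G \<and> finite (rcosets\<^bsub>G\<^esub> H)}.
      real (presentation_length (G\<lparr>carrier := H\<rparr>)) / real (card (rcosets\<^bsub>G\<^esub> H)))"


section \<open>Free products\<close>

text \<open>
  Elements of the free product are normal forms: words in the nontrivial elements of the two
  factors in which the factors alternate.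
\<close>

definition syllables ::
    "('a, 'c) monoid_scheme \<Rightarrow> ('b, 'd) monoid_scheme \<Rightarrow> ('a + 'b) set"
  where "syllables G H = (carrier G - {\<one>\<^bsub>G\<^esub>}) <+> (carrier H - {\<one>\<^bsub>H\<^esub>})"

definition alternating :: "('a + 'b) list \<Rightarrow> bool"
  where "alternating = successively (\<lambda>s t. isl s \<noteq> isl t)"

text \<open>Left multiplication of a normal form by an element of one of the factors.\<close>

fun syllable_mult ::
    "('a, 'c) monoid_scheme \<Rightarrow> ('b, 'd) monoid_scheme \<Rightarrow> 'a + 'b \<Rightarrow> ('a + 'b) list \<Rightarrow> ('a + 'b) list"
  where
    "syllable_mult G H (Inl a) (Inl b # w) =
      (if a \<otimes>\<^bsub>G\<^esub> b = \<one>\<^bsub>G\<^esub> then w else Inl (a \<otimes>\<^bsub>G\<^esub> b) # w)"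
  | "syllable_mult G H (Inr a) (Inr b # w) =
      (if a \<otimes>\<^bsub>H\<^esub> b = \<one>\<^bsub>H\<^esub> then w else Inr (a \<otimes>\<^bsub>H\<^esub> b) # w)"
  | "syllable_mult G H (Inl a) w = (if a = \<one>\<^bsub>G\<^esub> then w else Inl a # w)"
  | "syllable_mult G H (Inr a) w = (if a = \<one>\<^bsub>H\<^esub> then w else Inr a # w)"

definition free_product ::
    "('a, 'c) monoid_scheme \<Rightarrow> ('b, 'd) monoid_scheme \<Rightarrow> ('a + 'b) list monoid"
  where "free_product G H =
    \<lparr>carrier = {w \<in> lists (syllables G H). alternating w},
     mult = foldr (syllable_mult G H), one = []\<rparr>"

lemma alternating_Nil [simp]: "alternating []"
  by (simp add: alternating_def)

lemma alternating_Cons: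
  "alternating (s # w) \<longleftrightarrow> alternating w \<and> (w = [] \<or> isl (hd w) \<noteq> isl s)"
  by (cases w) (auto simp: alternating_def)

context
  fixes G :: "('a, 'c) monoid_scheme" and H :: "('b, 'd) monoid_scheme"
  assumes G: "group G" and H: "group H"
begin

interpretation G: group G by (rule G)
interpretation H: group H by (rule H)

abbreviation "FP \<equiv> carrier (free_product G H)"
abbreviation "sm \<equiv> syllable_mult G H"

lemma FP_iff: "w \<in> FP \<longleftrightarrow> set w \<subseteq> syllables G H \<and> alternating w"
  by (auto simp: free_product_def)

lemma FP_Nil: "[] \<in> FP"
  by (simp add: FP_iff)

lemma FP_ConsD: "s # w \<in> FP \<Longrightarrow> w \<in> FP"
  by (simp add: FP_iff alternating_Cons)

lemma FP_Inl_Cons: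
  "Inl a # w \<in> FP \<longleftrightarrow> a \<in> carrier G \<and> a \<noteq> \<one>\<^bsub>G\<^esub> \<and> w \<in> FP \<and> (w = [] \<or> \<not> isl (hd w))"
  by (auto simp: FP_iff alternating_Cons syllables_def)

lemma FP_Inr_Cons:
  "Inr a # w \<in> FP \<longleftrightarrow> a \<in> carrier H \<and> a \<noteq> \<one>\<^bsub>H\<^esub> \<and> w \<in> FP \<and> (w = [] \<or> isl (hd w))"
  by (auto simp: FP_iff alternating_Cons syllables_def)

lemmas FP_Cons = FP_Inl_Cons FP_Inr_Cons FP_Nil

lemma FP_cases:
  assumes "w \<in> FP"
  obtains (1) "w = []"
    | (2) a v where "w = Inl a # v" "a \<in> carrier G" "a \<noteq> \<one>\<^bsub>G\<^esub>" "v \<in> FP" "v = [] \<or> \<not> isl (hd v)"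
    | (3) a v where "w = Inr a # v" "a \<in> carrier H" "a \<noteq> \<one>\<^bsub>H\<^esub>" "v \<in> FP" "v = [] \<or> isl (hd v)"
proof (cases w)
  case Nil
  then show thesis by (rule that(1))
next
  case (Cons s v)
  then show thesis using assms that(2,3) by (cases s) (auto simp: FP_Cons)
qed

lemma sm_Inl: "v = [] \<or> \<not> isl (hd v) \<Longrightarrow> sm (Inl a) v = (if a = \<one>\<^bsub>G\<^esub> then v else Inl a # v)"
  by (cases v; cases "hd v") auto

lemma sm_Inr: "v = [] \<or> isl (hd v) \<Longrightarrow> sm (Inr a) v = (if a = \<one>\<^bsub>H\<^esub> then v else Inr a # v)"
  by (cases v; cases "hd v") auto

lemma sm_closed:
  "s \<in> carrier G <+> carrier H \<Longrightarrow> w \<in> FP \<Longrightarrow> sm s w \<in> FP"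
  by (erule FP_cases; cases s; auto simp: FP_Cons)

lemma sm_Inl_mult:
  assumes "w \<in> FP" "a \<in> carrier G" "b \<in> carrier G"
  shows "sm (Inl a) (sm (Inl b) w) = sm (Inl (a \<otimes>\<^bsub>G\<^esub> b)) w"
  using assms(1)
proof (cases rule: FP_cases)
  case 1
  then show ?thesis using assms by auto
next
  case (2 c v)
  then show ?thesis using assms by (auto simp: sm_Inl G.m_assoc)
next
  case (3 c v)
  then show ?thesis using assms by (auto simp: sm_Inl G.m_assoc)
qed

lemma sm_Inr_mult:
  assumes "w \<in> FP" "a \<in> carrier H" "b \<in> carrier H"
  shows "sm (Inr a) (sm (Inr b) w) = sm (Inr (a \<otimes>\<^bsub>H\<^esub> b)) w"
  using assms(1)
proof (cases rule: FP_cases)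
  case 1
  then show ?thesis using assms by auto
next
  case (2 c v)
  then show ?thesis using assms by (auto simp: sm_Inr H.m_assoc)
next
  case (3 c v)
  then show ?thesis using assms by (auto simp: sm_Inr H.m_assoc)
qed

lemma sm_one:
  assumes "w \<in> FP"
  shows "sm (Inl \<one>\<^bsub>G\<^esub>) w = w" "sm (Inr \<one>\<^bsub>H\<^esub>) w = w"
  using assms by (cases rule: FP_cases; auto)+

lemma foldr_sm_closed:
  "set u \<subseteq> carrier G <+> carrier H \<Longrightarrow> w \<in> FP \<Longrightarrow> foldr sm u w \<in> FP"
  by (induction u) (auto intro!: sm_closed)

lemma FP_factors: "w \<in> FP \<Longrightarrow> set w \<subseteq> carrier G <+> carrier H"
  by (auto simp: FP_iff syllables_def)

lemma foldr_sm:
  assumes "s \<in> carrier G <+> carrier H" "u \<in> FP" "w \<in> FP"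
  shows "foldr sm (sm s u) w = sm s (foldr sm u w)"
proof -
  have fold: "foldr sm v w \<in> FP" if "v \<in> FP" for v
    using that assms(3) by (intro foldr_sm_closed FP_factors)
  from assms(2) show ?thesis
  proof (cases rule: FP_cases)
    case 1
    then show ?thesis using assms by (auto simp: sm_one)
  next
    case (2 b v)
    then show ?thesis using assms(1) fold[of v] fold[OF assms(2)]
      by (auto simp: sm_one sm_Inl_mult sm_closed)
  next
    case (3 b v)
    then show ?thesis using assms(1) fold[of v] fold[OF assms(2)]
      by (auto simp: sm_one sm_Inr_mult sm_closed)
  qed
qed

lemma foldr_sm_assoc:
  "set u \<subseteq> carrier G <+> carrier H \<Longrightarrow> v \<in> FP \<Longrightarrow> w \<in> FP \<Longrightarrow>
    foldr sm (foldr sm u v) w = foldr sm u (foldr sm v w)"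
  by (induction u) (auto simp: foldr_sm foldr_sm_closed)

lemma foldr_sm_Nil: "w \<in> FP \<Longrightarrow> foldr sm w [] = w"
proof (induction w)
  case (Cons s w)
  then show ?case by (cases s) (auto simp: FP_Cons sm_Inl sm_Inr)
qed simp

lemma group_free_product: "group (free_product G H)"
proof (rule groupI)
  fix u assume u: "u \<in> FP"
  have "\<exists>v. set v \<subseteq> carrier G <+> carrier H \<and> (\<forall>w\<in>FP. foldr sm v (foldr sm u w) = w)"
    using u
  proof (induction u)
    case Nil
    show ?case by (intro exI[of _ "[]"]) simp
  next
    case (Cons s u)
    then have u: "u \<in> FP" by (blast dest: FP_ConsD)
    then obtain v where v: "set v \<subseteq> carrier G <+> carrier H"
      "\<And>w. w \<in> FP \<Longrightarrow> foldr sm v (foldr sm u w) = w" using Cons.IH by blast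
    have fold: "foldr sm u w \<in> FP" if "w \<in> FP" for w
      using u that by (intro foldr_sm_closed FP_factors)
    show ?case
    proof (cases s)
      case (Inl a)
      then have a: "a \<in> carrier G" using Cons.prems by (simp add: FP_Cons)
      show ?thesis using a v fold Inl
        by (intro exI[of _ "v @ [Inl (inv\<^bsub>G\<^esub> a)]"]) (auto simp: sm_Inl_mult sm_one)
    next
      case (Inr a)
      then have a: "a \<in> carrier H" using Cons.prems by (simp add: FP_Cons)
      show ?thesis using a v fold Inr
        by (intro exI[of _ "v @ [Inr (inv\<^bsub>H\<^esub> a)]"]) (auto simp: sm_Inr_mult sm_one)
    qed
  qed
  then obtain v where v: "set v \<subseteq> carrier G <+> carrier H"
    "\<And>w. w \<in> FP \<Longrightarrow> foldr sm v (foldr sm u w) = w" by blast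
  have "foldr sm (foldr sm v []) u = []"
    using v u foldr_sm_assoc[OF v(1) FP_Nil u] v(2)[OF FP_Nil] foldr_sm_Nil[OF u] by simp
  then show "\<exists>v\<in>FP. v \<otimes>\<^bsub>free_product G H\<^esub> u = \<one>\<^bsub>free_product G H\<^esub>"
    using foldr_sm_closed[OF v(1) FP_Nil]
    by (intro bexI[of _ "foldr sm v []"]) (auto simp: free_product_def)
next
  fix u v w assume "u \<in> FP" "v \<in> FP" "w \<in> FP"
  then show "u \<otimes>\<^bsub>free_product G H\<^esub> v \<otimes>\<^bsub>free_product G H\<^esub> w
      = u \<otimes>\<^bsub>free_product G H\<^esub> (v \<otimes>\<^bsub>free_product G H\<^esub> w)"
    using foldr_sm_assoc[OF FP_factors] by (simp add: free_product_def)
next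
  fix u v assume "u \<in> FP" "v \<in> FP"
  then show "u \<otimes>\<^bsub>free_product G H\<^esub> v \<in> FP"
    using foldr_sm_closed[OF FP_factors] by (simp add: free_product_def)
qed (auto simp: free_product_def)

end

end

theory Submission
  imports Defs
begin

text \<open>
  Up to relations of length at most two, the presentation length of a group is the least number of orbits of
  triangles in a simply connected 2-complex on which the group acts freely and with finitely many orbits of
  edges.

  Let \<open>K\<close> be a finite index subgroup of \<open>G = G1 * G2\<close>, and let \<open>C i\<close> be its intersections with the
  conjugates of the factors, one for every double coset.  Then the presentation length of \<open>K\<close> is the sum of those
  of the \<open>C i\<close>, which by Kurosh's theorem are the factors of a free product decomposition of \<open>K\<close>, up to a free
  factor.  For ``at most'', fill every coset of \<open>G1\<close> and \<open>G2\<close> in the Cayley graph of \<open>G\<close> with a complex for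
  the corresponding \<open>C i\<close>.  For ``at least'', project a complex for \<open>K\<close> to the cosets of the factors, which are
  arranged in a tree, and collapse all edges that are mapped to a single point of the coset belonging to \<open>C i\<close>.
  The result is a complex for \<open>C i\<close>, and a triangle survives in at most one of these complexes, since three points
  of a tree have only one median.

  The indices of the \<open>C i\<close> in a fixed factor add up to the index of \<open>K\<close>, which gives one inequality.  For the
  other, the stabiliser of a point of \<open>G1/A \<times> G2/B\<close> is a subgroup \<open>K\<close> all of whose \<open>C i\<close> are conjugate to
  \<open>A\<close> or \<open>B\<close>.
\<close>

section \<open>Words and presentations\<close>

text \<open>Relators of length at most two are free of charge, so any finite generating set may be
  used, edges may be inverted or collapsed, and a triangle with a collapsed side costs nothing. This
  is why complexes and orbits of triangles are manipulated instead of words, and why a collapse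
  never increases the length.

  The obstacle in the lower bound is that \<open>C i\<close> usually has infinite index in
  \<open>K\<close>, so a complex for \<open>K\<close> has infinitely many orbits of triangles under
  \<open>C i\<close>. Only the cells that cross the star of the relevant vertex of the tree survive
  the collapse, and these fall into finitely many orbits.

  Simple connectivity enters only through the solvability of \<open>h u v = inv (p u) p v\<close>
  for edge labels \<open>h\<close> that are consistent on triangles. Complexes are then glued by
  gluing the functions \<open>p\<close>, and a presentation is verified by labelling the edges of a
  complex with elements of the presented group itself.\<close>

definition letter_eval :: "('a, 'c) monoid_scheme \<Rightarrow> ('x \<Rightarrow> 'a) \<Rightarrow> 'x letter \<Rightarrow> 'a"
  where "letter_eval G f l = (if snd l then f (fst l) else inv\<^bsub>G\<^esub> f (fst l))"

definition word_eval :: "('a, 'c) monoid_scheme \<Rightarrow> ('x \<Rightarrow> 'a) \<Rightarrow> 'x letter list \<Rightarrow> 'a"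
  where "word_eval G f w = foldr (\<lambda>l g. letter_eval G f l \<otimes>\<^bsub>G\<^esub> g) w \<one>\<^bsub>G\<^esub>"

lemma words_Nil [simp]: "[] \<in> words X"
  by (simp add: words_def)

lemma words_Cons [simp]: "l # w \<in> words X \<longleftrightarrow> fst l \<in> X \<and> w \<in> words X"
  by (cases l) (auto simp: words_def)

lemma words_append [simp]: "u @ v \<in> words X \<longleftrightarrow> u \<in> words X \<and> v \<in> words X"
  by (auto simp: words_def)

lemma words_take: "w \<in> words X \<Longrightarrow> take i w \<in> words X"
  by (metis append_take_drop_id words_append)

lemma words_nth: "w \<in> words X \<Longrightarrow> i < length w \<Longrightarrow> fst (w ! i) \<in> X"
  by (auto simp: words_def in_lists_conv_set dest!: nth_mem)

lemma fst_letter_inv [simp]: "fst (letter_inv l) = fst l"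
  by (simp add: letter_inv_def)

lemma word_eval_Nil [simp]: "word_eval G f [] = \<one>\<^bsub>G\<^esub>"
  by (simp add: word_eval_def)

lemma word_eval_Cons [simp]: "word_eval G f (l # w) = letter_eval G f l \<otimes>\<^bsub>G\<^esub> word_eval G f w"
  by (simp add: word_eval_def)

context group
begin

lemma letter_eval_closed [simp]: "f \<in> X \<rightarrow> carrier G \<Longrightarrow> fst l \<in> X \<Longrightarrow> letter_eval G f l \<in> carrier G"
  by (auto simp: letter_eval_def)

lemma letter_eval_inv:
  "f \<in> X \<rightarrow> carrier G \<Longrightarrow> fst l \<in> X \<Longrightarrow> letter_eval G f (letter_inv l) = inv letter_eval G f l"
  using Pi_mem[of f X "\<lambda>_. carrier G" "fst l"] by (simp add: letter_eval_def letter_inv_def)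

lemma word_eval_closed [simp]: "f \<in> X \<rightarrow> carrier G \<Longrightarrow> w \<in> words X \<Longrightarrow> word_eval G f w \<in> carrier G"
  by (induction w) auto

lemma word_eval_append:
  "f \<in> X \<rightarrow> carrier G \<Longrightarrow> u \<in> words X \<Longrightarrow> v \<in> words X \<Longrightarrow>
    word_eval G f (u @ v) = word_eval G f u \<otimes> word_eval G f v"
  by (induction u) (auto simp: m_assoc)

lemma word_eval_letter_mult:
  assumes "f \<in> X \<rightarrow> carrier G" "fst l \<in> X" "w \<in> words X"
  shows "word_eval G f (letter_mult l w) = letter_eval G f l \<otimes> word_eval G f w"
proof (cases w)
  case (Cons k v)
  show ?thesis
  proof (cases "k = letter_inv l")
    case True
    then show ?thesis using Cons assms
      by (simp add: letter_eval_inv[OF assms(1)] m_assoc[symmetric])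
  qed (simp add: Cons)
qed simp

lemma word_eval_foldr:
  assumes "f \<in> X \<rightarrow> carrier G" "u \<in> words X" "v \<in> words X"
  shows "word_eval G f (foldr letter_mult u v) = word_eval G f u \<otimes> word_eval G f v"
  using assms(2)
proof (induction u)
  case (Cons l u)
  then have "foldr letter_mult u v \<in> words X" using words_foldr[of u X v] assms(3) by simp
  then show ?case using Cons assms by (simp add: word_eval_letter_mult[OF assms(1)] m_assoc)
qed (simp add: word_eval_closed[OF assms(1,3)])

lemma word_eval_hom: "f \<in> X \<rightarrow> carrier G \<Longrightarrow> word_eval G f \<in> hom (free_group X) G"
  by (rule homI) (auto simp: free_group_def word_eval_foldr)

lemma word_eval_free_reduce:
  "f \<in> X \<rightarrow> carrier G \<Longrightarrow> w \<in> words X \<Longrightarrow> word_eval G f (free_reduce w) = word_eval G f w"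
  by (simp add: free_reduce_def word_eval_foldr)

lemma normal_Inter: "\<N> \<noteq> {} \<Longrightarrow> (\<And>N. N \<in> \<N> \<Longrightarrow> N \<lhd> G) \<Longrightarrow> \<Inter>\<N> \<lhd> G"
  using subgroups_Inter[of \<N>] by (simp add: normal_inv_iff)

lemma normal_carrier: "carrier G \<lhd> G"
  by (simp add: normal_inv_iff subgroup_self)

lemma normal_normal_closure: "S \<subseteq> carrier G \<Longrightarrow> normal_closure G S \<lhd> G"
  unfolding normal_closure_def using normal_carrier by (intro normal_Inter) auto

end

lemma normal_closure_superset: "S \<subseteq> normal_closure G S"
  by (auto simp: normal_closure_def)

lemma normal_closure_minimal: "N \<lhd> G \<Longrightarrow> S \<subseteq> N \<Longrightarrow> normal_closure G S \<subseteq> N"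
  by (auto simp: normal_closure_def)

definition relator_kernel :: "nat \<Rightarrow> nat letter list list \<Rightarrow> nat letter list set"
  where "relator_kernel n rs = normal_closure (free_group {..<n}) (free_reduce ` set rs)"

lemma relator_kernel_normal:
  assumes "set rs \<subseteq> words {..<n}"
  shows "relator_kernel n rs \<lhd> free_group {..<n}"
  unfolding relator_kernel_def
  using assms by (intro group.normal_normal_closure group_free_group) (auto intro: free_reduce_in_free_group)

lemma presented_group_eq: "presented_group n rs = free_group {..<n} Mod relator_kernel n rs"
  by (simp add: presented_group_def relator_kernel_def)

lemma group_presented_group: "set rs \<subseteq> words {..<n} \<Longrightarrow> group (presented_group n rs)"
  unfolding presented_group_eq by (rule normal.factorgroup_is_group) (rule relator_kernel_normal)

definition relator_coset :: "nat \<Rightarrow> nat letter list list \<Rightarrow> nat letter list \<Rightarrow> nat letter list set"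
  where "relator_coset n rs w = relator_kernel n rs #>\<^bsub>free_group {..<n}\<^esub> w"

lemma relator_coset_hom:
  "set rs \<subseteq> words {..<n} \<Longrightarrow> relator_coset n rs \<in> hom (free_group {..<n}) (presented_group n rs)"
  using normal.r_coset_hom_Mod[OF relator_kernel_normal[of rs n]]
  by (simp add: relator_coset_def[abs_def] presented_group_eq)

lemma letter_word_in_free_group: "fst l \<in> X \<Longrightarrow> [l] \<in> carrier (free_group X)"
  by (simp add: free_group_def reduced_Cons)

lemma inv_letter_word: "i \<in> X \<Longrightarrow> inv\<^bsub>free_group X\<^esub> [(i, True)] = [(i, False)]"
  by (rule group.inv_equality[OF group_free_group])
    (auto simp: free_group_def letter_inv_def reduced_Cons)

text \<open>Both sides are multiplicative, so it is enough to compare them on single letters.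
  Applied to \<open>relator_coset\<close>, it turns statements about the quotient of the free group
  into evaluations of words.\<close>

lemma hom_free_reduce:
  assumes "group Q" "\<Phi> \<in> hom (free_group X) Q" "w \<in> words X"
  shows "\<Phi> (free_reduce w) = word_eval Q (\<lambda>i. \<Phi> [(i, True)]) w"
proof -
  interpret hom: group_hom "free_group X" Q \<Phi>
    using assms by (simp add: group_hom_def group_hom_axioms_def group_free_group)
  show ?thesis using assms(3)
  proof (induction w)
    case Nil
    show ?case using hom.hom_one by (simp add: free_reduce_def free_group_def)
  next
    case (Cons l w)
    then have w: "free_reduce w \<in> carrier (free_group X)" "fst l \<in> X"
      by (auto intro: free_reduce_in_free_group)
    have "\<Phi> [l] = letter_eval Q (\<lambda>i. \<Phi> [(i, True)]) l"
    proof (cases "snd l")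
      case True
      then show ?thesis by (cases l) (auto simp: letter_eval_def)
    next
      case False
      have "\<Phi> [(fst l, False)] = inv\<^bsub>Q\<^esub> \<Phi> [(fst l, True)]"
        using hom.hom_inv[of "[(fst l, True)]"] w(2)
        by (simp add: inv_letter_word letter_word_in_free_group)
      then show ?thesis using False by (cases l) (auto simp: letter_eval_def)
    qed
    moreover have "free_reduce (l # w) = [l] \<otimes>\<^bsub>free_group X\<^esub> free_reduce w"
      by (simp add: free_group_def free_reduce_def)
    ultimately show ?case using Cons w hom.hom_mult[of "[l]" "free_reduce w"]
      by (simp add: letter_word_in_free_group)
  qed
qed

lemma word_eval_relator:
  assumes "set rs \<subseteq> words {..<n}" "r \<in> set rs"
  shows "word_eval (presented_group n rs) (\<lambda>i. relator_coset n rs [(i, True)]) r = \<one>\<^bsub>presented_group n rs\<^esub>"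
proof -
  interpret N: normal "relator_kernel n rs" "free_group {..<n}" by (rule relator_kernel_normal) fact
  have "free_reduce r \<in> relator_kernel n rs"
    unfolding relator_kernel_def by (rule subsetD[OF normal_closure_superset imageI[OF assms(2)]])
  moreover have "r \<in> words {..<n}" using assms by auto
  ultimately have "relator_coset n rs (free_reduce r) = \<one>\<^bsub>presented_group n rs\<^esub>"
    using N.rcos_const[OF group_free_group] by (simp add: relator_coset_def presented_group_eq)
  then show ?thesis
    using hom_free_reduce[OF group_presented_group relator_coset_hom \<open>r \<in> words {..<n}\<close>] assms(1) by metis
qed

text \<open>The first isomorphism theorem: the assumptions identify the kernel of the evaluation
  with the normal closure of the relators. The nontrivial inclusion is asked for as an identity in
  the presented group, because a potential with values in that group delivers it in this
  form.\<close>

lemma is_presentationI: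
  assumes "group G" "set rs \<subseteq> words {..<n}" "f \<in> {..<n} \<rightarrow> carrier G"
    and surj: "\<And>g. g \<in> carrier G \<Longrightarrow> \<exists>w\<in>words {..<n}. word_eval G f w = g"
    and rel: "\<And>r. r \<in> set rs \<Longrightarrow> word_eval G f r = \<one>\<^bsub>G\<^esub>"
    and ker: "\<And>w. w \<in> words {..<n} \<Longrightarrow> word_eval G f w = \<one>\<^bsub>G\<^esub> \<Longrightarrow>
      word_eval (presented_group n rs) (\<lambda>i. relator_coset n rs [(i, True)]) w = \<one>\<^bsub>presented_group n rs\<^esub>"
  shows "is_presentation G n rs"
proof -
  interpret G: group G by fact
  let ?F = "free_group {..<n}"
  interpret F: group ?F by (rule group_free_group)
  interpret hom: group_hom ?F G "word_eval G f"
    using G.word_eval_hom[OF assms(3)]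
    by (simp add: group_hom_def group_hom_axioms_def group_free_group assms(1))
  interpret N: normal "relator_kernel n rs" ?F by (rule relator_kernel_normal) fact
  have words: "w \<in> words {..<n}" "free_reduce w = w" if "w \<in> carrier ?F" for w
    using that by (auto simp: free_group_def free_reduce_reduced)
  have "kernel ?F G (word_eval G f) = relator_kernel n rs"
  proof
    show "relator_kernel n rs \<subseteq> kernel ?F G (word_eval G f)"
      unfolding relator_kernel_def
      using assms(2) rel
      by (intro normal_closure_minimal hom.normal_kernel)
        (auto simp: kernel_def G.word_eval_free_reduce[OF assms(3)] intro!: free_reduce_in_free_group)
    show "kernel ?F G (word_eval G f) \<subseteq> relator_kernel n rs"
    proof
      fix w assume "w \<in> kernel ?F G (word_eval G f)"
      then have w: "w \<in> carrier ?F" "word_eval G f w = \<one>\<^bsub>G\<^esub>" by (auto simp: kernel_def)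
      have "relator_coset n rs w = relator_kernel n rs"
        using ker[OF words(1) w(2)] w(1)
          hom_free_reduce[OF group_presented_group relator_coset_hom words(1)] words(2) assms(2)
        by (simp add: presented_group_eq)
      then show "w \<in> relator_kernel n rs"
        using w(1) F.coset_join1 N.subgroup_axioms N.subset by (metis relator_coset_def)
    qed
  qed
  moreover have "word_eval G f ` carrier ?F = carrier G"
  proof
    show "carrier G \<subseteq> word_eval G f ` carrier ?F"
    proof
      fix g assume "g \<in> carrier G"
      then obtain w where "w \<in> words {..<n}" "word_eval G f w = g" using surj by blast
      then show "g \<in> word_eval G f ` carrier ?F"
        using G.word_eval_free_reduce[OF assms(3)] free_reduce_in_free_group by (metis imageI)
    qed
  qed auto
  ultimately show ?thesis
    using hom.FactGroup_iso assms(2) by (simp add: is_presentation_def presented_group_eq)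
qed

text \<open>The generators are the images of the one-letter words under the quotient map followed by
  the isomorphism. Injectivity of the latter puts every word that is trivial in \<open>G\<close>
  into the normal closure.\<close>

lemma is_presentationE:
  assumes "group G" "is_presentation G n rs"
  obtains f where "f \<in> {..<n} \<rightarrow> carrier G" "set rs \<subseteq> words {..<n}"
    "\<And>g. g \<in> carrier G \<Longrightarrow> \<exists>w\<in>words {..<n}. word_eval G f w = g"
    "\<And>r. r \<in> set rs \<Longrightarrow> word_eval G f r = \<one>\<^bsub>G\<^esub>"
    "\<And>w. w \<in> words {..<n} \<Longrightarrow> word_eval G f w = \<one>\<^bsub>G\<^esub> \<Longrightarrow> free_reduce w \<in> relator_kernel n rs"
proof -
  interpret G: group G by fact
  let ?F = "free_group {..<n}" and ?P = "presented_group n rs"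
  interpret F: group ?F by (rule group_free_group)
  have rs: "set rs \<subseteq> words {..<n}" using assms(2) by (simp add: is_presentation_def)
  interpret N: normal "relator_kernel n rs" ?F by (rule relator_kernel_normal) fact
  interpret P: group ?P by (rule group_presented_group) fact
  obtain \<phi> where \<phi>: "\<phi> \<in> iso ?P G" using assms(2) by (auto simp: is_presentation_def is_iso_def)
  have hom: "\<phi> \<circ> relator_coset n rs \<in> hom ?F G"
    using relator_coset_hom[OF rs] \<phi> by (auto simp: iso_def intro: hom_compose)
  define f where "f i = \<phi> (relator_coset n rs [(i, True)])" for i
  have eval: "word_eval G f w = \<phi> (relator_coset n rs (free_reduce w))" if "w \<in> words {..<n}" for w
    using hom_free_reduce[OF assms(1) hom that] by (simp add: f_def[abs_def])
  have N: "relator_coset n rs w = relator_kernel n rs \<longleftrightarrow> w \<in> relator_kernel n rs" if "w \<in> carrier ?F" for w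
    using that F.coset_join1[OF _ that N.subgroup_axioms] F.coset_join2[OF that N.subgroup_axioms]
    by (auto simp: relator_coset_def)
  have gh: "group_hom ?P G \<phi>"
    using \<phi> by (auto simp: iso_def intro!: group_hom.intro group_hom_axioms.intro P.group_axioms G.group_axioms)
  have P_one: "\<one>\<^bsub>?P\<^esub> = relator_kernel n rs" by (simp add: presented_group_eq)
  have one: "\<phi> X = \<one>\<^bsub>G\<^esub> \<longleftrightarrow> X = relator_kernel n rs" if "X \<in> carrier ?P" for X
    using group_hom.iso_iff[OF gh, THEN iffD1, OF \<phi>] group_hom.hom_one[OF gh] that
    unfolding P_one by blast
  have cls: "relator_coset n rs w \<in> carrier ?P" if "w \<in> carrier ?F" for w
    using relator_coset_hom[OF rs] that by (auto simp: hom_def)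
  have eval_one: "word_eval G f w = \<one>\<^bsub>G\<^esub> \<longleftrightarrow> free_reduce w \<in> relator_kernel n rs" if "w \<in> words {..<n}" for w
    unfolding eval[OF that] using one[OF cls] N free_reduce_in_free_group[OF that] by blast
  show thesis
  proof
    show "f \<in> {..<n} \<rightarrow> carrier G"
    proof
      fix i assume "i \<in> {..<n}"
      then have "[(i, True)] \<in> carrier ?F" by (simp add: letter_word_in_free_group)
      then show "f i \<in> carrier G" using hom_in_carrier[OF hom] by (simp add: f_def)
    qed
    show "\<exists>w\<in>words {..<n}. word_eval G f w = g" if "g \<in> carrier G" for g
    proof -
      have "g \<in> \<phi> ` carrier ?P"
        using that group_hom.iso_iff[OF gh, THEN iffD1, OF \<phi>, THEN conjunct1] by (rule subsetD[rotated])
      then obtain X where "X \<in> carrier ?P" "\<phi> X = g" by (auto simp only: image_iff)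
      moreover from this(1) obtain w where "w \<in> carrier ?F" "X = relator_coset n rs w"
        unfolding presented_group_eq carrier_FactGroup relator_coset_def by blast
      moreover from this(1) have "w \<in> words {..<n}" "free_reduce w = w"
        by (auto simp: free_group_def free_reduce_reduced)
      ultimately show ?thesis using eval[of w] by metis
    qed
    show "word_eval G f r = \<one>\<^bsub>G\<^esub>" if "r \<in> set rs" for r
      using that rs normal_closure_superset[of "free_reduce ` set rs" ?F] eval_one[of r]
      unfolding relator_kernel_def by blast
    show "free_reduce w \<in> relator_kernel n rs" if "w \<in> words {..<n}" "word_eval G f w = \<one>\<^bsub>G\<^esub>" for w
      using that eval_one by blast
  qed (use rs in auto)
qed

lemma is_presentation_iso: "is_presentation G n rs \<Longrightarrow> G \<cong> H \<Longrightarrow> is_presentation H n rs"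
  unfolding is_presentation_def by (meson iso_trans)

section \<open>Simply connected complexes\<close>

text \<open>A 1-cocycle with coefficients in a possibly nonabelian group. Reversing an edge inverts
  its label and loops have trivial label, as if all cells with boundary of length one or two were
  present.\<close>

definition cocycle :: "('q, 'z) monoid_scheme \<Rightarrow> ('w \<times> 'w) set \<Rightarrow> ('w \<times> 'w \<times> 'w) set \<Rightarrow> ('w \<Rightarrow> 'w \<Rightarrow> 'q) \<Rightarrow> bool"
  where "cocycle Q E T h \<longleftrightarrow>
    (\<forall>(u, v)\<in>E. h u v \<in> carrier Q \<and> h u v \<otimes>\<^bsub>Q\<^esub> h v u = \<one>\<^bsub>Q\<^esub> \<and> (u = v \<longrightarrow> h u v = \<one>\<^bsub>Q\<^esub>)) \<and>
    (\<forall>(u, v, w)\<in>T. h u v \<otimes>\<^bsub>Q\<^esub> h v w = h u w)"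

lemma cocycle_mono: "cocycle Q E T h \<Longrightarrow> E' \<subseteq> E \<Longrightarrow> T' \<subseteq> T \<Longrightarrow> cocycle Q E' T' h"
  unfolding cocycle_def by (meson subsetD)

lemma cocycle_edge:
  "cocycle Q E T h \<Longrightarrow> (u, v) \<in> E \<Longrightarrow>
    h u v \<in> carrier Q \<and> h u v \<otimes>\<^bsub>Q\<^esub> h v u = \<one>\<^bsub>Q\<^esub> \<and> (u = v \<longrightarrow> h u v = \<one>\<^bsub>Q\<^esub>)"
  unfolding cocycle_def by blast

lemma cocycle_triangle:
  "cocycle Q E T h \<Longrightarrow> (u, v, w) \<in> T \<Longrightarrow> h u v \<otimes>\<^bsub>Q\<^esub> h v w = h u w"
  unfolding cocycle_def by blast

text \<open>A trivialisation of the cocycle, the analogue of a primitive of a closed form.\<close>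

definition potential :: "('q, 'z) monoid_scheme \<Rightarrow> 'w set \<Rightarrow> ('w \<times> 'w) set \<Rightarrow> ('w \<Rightarrow> 'w \<Rightarrow> 'q) \<Rightarrow> ('w \<Rightarrow> 'q) \<Rightarrow> bool"
  where "potential Q W E h p \<longleftrightarrow> p \<in> W \<rightarrow> carrier Q \<and> (\<forall>(u, v)\<in>E. p v = p u \<otimes>\<^bsub>Q\<^esub> h u v)"

text \<open>Simple connectivity is expressed as the vanishing of the first cohomology with coefficients in arbitrary, not
  necessarily abelian, groups.  HOL cannot quantify over the type of these groups; the one that is fixed here
  suffices, since it is the type of the groups given by presentations.\<close>

definition simply_connected :: "'w set \<Rightarrow> ('w \<times> 'w) set \<Rightarrow> ('w \<times> 'w \<times> 'w) set \<Rightarrow> bool"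
  where "simply_connected W E T \<longleftrightarrow> (\<forall>u\<in>W. \<forall>v\<in>W. (u, v) \<in> E\<^sup>*) \<and>
    (\<forall>(Q :: nat letter list set monoid) h. group Q \<longrightarrow> cocycle Q E T h \<longrightarrow> (\<exists>p. potential Q W E h p))"

section \<open>Cayley complexes and the holonomy of edge paths\<close>

definition cayley_edges :: "('a, 'c) monoid_scheme \<Rightarrow> 'a set \<Rightarrow> ('a \<times> 'a) set"
  where "cayley_edges G S = {(g, g \<otimes>\<^bsub>G\<^esub> s) | g s. g \<in> carrier G \<and> s \<in> S}"

definition cayley_triangles :: "('a, 'c) monoid_scheme \<Rightarrow> ('a \<times> 'a) set \<Rightarrow> ('a \<times> 'a \<times> 'a) set"
  where "cayley_triangles G P = {(g, g \<otimes>\<^bsub>G\<^esub> u, g \<otimes>\<^bsub>G\<^esub> v) | g u v. g \<in> carrier G \<and> (u, v) \<in> P}"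

lemma cayley_edgesI: "g \<in> carrier G \<Longrightarrow> s \<in> S \<Longrightarrow> (g, g \<otimes>\<^bsub>G\<^esub> s) \<in> cayley_edges G S"
  by (auto simp: cayley_edges_def)

lemma cayley_trianglesI:
  "g \<in> carrier G \<Longrightarrow> (u, v) \<in> P \<Longrightarrow> (g, g \<otimes>\<^bsub>G\<^esub> u, g \<otimes>\<^bsub>G\<^esub> v) \<in> cayley_triangles G P"
  by (auto simp: cayley_triangles_def)

lemma simply_connectedD:
  "simply_connected W E T \<Longrightarrow> u \<in> W \<Longrightarrow> v \<in> W \<Longrightarrow> (u, v) \<in> E\<^sup>*"
  by (simp add: simply_connected_def)

lemma simply_connected_potential:
  fixes Q :: "nat letter list set monoid"
  assumes "simply_connected W E T" "group Q" "cocycle Q E T h"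
  obtains p where "p \<in> W \<rightarrow> carrier Q" "\<And>u v. (u, v) \<in> E \<Longrightarrow> p v = p u \<otimes>\<^bsub>Q\<^esub> h u v"
proof -
  obtain p where "potential Q W E h p" using assms unfolding simply_connected_def by blast
  then show thesis using that unfolding potential_def by blast
qed

text \<open>The holonomy of \<open>h\<close> along the edge path of the Cayley graph that starts at
  \<open>g\<close> and spells \<open>w\<close>. Letters multiply on the right, which leaves
  multiplication on the left for the action of the group on the complex.\<close>

fun path_product :: "('a, 'c) monoid_scheme \<Rightarrow> ('q, 'z) monoid_scheme \<Rightarrow> ('a \<Rightarrow> 'a \<Rightarrow> 'q) \<Rightarrow> ('x \<Rightarrow> 'a) \<Rightarrow>
    'x letter list \<Rightarrow> 'a \<Rightarrow> 'q"
  where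
    "path_product G Q h f [] g = \<one>\<^bsub>Q\<^esub>"
  | "path_product G Q h f (l # w) g =
      h g (g \<otimes>\<^bsub>G\<^esub> letter_eval G f l) \<otimes>\<^bsub>Q\<^esub> path_product G Q h f w (g \<otimes>\<^bsub>G\<^esub> letter_eval G f l)"

context group
begin

context
  fixes Q :: "('q, 'z) monoid_scheme" and h :: "'a \<Rightarrow> 'a \<Rightarrow> 'q" and f :: "'x \<Rightarrow> 'a" and X :: "'x set"
  assumes Q: "group Q" and f: "f \<in> X \<rightarrow> carrier G"
    and h_closed: "\<And>g l. g \<in> carrier G \<Longrightarrow> fst l \<in> X \<Longrightarrow> h g (g \<otimes> letter_eval G f l) \<in> carrier Q"
    and h_inv: "\<And>g l. g \<in> carrier G \<Longrightarrow> fst l \<in> X \<Longrightarrow>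
      h g (g \<otimes> letter_eval G f l) \<otimes>\<^bsub>Q\<^esub> h (g \<otimes> letter_eval G f l) g = \<one>\<^bsub>Q\<^esub>"
begin

interpretation Q: group Q by (rule Q)

lemma path_product_closed:
  "w \<in> words X \<Longrightarrow> g \<in> carrier G \<Longrightarrow> path_product G Q h f w g \<in> carrier Q"
  by (induction w arbitrary: g) (auto simp: h_closed letter_eval_closed[OF f])

lemma path_product_append:
  "u \<in> words X \<Longrightarrow> v \<in> words X \<Longrightarrow> g \<in> carrier G \<Longrightarrow>
    path_product G Q h f (u @ v) g = path_product G Q h f u g \<otimes>\<^bsub>Q\<^esub> path_product G Q h f v (g \<otimes> word_eval G f u)"
  by (induction u arbitrary: g)
    (auto simp: Q.m_assoc m_assoc h_closed letter_eval_closed[OF f] word_eval_closed[OF f] path_product_closed)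

text \<open>Cancelling a letter against its inverse removes a piece of path that runs along an edge
  and straight back, and the two labels are inverse to each other.\<close>

lemma path_product_letter_mult:
  assumes "fst l \<in> X" "w \<in> words X" "g \<in> carrier G"
  shows "path_product G Q h f (letter_mult l w) g = path_product G Q h f (l # w) g"
proof (cases w)
  case (Cons k v)
  note closed = letter_eval_closed[OF f assms(1)]
  show ?thesis
  proof (cases "k = letter_inv l")
    case True
    have *: "g \<otimes> letter_eval G f l \<otimes> letter_eval G f k = g"
      using assms closed True by (simp add: letter_eval_inv[OF f] m_assoc)
    have "h (g \<otimes> letter_eval G f l) g \<in> carrier Q"
      using h_closed[of "g \<otimes> letter_eval G f l" k] assms closed * True by simp
    then show ?thesis
      using True Cons assms * h_inv[OF assms(3,1)] h_closed[OF assms(3,1)]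
      by (simp add: Q.m_assoc[symmetric] path_product_closed)
  qed (simp add: Cons)
qed simp

lemma path_product_foldr:
  "u \<in> words X \<Longrightarrow> v \<in> words X \<Longrightarrow> g \<in> carrier G \<Longrightarrow>
    path_product G Q h f (foldr letter_mult u v) g = path_product G Q h f (u @ v) g"
  by (induction u arbitrary: g)
    (auto simp: path_product_letter_mult words_foldr letter_eval_closed[OF f])

text \<open>Conjugating a word moves the starting point of its loop, so the condition is invariant
  under conjugation only if trivial holonomy is required from every starting point. Once the
  relators satisfy it, their whole normal closure does.\<close>

lemma path_product_normal:
  "{w \<in> carrier (free_group X). word_eval G f w = \<one> \<and> (\<forall>g\<in>carrier G. path_product G Q h f w g = \<one>\<^bsub>Q\<^esub>)}
    \<lhd> free_group X" (is "?N \<lhd> ?F")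
proof -
  interpret F: group ?F by (rule group_free_group)
  interpret hom: group_hom ?F G "word_eval G f"
    using word_eval_hom[OF f] by (simp add: group_hom_def group_hom_axioms_def group_free_group)
  have words: "w \<in> words X" if "w \<in> carrier ?F" for w
    using that by (simp add: free_group_def)
  have mult: "path_product G Q h f (u \<otimes>\<^bsub>?F\<^esub> v) g
      = path_product G Q h f u g \<otimes>\<^bsub>Q\<^esub> path_product G Q h f v (g \<otimes> word_eval G f u)"
    if "u \<in> carrier ?F" "v \<in> carrier ?F" "g \<in> carrier G" for u v g
  proof -
    have "u \<otimes>\<^bsub>?F\<^esub> v = foldr letter_mult u v" by (simp add: free_group_def)
    then show ?thesis
      using path_product_foldr path_product_append words that by metis
  qed
  have one: "path_product G Q h f \<one>\<^bsub>?F\<^esub> g = \<one>\<^bsub>Q\<^esub>" for g by (simp add: free_group_def)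
  show ?thesis unfolding F.normal_inv_iff
  proof (intro conjI ballI F.subgroupI)
    show "?N \<noteq> {}" using one F.one_closed hom.hom_one by blast
  next
    fix u assume u: "u \<in> ?N"
    then have "path_product G Q h f (inv\<^bsub>?F\<^esub> u) g = \<one>\<^bsub>Q\<^esub>" if "g \<in> carrier G" for g
      using that mult[of "inv\<^bsub>?F\<^esub> u" u g] one[of g] path_product_closed[OF words, of "inv\<^bsub>?F\<^esub> u" g]
      by simp
    then show "inv\<^bsub>?F\<^esub> u \<in> ?N" using u by simp
  next
    fix u v assume "u \<in> ?N" "v \<in> ?N"
    then show "u \<otimes>\<^bsub>?F\<^esub> v \<in> ?N" by (simp add: mult)
  next
    fix x u assume x: "x \<in> carrier ?F" and u: "u \<in> ?N"
    have "path_product G Q h f (x \<otimes>\<^bsub>?F\<^esub> u \<otimes>\<^bsub>?F\<^esub> inv\<^bsub>?F\<^esub> x) g = \<one>\<^bsub>Q\<^esub>" if g: "g \<in> carrier G" for g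
    proof -
      have "path_product G Q h f (x \<otimes>\<^bsub>?F\<^esub> u \<otimes>\<^bsub>?F\<^esub> inv\<^bsub>?F\<^esub> x) g
          = path_product G Q h f (x \<otimes>\<^bsub>?F\<^esub> inv\<^bsub>?F\<^esub> x) g"
        using x u g path_product_closed[OF words, of x g] mult[of x "inv\<^bsub>?F\<^esub> x" g, symmetric]
        by (simp add: mult del: F.r_inv)
      then show ?thesis using x one by simp
    qed
    then show "x \<otimes>\<^bsub>?F\<^esub> u \<otimes>\<^bsub>?F\<^esub> inv\<^bsub>?F\<^esub> x \<in> ?N" using x u by simp
  qed auto
qed

lemma path_product_snoc:
  "u \<in> words X \<Longrightarrow> fst l \<in> X \<Longrightarrow> g \<in> carrier G \<Longrightarrow> path_product G Q h f (u @ [l]) g =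
    path_product G Q h f u g \<otimes>\<^bsub>Q\<^esub> h (g \<otimes> word_eval G f u) (g \<otimes> word_eval G f (u @ [l]))"
  using path_product_append[of u "[l]" g] h_closed[of "g \<otimes> word_eval G f u" l]
  by (simp add: word_eval_append[OF f] word_eval_closed[OF f] letter_eval_closed[OF f] m_assoc)

text \<open>Each triangle of the fan replaces a diagonal and the following edge by the next diagonal
  from \<open>g\<close>.\<close>

lemma path_product_fan:
  assumes g: "g \<in> carrier G" and r: "r \<in> words X"
    and tri: "\<And>i. 1 \<le> i \<Longrightarrow> i + 2 \<le> length r \<Longrightarrow>
      h g (g \<otimes> word_eval G f (take i r)) \<otimes>\<^bsub>Q\<^esub> h (g \<otimes> word_eval G f (take i r)) (g \<otimes> word_eval G f (take (Suc i) r))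
        = h g (g \<otimes> word_eval G f (take (Suc i) r))"
  shows "1 \<le> i \<Longrightarrow> i < length r \<Longrightarrow>
    path_product G Q h f (take i r) g = h g (g \<otimes> word_eval G f (take i r))"
proof (induction i rule: dec_induct)
  case base
  then obtain l r' where "r = l # r'" by (cases r) auto
  then show ?case using r h_closed[of g l] g by (simp add: letter_eval_closed[OF f])
next
  case (step i)
  then have "take (Suc i) r = take i r @ [r ! i]" by (simp add: take_Suc_conv_app_nth)
  then show ?case
    using step path_product_snoc[of "take i r" "r ! i" g] tri[of i] words_take[OF r] words_nth[OF r] g
    by simp
qed

text \<open>All but the last edge of the loop are replaced by a single diagonal, along which the
  last edge runs back. For a loop of length one there is no diagonal, and \<open>loop\<close> makes
  its label trivial.\<close>

lemma path_product_relator: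
  assumes g: "g \<in> carrier G" and r: "r \<in> words X" "word_eval G f r = \<one>"
    and tri: "\<And>i. 1 \<le> i \<Longrightarrow> i + 2 \<le> length r \<Longrightarrow>
      h g (g \<otimes> word_eval G f (take i r)) \<otimes>\<^bsub>Q\<^esub> h (g \<otimes> word_eval G f (take i r)) (g \<otimes> word_eval G f (take (Suc i) r))
        = h g (g \<otimes> word_eval G f (take (Suc i) r))"
    and diag: "\<And>i. 1 \<le> i \<Longrightarrow> i < length r \<Longrightarrow>
      h g (g \<otimes> word_eval G f (take i r)) \<otimes>\<^bsub>Q\<^esub> h (g \<otimes> word_eval G f (take i r)) g = \<one>\<^bsub>Q\<^esub>"
    and loop: "\<And>l. fst l \<in> X \<Longrightarrow> letter_eval G f l = \<one> \<Longrightarrow> h g g = \<one>\<^bsub>Q\<^esub>"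
  shows "path_product G Q h f r g = \<one>\<^bsub>Q\<^esub>"
proof (cases r rule: rev_cases)
  case (snoc u l)
  then have ul: "u \<in> words X" "fst l \<in> X" using r by auto
  have last: "path_product G Q h f r g = path_product G Q h f u g \<otimes>\<^bsub>Q\<^esub> h (g \<otimes> word_eval G f u) g"
    using path_product_snoc[OF ul g] r g snoc by simp
  show ?thesis
  proof (cases "u = []")
    case True
    then have "letter_eval G f l = \<one>" using r snoc ul by (simp add: letter_eval_closed[OF f])
    then show ?thesis using last True loop[OF ul(2)] g by simp
  next
    case False
    have "1 \<le> length u" "length u < length r" "take (length u) r = u"
      using False snoc by (auto simp: Suc_le_eq)
    then show ?thesis using last path_product_fan[OF g r(1) tri, of "length u"] diag[of "length u"] by simp
  qed
qed simp

text \<open>The value at \<open>g\<close> is the holonomy along any word that leads from \<one> to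
  \<open>g\<close>; two such words differ by a loop, whose holonomy is trivial by
  assumption.\<close>

lemma path_product_potential:
  assumes surj: "\<And>g. g \<in> carrier G \<Longrightarrow> \<exists>w\<in>words X. word_eval G f w = g"
    and trivial: "\<And>w. w \<in> words X \<Longrightarrow> word_eval G f w = \<one> \<Longrightarrow> path_product G Q h f w \<one> = \<one>\<^bsub>Q\<^esub>"
  obtains p where "p \<in> carrier G \<rightarrow> carrier Q"
    "\<And>g w. g \<in> carrier G \<Longrightarrow> w \<in> words X \<Longrightarrow> p (g \<otimes> word_eval G f w) = p g \<otimes>\<^bsub>Q\<^esub> path_product G Q h f w g"
proof -
  obtain wd where wd: "\<And>g. g \<in> carrier G \<Longrightarrow> wd g \<in> words X" "\<And>g. g \<in> carrier G \<Longrightarrow> word_eval G f (wd g) = g"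
    using surj by metis
  note [simp] = word_eval_closed[OF f] word_eval_append[OF f]
  have eq: "path_product G Q h f u \<one> = path_product G Q h f v \<one>"
    if uv: "u \<in> words X" "v \<in> words X" "word_eval G f u = word_eval G f v" for u v
  proof -
    \<comment> \<open>Both words are closed up by the same return path, whose holonomy is cancelled
      afterwards.\<close>
    let ?v = "wd (inv word_eval G f v)"
    have v: "?v \<in> words X" "word_eval G f ?v = inv word_eval G f v" using wd uv by auto
    have "path_product G Q h f (u @ ?v) \<one> = \<one>\<^bsub>Q\<^esub>" "path_product G Q h f (v @ ?v) \<one> = \<one>\<^bsub>Q\<^esub>"
      using uv v by (auto intro!: trivial)
    then show ?thesis
      using uv v path_product_closed[of ?v "word_eval G f v"] path_product_closed[of u \<one>] path_product_closed[of v \<one>]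
      by (simp add: path_product_append) (metis Q.right_cancel)
  qed
  show thesis
  proof
    show "(\<lambda>g. path_product G Q h f (wd g) \<one>) \<in> carrier G \<rightarrow> carrier Q"
      using wd by (auto intro: path_product_closed)
    fix g w assume "g \<in> carrier G" "w \<in> words X"
    then show "path_product G Q h f (wd (g \<otimes> word_eval G f w)) \<one>
        = path_product G Q h f (wd g) \<one> \<otimes>\<^bsub>Q\<^esub> path_product G Q h f w g"
      using eq[of "wd (g \<otimes> word_eval G f w)" "wd g @ w"] wd by (simp add: path_product_append)
  qed
qed

end

end

lemma card_UN_set_le_sum_list:
  "card (\<Union>x\<in>set xs. A x) \<le> (\<Sum>x\<leftarrow>xs. card (A x))"
proof (induction xs)
  case (Cons x xs)
  then show ?case using card_Un_le[of "A x" "\<Union>x\<in>set xs. A x"] by simp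
qed simp

lemma (in group) sym_cayley_edges:
  assumes "S \<subseteq> carrier G" "\<And>s. s \<in> S \<Longrightarrow> inv s \<in> S"
  shows "sym (cayley_edges G S)"
proof (rule symI)
  fix u v assume "(u, v) \<in> cayley_edges G S"
  then obtain s where s: "u \<in> carrier G" "s \<in> S" "v = u \<otimes> s" by (auto simp: cayley_edges_def)
  then have "s \<in> carrier G" using assms by auto
  then have "u = v \<otimes> inv s" "v \<in> carrier G" using s by (auto simp: m_assoc)
  then show "(v, u) \<in> cayley_edges G S" using assms(2)[OF s(2)] cayley_edgesI by metis
qed

text \<open>A relator of length \<open>k \<ge> 3\<close> is filled by a fan of \<open>k - 2\<close> triangles with apex at its starting point,
  while shorter relators only identify or invert edges, which is built into \<^const>\<open>cocycle\<close>.\<close>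

theorem (in group) presentation_complex:
  assumes "is_presentation G n rs"
  obtains S P where "finite S" "S \<subseteq> carrier G" "\<And>s. s \<in> S \<Longrightarrow> inv s \<in> S"
    "finite P" "card P \<le> (\<Sum>r\<leftarrow>rs. length r - 2)"
    "\<And>u v. (u, v) \<in> P \<Longrightarrow> u \<in> S \<and> v \<in> S \<and> inv u \<otimes> v \<in> S"
    "simply_connected (carrier G) (cayley_edges G S) (cayley_triangles G P)"
proof -
  obtain f where f: "f \<in> {..<n} \<rightarrow> carrier G" and rs: "set rs \<subseteq> words {..<n}"
    and surj: "\<And>g. g \<in> carrier G \<Longrightarrow> \<exists>w\<in>words {..<n}. word_eval G f w = g"
    and rel: "\<And>r. r \<in> set rs \<Longrightarrow> word_eval G f r = \<one>"
    and ker: "\<And>w. w \<in> words {..<n} \<Longrightarrow> word_eval G f w = \<one> \<Longrightarrow> free_reduce w \<in> relator_kernel n rs"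
    using is_presentationE[OF group_axioms assms] by metis
  note [simp] = word_eval_closed[OF f] letter_eval_closed[OF f]
  \<comment> \<open>The letters give the edges of the Cayley graph, the proper nonempty prefixes of
    relators the diagonals of the fans.\<close>
  define U where "U = (\<lambda>l. [l]) ` ({..<n} \<times> UNIV) \<union> (\<Union>r\<in>set rs. (\<lambda>i. take i r) ` {1..<length r})"
  define S0 where "S0 = word_eval G f ` U"
  define S where "S = S0 \<union> m_inv G ` S0"
  \<comment> \<open>For a relator of length \<open>k\<close> the index runs from 1 to
    \<open>k - 2\<close>; the third side of the triangle is a letter. For \<open>k\<close> at most 2
    the interval is empty.\<close>
  define P where "P = (\<Union>r\<in>set rs. (\<lambda>i. (word_eval G f (take i r), word_eval G f (take (Suc i) r))) ` {1..<length r - 1})"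
  let ?E = "cayley_edges G S" and ?T = "cayley_triangles G P"
  have U: "U \<subseteq> words {..<n}" using rs by (auto simp: U_def intro: words_take)
  have S0: "S0 \<subseteq> carrier G" "S0 \<subseteq> S" using U by (auto simp: S0_def S_def)
  have S: "S \<subseteq> carrier G" "finite S" using S0(1) by (auto simp: S_def) (simp_all add: S0_def U_def)
  have S_inv: "inv s \<in> S" if "s \<in> S" for s using that S0 by (auto simp: S_def)
  have S_letter: "letter_eval G f l \<in> S0" if "fst l < n" for l
  proof -
    have "[l] \<in> U" using that by (cases l) (auto simp: U_def)
    moreover have "word_eval G f [l] = letter_eval G f l" using that by simp
    ultimately show ?thesis unfolding S0_def by (metis imageI)
  qed
  have S_take: "word_eval G f (take i r) \<in> S0" if "r \<in> set rs" "1 \<le> i" "i < length r" for i r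
    unfolding S0_def U_def using that by (intro imageI UnI2 UN_I) auto
  have P: "u \<in> S \<and> v \<in> S \<and> inv u \<otimes> v \<in> S" if "(u, v) \<in> P" for u v
  proof -
    obtain r i where r: "r \<in> set rs" "1 \<le> i" "i < length r - 1"
      "u = word_eval G f (take i r)" "v = word_eval G f (take (Suc i) r)"
      using \<open>(u, v) \<in> P\<close> by (auto simp: P_def)
    have rw: "r \<in> words {..<n}" using r rs by auto
    have "take (Suc i) r = take i r @ [r ! i]" using r by (simp add: take_Suc_conv_app_nth)
    then have "v = u \<otimes> letter_eval G f (r ! i)"
      using r words_take[OF rw] words_nth[OF rw, of i] by (simp add: word_eval_append[OF f])
    then have "inv u \<otimes> v = letter_eval G f (r ! i)"
      using r words_take[OF rw] words_nth[OF rw, of i] by (simp add: m_assoc[symmetric])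
    then show ?thesis using r S_take[OF r(1), of i] S_take[OF r(1), of "Suc i"] S_letter[of "r ! i"] words_nth[OF rw, of i] S0
      by auto
  qed
  have "card P \<le> (\<Sum>r\<leftarrow>rs. card ((\<lambda>i. (word_eval G f (take i r), word_eval G f (take (Suc i) r))) ` {1..<length r - 1}))"
    unfolding P_def by (rule card_UN_set_le_sum_list)
  also have "\<dots> \<le> (\<Sum>r\<leftarrow>rs. length r - 2)"
    by (intro sum_list_mono order_trans[OF card_image_le]) auto
  finally have card_P: "card P \<le> (\<Sum>r\<leftarrow>rs. length r - 2)" .
  have walk: "(g, g \<otimes> word_eval G f w) \<in> ?E\<^sup>*" if "w \<in> words {..<n}" "g \<in> carrier G" for g w
    using that
  proof (induction w arbitrary: g)
    case (Cons l w)
    then have "(g, g \<otimes> letter_eval G f l) \<in> ?E" using S_letter[of l] S0 by (auto intro!: cayley_edgesI)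
    moreover have "(g \<otimes> letter_eval G f l, g \<otimes> letter_eval G f l \<otimes> word_eval G f w) \<in> ?E\<^sup>*"
      using Cons by auto
    ultimately show ?case using Cons.prems by (simp add: m_assoc)
  qed simp
  have "simply_connected (carrier G) ?E ?T"
    unfolding simply_connected_def
  proof (intro conjI ballI allI impI)
    fix u v assume uv: "u \<in> carrier G" "v \<in> carrier G"
    obtain w where "w \<in> words {..<n}" "word_eval G f w = inv u \<otimes> v" using surj uv by blast
    then show "(u, v) \<in> ?E\<^sup>*" using walk[of w u] uv by (simp add: m_assoc[symmetric])
  next
    fix Q :: "nat letter list set monoid" and h assume Q: "group Q" and h: "cocycle Q ?E ?T h"
    interpret Q: group Q by fact
    have hE: "h u v \<in> carrier Q" "h u v \<otimes>\<^bsub>Q\<^esub> h v u = \<one>\<^bsub>Q\<^esub>" "u = v \<Longrightarrow> h u v = \<one>\<^bsub>Q\<^esub>" if "(u, v) \<in> ?E" for u v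
      using that h by (auto simp: cocycle_def)
    have hT: "h u v \<otimes>\<^bsub>Q\<^esub> h v w = h u w" if "(u, v, w) \<in> ?T" for u v w
      using that h by (auto simp: cocycle_def)
    have E0: "(g, g \<otimes> s) \<in> ?E" if "g \<in> carrier G" "s \<in> S0" for g s
      using that S0 by (auto intro: cayley_edgesI)
    have h1: "h g (g \<otimes> letter_eval G f l) \<in> carrier Q"
      and h2: "h g (g \<otimes> letter_eval G f l) \<otimes>\<^bsub>Q\<^esub> h (g \<otimes> letter_eval G f l) g = \<one>\<^bsub>Q\<^esub>"
      if "g \<in> carrier G" "fst l \<in> {..<n}" for g l
      using that by (auto intro!: hE E0 S_letter)
    have tri: "h g (g \<otimes> word_eval G f (take i r)) \<otimes>\<^bsub>Q\<^esub> h (g \<otimes> word_eval G f (take i r)) (g \<otimes> word_eval G f (take (Suc i) r))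
        = h g (g \<otimes> word_eval G f (take (Suc i) r))"
      if "r \<in> set rs" "g \<in> carrier G" "1 \<le> i" "i + 2 \<le> length r" for r i g
    proof (intro hT cayley_trianglesI that)
      have "i \<in> {1..<length r - 1}" using that by auto
      then show "(word_eval G f (take i r), word_eval G f (take (Suc i) r)) \<in> P"
        unfolding P_def using \<open>r \<in> set rs\<close> by blast
    qed
    have rel_one: "path_product G Q h f r g = \<one>\<^bsub>Q\<^esub>" if "r \<in> set rs" "g \<in> carrier G" for r g
    proof (rule path_product_relator[OF Q f h1 h2 that(2)])
      show "r \<in> words {..<n}" "word_eval G f r = \<one>" using that rs rel by auto
      show "h g (g \<otimes> word_eval G f (take i r)) \<otimes>\<^bsub>Q\<^esub> h (g \<otimes> word_eval G f (take i r)) g = \<one>\<^bsub>Q\<^esub>"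
        if "1 \<le> i" "i < length r" for i
        by (intro hE E0 S_take that \<open>r \<in> set rs\<close> \<open>g \<in> carrier G\<close>)
      show "h g g = \<one>\<^bsub>Q\<^esub>" if "fst l \<in> {..<n}" "letter_eval G f l = \<one>" for l
        using hE(3)[OF E0, of g "letter_eval G f l"] S_letter[of l] that \<open>g \<in> carrier G\<close> by simp
    qed (use tri that in auto)
    \<comment> \<open>The words that are trivial in \<open>G\<close> and have trivial holonomy from
      everywhere form a normal subgroup. It contains the relators, hence all words that are trivial
      in \<open>G\<close>, after free reduction.\<close>
    let ?N = "{w \<in> carrier (free_group {..<n}). word_eval G f w = \<one> \<and> (\<forall>g\<in>carrier G. path_product G Q h f w g = \<one>\<^bsub>Q\<^esub>)}"
    have pp_reduce: "path_product G Q h f (free_reduce w) g = path_product G Q h f w g"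
      if "w \<in> words {..<n}" "g \<in> carrier G" for w g
      using path_product_foldr[OF Q f h1 h2 that(1) _ that(2), of "[]"] by (simp add: free_reduce_def)
    have "relator_kernel n rs \<subseteq> ?N"
      unfolding relator_kernel_def
    proof (rule normal_closure_minimal)
      show "?N \<lhd> free_group {..<n}" using path_product_normal[OF Q f h1 h2] by simp
      show "free_reduce ` set rs \<subseteq> ?N"
        using rs rel rel_one by (auto simp: word_eval_free_reduce[OF f] pp_reduce subset_eq intro: free_reduce_in_free_group)
    qed
    then have trivial: "path_product G Q h f w \<one> = \<one>\<^bsub>Q\<^esub>" if "w \<in> words {..<n}" "word_eval G f w = \<one>" for w
      using ker[OF that] pp_reduce[OF that(1) one_closed] by blast
    obtain p where p: "p \<in> carrier G \<rightarrow> carrier Q" and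
      p_word: "\<And>g w. g \<in> carrier G \<Longrightarrow> w \<in> words {..<n} \<Longrightarrow>
        p (g \<otimes> word_eval G f w) = p g \<otimes>\<^bsub>Q\<^esub> path_product G Q h f w g"
      using path_product_potential[OF Q f h1 h2 surj trivial] by metis
    have pp_U: "path_product G Q h f u g = h g (g \<otimes> word_eval G f u)" if "u \<in> U" "g \<in> carrier G" for u g
    proof -
      consider l where "u = [l]" "fst l \<in> {..<n}"
        | r i where "r \<in> set rs" "1 \<le> i" "i < length r" "u = take i r"
        using \<open>u \<in> U\<close> by (auto simp: U_def)
      then show ?thesis
      proof cases
        case 1
        then show ?thesis using h1[OF that(2)] by simp
      next
        case 2
        then show ?thesis using path_product_fan[OF Q f h1 h2 that(2), of r i] tri[OF 2(1) that(2)] rs by auto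
      qed
    qed
    have p_S0: "p (g \<otimes> s) = p g \<otimes>\<^bsub>Q\<^esub> h g (g \<otimes> s)" if "g \<in> carrier G" "s \<in> S0" for g s
      using that p_word pp_U U by (auto simp: S0_def)
    have "p v = p u \<otimes>\<^bsub>Q\<^esub> h u v" if "(u, v) \<in> ?E" for u v
    proof -
      obtain s where s: "u \<in> carrier G" "s \<in> S" "v = u \<otimes> s" using \<open>(u, v) \<in> ?E\<close> by (auto simp: cayley_edges_def)
      show ?thesis
      proof (cases "s \<in> S0")
        case True
        then show ?thesis using p_S0 s by simp
      next
        case False
        \<comment> \<open>The edge is the reverse of one that belongs to \<open>S0\<close>, for
          which the equation is already known.\<close>
        then obtain t where t: "t \<in> S0" "s = inv t" using s by (auto simp: S_def)
        then have tc: "t \<in> carrier G" using S0 by auto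
        then have uv: "u = v \<otimes> t" "v \<in> carrier G" using s t by (auto simp: m_assoc)
        then have "p u = p v \<otimes>\<^bsub>Q\<^esub> h v u" using p_S0[of v t] t by simp
        moreover have "(v, u) \<in> ?E" using E0[of v t] t uv by simp
        moreover have "p v \<in> carrier Q" using p uv by auto
        ultimately show ?thesis
          using hE(1,2)[of v u] hE(1)[OF that] by (simp add: Q.m_assoc)
      qed
    qed
    then show "\<exists>p. potential Q (carrier G) ?E h p"
      unfolding potential_def using p by blast
  qed
  then show thesis using that[of S P] S S_inv P card_P by (simp add: P_def)
qed

section \<open>Collapsing complexes\<close>

lemma rtrancl_escape:
  assumes "(u, v) \<in> E\<^sup>*" "u \<in> D" "v \<notin> D"
  obtains x y where "(x, y) \<in> E" "x \<in> D" "y \<notin> D"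
  using assms by (induction rule: rtrancl_induct) blast+

text \<open>Collapsing the complex along edges that do not change the value of \<open>q\<close>, and then along a maximal
  tree of orbits of the resulting vertices, leaves a complex whose vertex set is \<open>G\<close> itself.\<close>

locale collapse = group G for G (structure) +
  fixes act :: "'a \<Rightarrow> 'w \<Rightarrow> 'w" and W :: "'w set" and E :: "('w \<times> 'w) set"
    and T :: "('w \<times> 'w \<times> 'w) set" and q :: "'w \<Rightarrow> 's"
  assumes act_closed: "g \<in> carrier G \<Longrightarrow> w \<in> W \<Longrightarrow> act g w \<in> W"
    and act_one: "w \<in> W \<Longrightarrow> act \<one> w = w"
    and act_mult: "g \<in> carrier G \<Longrightarrow> g' \<in> carrier G \<Longrightarrow> w \<in> W \<Longrightarrow> act (g \<otimes> g') w = act g (act g' w)"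
    and E_subset: "E \<subseteq> W \<times> W" and E_sym: "sym E"
    and E_act: "g \<in> carrier G \<Longrightarrow> (u, v) \<in> E \<Longrightarrow> (act g u, act g v) \<in> E"
    and T_edges: "(u, v, w) \<in> T \<Longrightarrow> (u, v) \<in> E \<and> (v, w) \<in> E \<and> (u, w) \<in> E"
    and W_nonempty: "W \<noteq> {}"
    and simply_connected: "simply_connected W E T"
    and q_act: "g \<in> carrier G \<Longrightarrow> u \<in> W \<Longrightarrow> v \<in> W \<Longrightarrow> q u = q v \<Longrightarrow> q (act g u) = q (act g v)"
    and q_free: "g \<in> carrier G \<Longrightarrow> w \<in> W \<Longrightarrow> q (act g w) = q w \<Longrightarrow> g = \<one>"
begin

lemma act_inv:
  "g \<in> carrier G \<Longrightarrow> w \<in> W \<Longrightarrow> act (inv g) (act g w) = w"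
  "g \<in> carrier G \<Longrightarrow> w \<in> W \<Longrightarrow> act g (act (inv g) w) = w"
  by (simp_all add: act_mult[symmetric] act_one)

section \<open>Trees of orbits\<close>

definition flat_edges :: "('w \<times> 'w) set"
  where "flat_edges = {(u, v) \<in> E. q u = q v}"

definition saturated :: "'w set \<Rightarrow> bool"
  where "saturated D \<longleftrightarrow> flat_edges `` D \<subseteq> D"

text \<open>A connected union of flat components that contains at most one point of every orbit. It
  is a tree only in the sense that it grows by one flat component at a time; the subgraph induced on
  \<open>D\<close> may have cycles.\<close>

definition tree_from :: "'w \<Rightarrow> 'w set \<Rightarrow> bool"
  where "tree_from w0 D \<longleftrightarrow> w0 \<in> D \<and> D \<subseteq> W \<and> saturated D \<and> (\<forall>d\<in>D. (w0, d) \<in> (E \<inter> D \<times> D)\<^sup>*) \<and>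
    (\<forall>g\<in>carrier G. \<forall>d\<in>D. act g d \<in> D \<longrightarrow> g = \<one>)"

lemma flat_edges_sym: "sym flat_edges"
  unfolding flat_edges_def sym_def using symD[OF E_sym] by fastforce

lemma flat_edges_act: "g \<in> carrier G \<Longrightarrow> (u, v) \<in> flat_edges \<Longrightarrow> (act g u, act g v) \<in> flat_edges"
proof -
  assume g: "g \<in> carrier G" and "(u, v) \<in> flat_edges"
  then have uv: "(u, v) \<in> E" "q u = q v" by (auto simp: flat_edges_def)
  then have "u \<in> W" "v \<in> W" using E_subset by auto
  then show ?thesis using E_act[OF g uv(1)] q_act[OF g _ _ uv(2)] by (simp add: flat_edges_def)
qed

lemma flat_component:
  assumes "v \<in> W" "x \<in> flat_edges\<^sup>* `` {v}"
  shows "x \<in> W" "q x = q v" "(v, x) \<in> (E \<inter> (flat_edges\<^sup>* `` {v}) \<times> (flat_edges\<^sup>* `` {v}))\<^sup>*"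
proof -
  have "(v, x) \<in> flat_edges\<^sup>*" using assms(2) by auto
  then have "x \<in> W \<and> q x = q v \<and> (v, x) \<in> (E \<inter> (flat_edges\<^sup>* `` {v}) \<times> (flat_edges\<^sup>* `` {v}))\<^sup>*"
  proof (induction rule: rtrancl_induct)
    case base
    then show ?case using assms(1) by simp
  next
    case (step y z)
    have "(y, z) \<in> E \<inter> (flat_edges\<^sup>* `` {v}) \<times> (flat_edges\<^sup>* `` {v})"
      using step(1,2) rtrancl_into_rtrancl[OF step(1,2)] by (auto simp: flat_edges_def)
    then show ?case using step(2,3) E_subset by (auto simp: flat_edges_def intro: rtrancl_into_rtrancl)
  qed
  then show "x \<in> W" "q x = q v" "(v, x) \<in> (E \<inter> (flat_edges\<^sup>* `` {v}) \<times> (flat_edges\<^sup>* `` {v}))\<^sup>*" by auto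
qed

lemma saturated_rtrancl:
  assumes "saturated D" "(u, v) \<in> flat_edges\<^sup>*"
  shows "u \<in> D \<longleftrightarrow> v \<in> D"
  using assms(2)
proof (induction rule: rtrancl_induct)
  case (step y z)
  then show ?case using symD[OF flat_edges_sym] assms(1) unfolding saturated_def by blast
qed simp

text \<open>The map \<open>q\<close> is constant on a flat component, so an element that moves a
  point within it preserves the value of \<open>q\<close> and is trivial by
  \<open>q_free\<close>.\<close>

lemma tree_from_component:
  assumes "w0 \<in> W"
  shows "tree_from w0 (flat_edges\<^sup>* `` {w0})"
  unfolding tree_from_def
proof (intro conjI ballI impI)
  show "saturated (flat_edges\<^sup>* `` {w0})" by (auto simp: saturated_def)
  show "g = \<one>" if "g \<in> carrier G" "d \<in> flat_edges\<^sup>* `` {w0}" "act g d \<in> flat_edges\<^sup>* `` {w0}" for g d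
    using that flat_component[OF assms] q_free by metis
qed (use flat_component[OF assms] in auto)

lemma tree_from_extend:
  assumes D: "tree_from w0 D" and uv: "(u, v) \<in> E" "u \<in> D" and v: "\<And>g. g \<in> carrier G \<Longrightarrow> act g v \<notin> D"
  shows "tree_from w0 (D \<union> flat_edges\<^sup>* `` {v})"
proof -
  have vW: "v \<in> W" using uv E_subset by auto
  note comp = flat_component[OF vW]
  let ?D = "D \<union> flat_edges\<^sup>* `` {v}"
  have sat: "saturated D" and DW: "D \<subseteq> W" using D by (auto simp: tree_from_def)
  \<comment> \<open>Saturation spreads the assumption on \<open>v\<close> to its flat component: a
    translate of the component that meets \<open>D\<close> would lie inside
    \<open>D\<close>.\<close>
  have out: "act g x \<notin> D" if "g \<in> carrier G" "x \<in> flat_edges\<^sup>* `` {v}" for g x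
  proof -
    have "(v, x) \<in> flat_edges\<^sup>*" using that by auto
    then have "(act g v, act g x) \<in> flat_edges\<^sup>*"
      by (induction rule: rtrancl_induct) (auto intro: rtrancl_into_rtrancl flat_edges_act that)
    then show ?thesis using saturated_rtrancl[OF sat] v that by blast
  qed
  show ?thesis
    unfolding tree_from_def
  proof (intro conjI ballI impI)
    show "saturated ?D" using sat by (auto simp: saturated_def)
    show "w0 \<in> ?D" using D by (auto simp: tree_from_def)
    show "?D \<subseteq> W" using comp DW by auto
    fix d assume d: "d \<in> ?D"
    have D_path: "(w0, x) \<in> (E \<inter> ?D \<times> ?D)\<^sup>*" if "x \<in> D" for x
      using D that rtrancl_mono[of "E \<inter> D \<times> D" "E \<inter> ?D \<times> ?D"] by (auto simp: tree_from_def)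
    show "(w0, d) \<in> (E \<inter> ?D \<times> ?D)\<^sup>*"
    proof (cases "d \<in> D")
      case False
      then have "(v, d) \<in> (E \<inter> ?D \<times> ?D)\<^sup>*"
        using d comp(3)[of d] rtrancl_mono[of "E \<inter> flat_edges\<^sup>* `` {v} \<times> flat_edges\<^sup>* `` {v}" "E \<inter> ?D \<times> ?D"]
        by auto
      moreover have "(u, v) \<in> E \<inter> ?D \<times> ?D" using uv by auto
      ultimately show ?thesis using D_path[OF uv(2)] by (meson rtrancl_trans converse_rtrancl_into_rtrancl)
    qed (rule D_path)
    fix g assume g: "g \<in> carrier G" "act g d \<in> ?D"
    show "g = \<one>"
    proof (cases "d \<in> D")
      case True
      show ?thesis
      proof (cases "act g d \<in> D")
        case True
        then show ?thesis using D \<open>d \<in> D\<close> g by (auto simp: tree_from_def)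
      next
        case False
        then have "act (inv g) (act g d) \<notin> D" using g out by auto
        then show ?thesis using True DW g by (auto simp: act_inv)
      qed
    next
      case False
      then have "d \<in> flat_edges\<^sup>* `` {v}" "act g d \<in> flat_edges\<^sup>* `` {v}" using d g out by auto
      then show ?thesis using comp q_free g by metis
    qed
  qed
qed

text \<open>A maximal tree, obtained from Zorn's lemma, meets every orbit. Otherwise some path in
  \<open>W\<close> leaves the union of the translates of the tree, and a translate of the edge along
  which it leaves extends the tree.\<close>

lemma transversal_tree:
  assumes "w0 \<in> W"
  obtains D where "tree_from w0 D" "\<And>w. w \<in> W \<Longrightarrow> \<exists>g\<in>carrier G. act g w \<in> D"
proof -
  have "\<exists>D\<in>Collect (tree_from w0). \<forall>D'\<in>Collect (tree_from w0). D \<subseteq> D' \<longrightarrow> D' = D"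
  proof (rule subset_Zorn_nonempty)
    show "Collect (tree_from w0) \<noteq> {}" using tree_from_component[OF assms] by blast
    fix \<C> assume \<C>: "\<C> \<noteq> {}" "subset.chain (Collect (tree_from w0)) \<C>"
    then have tr: "\<And>D. D \<in> \<C> \<Longrightarrow> tree_from w0 D"
      and ch: "\<And>D D'. D \<in> \<C> \<Longrightarrow> D' \<in> \<C> \<Longrightarrow> D \<subseteq> D' \<or> D' \<subseteq> D"
      by (auto simp: subset_chain_def)
    have "tree_from w0 (\<Union>\<C>)"
      unfolding tree_from_def
    proof (intro conjI ballI impI)
      show "w0 \<in> \<Union>\<C>" using tr \<C> by (auto simp: tree_from_def)
      show "\<Union>\<C> \<subseteq> W" using tr unfolding tree_from_def by blast
      show "saturated (\<Union>\<C>)" using tr by (fastforce simp: tree_from_def saturated_def)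
      show "(w0, d) \<in> (E \<inter> \<Union>\<C> \<times> \<Union>\<C>)\<^sup>*" if "d \<in> \<Union>\<C>" for d
      proof -
        obtain D where D: "D \<in> \<C>" "d \<in> D" using \<open>d \<in> \<Union>\<C>\<close> by auto
        then have "E \<inter> D \<times> D \<subseteq> E \<inter> \<Union>\<C> \<times> \<Union>\<C>" by auto
        moreover have "(w0, d) \<in> (E \<inter> D \<times> D)\<^sup>*" using tr[OF D(1)] D(2) by (simp add: tree_from_def)
        ultimately show ?thesis using rtrancl_mono by blast
      qed
      show "g = \<one>" if "g \<in> carrier G" "d \<in> \<Union>\<C>" "act g d \<in> \<Union>\<C>" for g d
      proof -
        obtain D D' where "D \<in> \<C>" "d \<in> D" "D' \<in> \<C>" "act g d \<in> D'"
          using \<open>d \<in> \<Union>\<C>\<close> \<open>act g d \<in> \<Union>\<C>\<close> by auto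
        then obtain D'' where "D'' \<in> \<C>" "d \<in> D''" "act g d \<in> D''" using ch by (metis subsetD)
        then show ?thesis using tr that by (auto simp: tree_from_def)
      qed
    qed
    then show "\<Union>\<C> \<in> Collect (tree_from w0)" by simp
  qed
  then obtain D where D: "tree_from w0 D" "\<And>D'. tree_from w0 D' \<Longrightarrow> D \<subseteq> D' \<Longrightarrow> D' = D" by auto
  define D1 where "D1 = {w \<in> W. \<exists>g\<in>carrier G. act g w \<in> D}"
  have DW: "D \<subseteq> W" "w0 \<in> D" using D by (auto simp: tree_from_def)
  have "w \<in> D1" if "w \<in> W" for w
  proof (rule ccontr)
    assume "w \<notin> D1"
    moreover have "w0 \<in> D1" using DW assms act_one[OF assms] by (auto simp: D1_def intro!: bexI[of _ \<one>])
    moreover have "(w0, w) \<in> E\<^sup>*" using simply_connected that assms by (auto simp: simply_connected_def)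
    ultimately obtain x y where xy: "(x, y) \<in> E" "x \<in> D1" "y \<notin> D1" using rtrancl_escape by metis
    then obtain g where g: "g \<in> carrier G" "act g x \<in> D" by (auto simp: D1_def)
    have yW: "y \<in> W" using xy E_subset by auto
    have "act g' (act g y) \<notin> D" if "g' \<in> carrier G" for g'
      using xy(3) yW that g by (auto simp: D1_def act_mult[symmetric])
    then have "tree_from w0 (D \<union> flat_edges\<^sup>* `` {act g y})"
      using E_act[OF g(1) xy(1)] g by (intro tree_from_extend[OF D(1)])
    then have "act g y \<in> D" using D(2)[of "D \<union> flat_edges\<^sup>* `` {act g y}"] by auto
    then show False using xy(3) yW g by (auto simp: D1_def)
  qed
  then show thesis using that[OF D(1)] by (auto simp: D1_def)
qed

text \<open>The set \<open>D\<close> meets every orbit exactly once, so its translates partition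
  \<open>W\<close>, and \<open>\<pi> w\<close> is the element whose translate of \<open>D\<close>
  contains \<open>w\<close>. Fibres are connected because \<open>D\<close> is, and flat edges stay
  in one fibre because \<open>D\<close> is saturated.\<close>

lemma equivariant_collapse:
  obtains \<pi> where "\<pi> \<in> W \<rightarrow> carrier G" "\<And>g w. g \<in> carrier G \<Longrightarrow> w \<in> W \<Longrightarrow> \<pi> (act g w) = g \<otimes> \<pi> w"
    "\<And>u v. u \<in> W \<Longrightarrow> v \<in> W \<Longrightarrow> \<pi> u = \<pi> v \<Longrightarrow> (u, v) \<in> {(x, y) \<in> E. \<pi> x = \<pi> y}\<^sup>*"
    "\<And>u v. (u, v) \<in> E \<Longrightarrow> q u = q v \<Longrightarrow> \<pi> u = \<pi> v"
proof -
  obtain w0 where w0: "w0 \<in> W" using W_nonempty by auto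
  obtain D where D: "tree_from w0 D" and ex: "\<And>w. w \<in> W \<Longrightarrow> \<exists>g\<in>carrier G. act g w \<in> D"
    using transversal_tree[OF w0] by blast
  have sat: "saturated D" and DW: "D \<subseteq> W" and w0D: "w0 \<in> D"
    and path: "\<And>d. d \<in> D \<Longrightarrow> (w0, d) \<in> (E \<inter> D \<times> D)\<^sup>*"
    and free: "\<And>g d. g \<in> carrier G \<Longrightarrow> d \<in> D \<Longrightarrow> act g d \<in> D \<Longrightarrow> g = \<one>"
    using D by (auto simp: tree_from_def)
  have uniq: "g = g'" if g: "g \<in> carrier G" "g' \<in> carrier G" "w \<in> W" "act g w \<in> D" "act g' w \<in> D" for g g' w
  proof -
    have "act (g' \<otimes> inv g) (act g w) = act g' w" using g by (simp add: act_mult act_closed act_inv)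
    then have "g' \<otimes> inv g = \<one>" using g free[of "g' \<otimes> inv g" "act g w"] by simp
    then show ?thesis using g by (metis inv_equality inv_inv inv_closed)
  qed
  obtain \<gamma> where \<gamma>: "\<And>w. w \<in> W \<Longrightarrow> \<gamma> w \<in> carrier G" "\<And>w. w \<in> W \<Longrightarrow> act (\<gamma> w) w \<in> D"
    using ex by metis
  have \<gamma>_eq: "\<gamma> w = g" if "g \<in> carrier G" "w \<in> W" "act g w \<in> D" for g w
    using uniq[of "\<gamma> w" g w] \<gamma> that by auto
  have \<gamma>_act: "\<gamma> (act g w) = \<gamma> w \<otimes> inv g" if "g \<in> carrier G" "w \<in> W" for g w
    using that \<gamma>(2)[of w] by (intro \<gamma>_eq) (auto simp: \<gamma> act_closed act_mult act_inv)
  have \<gamma>_D: "\<gamma> d = \<one>" if "d \<in> D" for d using that DW by (intro \<gamma>_eq) (auto simp: act_one)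
  \<comment> \<open>The translate of \<open>w0\<close> serves as the centre of the translate of
    \<open>D\<close> that contains \<open>u\<close>.\<close>
  have to_base: "(u, act (inv \<gamma> u) w0) \<in> {(x, y) \<in> E. \<gamma> x = \<gamma> y}\<^sup>*"
    and from_base: "(act (inv \<gamma> u) w0, u) \<in> {(x, y) \<in> E. \<gamma> x = \<gamma> y}\<^sup>*" if u: "u \<in> W" for u
  proof -
    let ?R = "{(x, y) \<in> E. \<gamma> x = \<gamma> y}"
    let ?g = "inv \<gamma> u"
    have g: "?g \<in> carrier G" using \<gamma> u by auto
    have "(w0, act (\<gamma> u) u) \<in> (E \<inter> D \<times> D)\<^sup>*" using path \<gamma> u by auto
    then have "(act ?g w0, act ?g (act (\<gamma> u) u)) \<in> ?R\<^sup>*"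
    proof (induction rule: rtrancl_induct)
      case (step y z)
      then have "(act ?g y, act ?g z) \<in> ?R"
        using g DW by (auto simp: \<gamma>_act \<gamma>_D subset_eq intro: E_act)
      then show ?case using step by (auto intro: rtrancl_into_rtrancl)
    qed simp
    then show *: "(act ?g w0, u) \<in> ?R\<^sup>*" using \<gamma> u by (simp add: act_inv)
    have "sym ?R" unfolding sym_def using symD[OF E_sym] by fastforce
    then show "(u, act ?g w0) \<in> ?R\<^sup>*" using * by (rule symD[OF sym_rtrancl])
  qed
  show thesis
  proof
    show "(\<lambda>w. inv \<gamma> w) \<in> W \<rightarrow> carrier G" using \<gamma> by auto
    show "inv \<gamma> (act g w) = g \<otimes> inv \<gamma> w" if "g \<in> carrier G" "w \<in> W" for g w
      using that \<gamma> by (simp add: \<gamma>_act inv_mult_group)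
    have inv_eq: "inv \<gamma> x = inv \<gamma> y \<longleftrightarrow> \<gamma> x = \<gamma> y" if "x \<in> W" "y \<in> W" for x y
      using inj_onD[OF inv_inj, of "\<gamma> x" "\<gamma> y"] \<gamma> that by auto
    then have "{(x, y) \<in> E. inv \<gamma> x = inv \<gamma> y} = {(x, y) \<in> E. \<gamma> x = \<gamma> y}"
      using E_subset by blast
    then show "(u, v) \<in> {(x, y) \<in> E. inv \<gamma> x = inv \<gamma> y}\<^sup>*" if "u \<in> W" "v \<in> W" "inv \<gamma> u = inv \<gamma> v" for u v
      using to_base[OF that(1)] from_base[OF that(2)] that inv_eq[OF that(1,2)] by (metis (lifting) rtrancl_trans)
    show "inv \<gamma> u = inv \<gamma> v" if "(u, v) \<in> E" "q u = q v" for u v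
    proof -
      have uv: "u \<in> W" "v \<in> W" using that E_subset by auto
      then have "(act (\<gamma> u) u, act (\<gamma> u) v) \<in> flat_edges"
        using flat_edges_act[OF \<gamma>(1), of u u v] that by (auto simp: flat_edges_def)
      then have "act (\<gamma> u) v \<in> D" using sat \<gamma>(2)[OF uv(1)] by (auto simp: saturated_def)
      then show ?thesis using \<gamma>_eq \<gamma>(1) uv by metis
    qed
  qed
qed

text \<open>There is one generator for every label in \<open>G\<close> of an edge, with relators of
  length one and two for the identity and for inverses. Triangles on which \<open>q\<close> takes
  three values are translates of triangles in \<open>T0\<close>, which cost one each; the others
  follow from the short relators. The relators suffice because labelling edges by generators is a
  cocycle in the presented group, and its potential shows that the value of a word there depends
  only on its value in \<open>G\<close>.\<close>

theorem presentation_exists: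
  assumes "finite E0" "E0 \<subseteq> W \<times> W" and
    crossing_edges: "\<And>u v. (u, v) \<in> E \<Longrightarrow> q u \<noteq> q v \<Longrightarrow>
      \<exists>g\<in>carrier G. \<exists>(a, b)\<in>E0. u = act g a \<and> v = act g b" and
    "finite T0" "T0 \<subseteq> T" and
    crossing_triangles: "\<And>u v w. (u, v, w) \<in> T \<Longrightarrow> q u \<noteq> q v \<Longrightarrow> q v \<noteq> q w \<Longrightarrow> q u \<noteq> q w \<Longrightarrow>
      \<exists>g\<in>carrier G. \<exists>(a, b, c)\<in>T0. u = act g a \<and> v = act g b \<and> w = act g c"
  shows "\<exists>n rs. is_presentation G n rs \<and> (\<Sum>r\<leftarrow>rs. length r - 2) \<le> card T0"
proof -
  obtain \<pi> where \<pi>: "\<pi> \<in> W \<rightarrow> carrier G" "\<And>g w. g \<in> carrier G \<Longrightarrow> w \<in> W \<Longrightarrow> \<pi> (act g w) = g \<otimes> \<pi> w"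
    and fiber: "\<And>u v. u \<in> W \<Longrightarrow> v \<in> W \<Longrightarrow> \<pi> u = \<pi> v \<Longrightarrow> (u, v) \<in> {(x, y) \<in> E. \<pi> x = \<pi> y}\<^sup>*"
    and flat: "\<And>u v. (u, v) \<in> E \<Longrightarrow> q u = q v \<Longrightarrow> \<pi> u = \<pi> v"
    by (rule equivariant_collapse) (rule that; assumption)
  have \<pi>_closed [simp]: "\<pi> w \<in> carrier G" if "w \<in> W" for w using \<pi> that by auto
  have EW: "u \<in> W" "v \<in> W" if "(u, v) \<in> E" for u v using that E_subset by auto
  \<comment> \<open>The label of an edge after the collapse, which is invariant under the
    action.\<close>
  define \<delta> where "\<delta> u v = inv \<pi> u \<otimes> \<pi> v" for u v
  have \<delta>_closed [simp]: "\<delta> u v \<in> carrier G" if "u \<in> W" "v \<in> W" for u v using that by (simp add: \<delta>_def)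
  have \<delta>_mult: "\<delta> u v \<otimes> \<delta> v w = \<delta> u w" if "u \<in> W" "v \<in> W" "w \<in> W" for u v w
    using that by (simp add: \<delta>_def m_assoc) (simp add: m_assoc[symmetric])
  have \<delta>_inv: "inv \<delta> u v = \<delta> v u" if "u \<in> W" "v \<in> W" for u v
    using that by (simp add: \<delta>_def inv_mult_group)
  have \<delta>_one: "\<delta> u v = \<one> \<longleftrightarrow> \<pi> u = \<pi> v" if "u \<in> W" "v \<in> W" for u v
    unfolding \<delta>_def using that by (metis \<pi>_closed inv_equality inv_inv inv_closed l_inv)
  have \<delta>_act: "\<delta> (act g u) (act g v) = \<delta> u v" if "g \<in> carrier G" "u \<in> W" "v \<in> W" for g u v
    using that by (simp add: \<delta>_def \<pi> inv_mult_group m_assoc) (simp add: m_assoc[symmetric])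
  define X where "X = insert \<one> ((\<lambda>(u, v). \<delta> u v) ` E)"
  have X_closed: "X \<subseteq> carrier G" using EW by (auto simp: X_def)
  have X_one: "\<one> \<in> X" and X_\<delta>: "\<And>u v. (u, v) \<in> E \<Longrightarrow> \<delta> u v \<in> X" by (auto simp: X_def)
  have X_inv: "inv x \<in> X" if "x \<in> X" for x
  proof (cases "x = \<one>")
    case False
    then obtain u v where "(u, v) \<in> E" "x = \<delta> u v" using \<open>x \<in> X\<close> by (auto simp: X_def)
    then show ?thesis using X_\<delta>[OF symD[OF E_sym]] \<delta>_inv EW by metis
  qed (simp add: X_one)
  \<comment> \<open>There may be infinitely many orbits of edges, but those that are not represented
    in \<open>E0\<close> are flat and have trivial label.\<close>
  have "X \<subseteq> insert \<one> ((\<lambda>(u, v). \<delta> u v) ` E0)"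
  proof
    fix x assume "x \<in> X"
    then consider "x = \<one>" | u v where "(u, v) \<in> E" "x = \<delta> u v" by (auto simp: X_def)
    then show "x \<in> insert \<one> ((\<lambda>(u, v). \<delta> u v) ` E0)"
    proof cases
      case (2 u v)
      show ?thesis
      proof (cases "q u = q v")
        case True
        then show ?thesis using flat[OF 2(1)] \<delta>_one EW[OF 2(1)] 2(2) by simp
      next
        case False
        then obtain g a b where "g \<in> carrier G" "(a, b) \<in> E0" "u = act g a" "v = act g b"
          using crossing_edges[OF 2(1)] by blast
        then have "x = \<delta> a b" using \<delta>_act assms(2) 2(2) by auto
        then show ?thesis using \<open>(a, b) \<in> E0\<close> by force
      qed
    qed simp
  qed
  then have "finite X" using assms(1) finite_subset by blast
  then obtain f where f_bij: "bij_betw f {0..<card X} X" using ex_bij_betw_nat_finite by blast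
  define n where "n = card X"
  define idx where "idx x = the_inv_into {..<n} f x" for x
  have bij: "bij_betw f {..<n} X" using f_bij by (simp add: n_def atLeast0LessThan)
  have idx: "idx x < n" "f (idx x) = x" if "x \<in> X" for x
    using that bij the_inv_into_into[of f "{..<n}" x "{..<n}"] f_the_inv_into_f[of f "{..<n}" x]
    by (auto simp: bij_betw_def idx_def)
  have idx_f: "idx (f i) = i" and f_X: "f i \<in> X" if "i < n" for i
    using that bij the_inv_into_f_f[of f "{..<n}" i] by (auto simp: bij_betw_def idx_def)
  have f: "f \<in> {..<n} \<rightarrow> carrier G" using f_X X_closed by auto
  note [simp] = word_eval_closed[OF f] word_eval_append[OF f]
  define L where "L x = (idx x, True)" for x
  have fst_L [simp]: "x \<in> X \<Longrightarrow> fst (L x) < n" for x by (simp add: L_def idx)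
  have eval_L [simp]: "letter_eval G f (L x) = x" if "x \<in> X" for x
    using that by (simp add: letter_eval_def L_def idx)
  obtain xs where xs: "set xs = X" using finite_list[OF \<open>finite X\<close>] by blast
  obtain ts where ts: "set ts = T0" "distinct ts" using finite_distinct_list[OF \<open>finite T0\<close>] by blast
  \<comment> \<open>Only the relators for triangles have length three, so the cost is the number of
    triangles in \<open>T0\<close>.\<close>
  define rs where "rs = [L \<one>] # map (\<lambda>x. [L x, L (inv x)]) xs
    @ map (\<lambda>(a, b, c). [L (\<delta> a b), L (\<delta> b c), letter_inv (L (\<delta> a c))]) ts"
  have T0_E: "(a, b) \<in> E \<and> (b, c) \<in> E \<and> (a, c) \<in> E" if "(a, b, c) \<in> T0" for a b c
    using that T_edges assms(5) by auto
  have rs: "set rs \<subseteq> words {..<n}"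
    using X_one X_inv xs ts T0_E X_\<delta> by (auto simp: rs_def)
  have rs_mem: "[L \<one>] \<in> set rs" "\<And>x. x \<in> X \<Longrightarrow> [L x, L (inv x)] \<in> set rs"
    "\<And>a b c. (a, b, c) \<in> T0 \<Longrightarrow> [L (\<delta> a b), L (\<delta> b c), letter_inv (L (\<delta> a c))] \<in> set rs"
    using xs ts by (force simp: rs_def)+
  have "(\<lambda>x. length (case x of (a, b, c) \<Rightarrow> [L (\<delta> a b), L (\<delta> b c), letter_inv (L (\<delta> a c))]) - 2) = (\<lambda>_. 1)"
    by auto
  then have cost: "(\<Sum>r\<leftarrow>rs. length r - 2) = card T0"
    using ts distinct_card[OF ts(2)] by (simp add: rs_def o_def sum_list_triv)
  let ?Q = "presented_group n rs"
  interpret Q: group ?Q by (rule group_presented_group[OF rs])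
  define \<kappa> where "\<kappa> i = relator_coset n rs [(i, True)]" for i
  have \<kappa>: "\<kappa> \<in> {..<n} \<rightarrow> carrier ?Q"
    using hom_in_carrier[OF relator_coset_hom[OF rs]] letter_word_in_free_group[of "(_, True)" "{..<n}"]
    by (auto simp: \<kappa>_def)
  have \<kappa>_rel: "word_eval ?Q \<kappa> r = \<one>\<^bsub>?Q\<^esub>" if "r \<in> set rs" for r
    using word_eval_relator[OF rs that] by (simp add: \<kappa>_def[abs_def])
  have eval_\<kappa> [simp]: "letter_eval ?Q \<kappa> (L x) = \<kappa> (idx x)" for x
    by (simp add: letter_eval_def L_def)
  have \<kappa>_closed [simp]: "\<kappa> (idx x) \<in> carrier ?Q" if "x \<in> X" for x using \<kappa> idx that by auto
  have \<kappa>_one: "\<kappa> (idx \<one>) = \<one>\<^bsub>?Q\<^esub>" using \<kappa>_rel[OF rs_mem(1)] X_one by simp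
  have \<kappa>_inv: "\<kappa> (idx x) \<otimes>\<^bsub>?Q\<^esub> \<kappa> (idx (inv x)) = \<one>\<^bsub>?Q\<^esub>" if "x \<in> X" for x
    using \<kappa>_rel[OF rs_mem(2)[OF that]] X_inv[OF that] that by simp
  have \<kappa>_T0: "\<kappa> (idx (\<delta> a b)) \<otimes>\<^bsub>?Q\<^esub> \<kappa> (idx (\<delta> b c)) = \<kappa> (idx (\<delta> a c))" if abc: "(a, b, c) \<in> T0" for a b c
  proof -
    have X: "\<delta> a b \<in> X" "\<delta> b c \<in> X" "\<delta> a c \<in> X" using T0_E[OF abc] X_\<delta> by auto
    have "word_eval ?Q \<kappa> [L (\<delta> a b), L (\<delta> b c), letter_inv (L (\<delta> a c))] = \<one>\<^bsub>?Q\<^esub>"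
      by (intro \<kappa>_rel rs_mem abc)
    then have "\<kappa> (idx (\<delta> a b)) \<otimes>\<^bsub>?Q\<^esub> \<kappa> (idx (\<delta> b c)) \<otimes>\<^bsub>?Q\<^esub> inv\<^bsub>?Q\<^esub> \<kappa> (idx (\<delta> a c)) = \<one>\<^bsub>?Q\<^esub>"
      using X fst_L by (simp add: Q.letter_eval_inv[OF \<kappa>] Q.m_assoc)
    then show ?thesis
      using X Q.inv_solve_right'[of "\<one>\<^bsub>?Q\<^esub>" "\<kappa> (idx (\<delta> a b)) \<otimes>\<^bsub>?Q\<^esub> \<kappa> (idx (\<delta> b c))" "\<kappa> (idx (\<delta> a c))"]
      by simp
  qed
  define h where "h u v = \<kappa> (idx (\<delta> u v))" for u v
  have h_tri: "h u v \<otimes>\<^bsub>?Q\<^esub> h v w = h u w" if uvw: "(u, v, w) \<in> T" for u v w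
  proof -
    have E: "(u, v) \<in> E" "(v, w) \<in> E" "(u, w) \<in> E" using T_edges[OF uvw] by auto
    then have W: "u \<in> W" "v \<in> W" "w \<in> W" using EW by auto
    have X: "\<delta> u v \<in> X" "\<delta> v w \<in> X" "\<delta> u w \<in> X" using E X_\<delta> by auto
    \<comment> \<open>A triangle on which \<open>q\<close> repeats a value has a collapsed side, so
      its relation is either void or says that two labels are inverse to each other.\<close>
    consider "\<pi> u = \<pi> v" | "\<pi> v = \<pi> w" | "\<pi> u = \<pi> w" | "q u \<noteq> q v" "q v \<noteq> q w" "q u \<noteq> q w"
      using flat E by blast
    then show ?thesis
    proof cases
      case 1
      then have "\<delta> u v = \<one>" "\<delta> u w = \<delta> v w" using W by (auto simp: \<delta>_def)
      then show ?thesis using X by (simp add: h_def \<kappa>_one)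
    next
      case 2
      then have "\<delta> v w = \<one>" "\<delta> u w = \<delta> u v" using W by (auto simp: \<delta>_def)
      then show ?thesis using X by (simp add: h_def \<kappa>_one)
    next
      case 3
      then have "\<delta> u w = \<one>" "\<delta> v w = inv \<delta> u v" using W by (auto simp: \<delta>_inv) (auto simp: \<delta>_def)
      then show ?thesis using \<kappa>_inv[OF X(1)] by (simp add: h_def \<kappa>_one)
    next
      case 4
      then obtain g a b c where abc: "g \<in> carrier G" "(a, b, c) \<in> T0" "u = act g a" "v = act g b" "w = act g c"
        using crossing_triangles[OF uvw] by blast
      then have "a \<in> W" "b \<in> W" "c \<in> W" using T0_E EW by blast+
      then show ?thesis using \<kappa>_T0[OF abc(2)] abc by (simp add: h_def \<delta>_act)
    qed
  qed
  have "cocycle ?Q E T h"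
    unfolding cocycle_def
  proof (intro conjI ballI; clarify)
    fix u v assume uv: "(u, v) \<in> E"
    then have "h u v \<otimes>\<^bsub>?Q\<^esub> h v u = \<one>\<^bsub>?Q\<^esub>"
      using \<kappa>_inv[OF X_\<delta>[OF uv]] EW[OF uv] by (simp add: h_def \<delta>_inv)
    moreover have "h u v \<in> carrier ?Q" using X_\<delta>[OF uv] by (simp add: h_def)
    moreover have "h u u = \<one>\<^bsub>?Q\<^esub>" using EW[OF uv] \<delta>_one[of u u] by (simp add: h_def \<kappa>_one)
    ultimately show "h u v \<in> carrier ?Q \<and> h u v \<otimes>\<^bsub>?Q\<^esub> h v u = \<one>\<^bsub>?Q\<^esub> \<and> (u = v \<longrightarrow> h u v = \<one>\<^bsub>?Q\<^esub>)" by auto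
  qed (rule h_tri)
  then obtain p where p: "p \<in> W \<rightarrow> carrier ?Q" "\<And>u v. (u, v) \<in> E \<Longrightarrow> p v = p u \<otimes>\<^bsub>?Q\<^esub> h u v"
    using simply_connected_potential[OF simply_connected Q.is_group] by blast
  \<comment> \<open>Edges within a fibre of \<pi> carry the label of the identity, so the potential
    descends to \<open>G\<close>.\<close>
  have p_fiber: "p u = p v" if uv: "u \<in> W" "v \<in> W" "\<pi> u = \<pi> v" for u v
    using fiber[OF uv]
  proof (induction rule: rtrancl_induct)
    case (step y z)
    then have "(y, z) \<in> E" "\<pi> y = \<pi> z" by auto
    then have "h y z = \<one>\<^bsub>?Q\<^esub>" "p y \<in> carrier ?Q" using EW[of y z] \<delta>_one[of y z] p(1) by (auto simp: h_def \<kappa>_one)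
    then show ?case using step p(2)[OF \<open>(y, z) \<in> E\<close>] by simp
  qed simp
  \<comment> \<open>There need not be an edge with label \<open>x\<close> at \<open>u\<close>
    itself, but some translate of an edge with this label starts in the same fibre, where
    \<open>p\<close> has the same value.\<close>
  have move: "\<exists>v\<in>W. \<pi> v = \<pi> u \<otimes> x \<and> p v = p u \<otimes>\<^bsub>?Q\<^esub> \<kappa> (idx x)" if u: "u \<in> W" and x: "x \<in> X" for u x
  proof (cases "x = \<one>")
    case True
    then show ?thesis using u p(1) by (intro bexI[of _ u]) (auto simp: \<kappa>_one Pi_iff)
  next
    case False
    then obtain a b where ab: "(a, b) \<in> E" "x = \<delta> a b" using x by (auto simp: X_def)
    define g where "g = \<pi> u \<otimes> inv \<pi> a"
    have abW: "a \<in> W" "b \<in> W" using EW[OF ab(1)] by auto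
    have g: "g \<in> carrier G" using u abW by (simp add: g_def)
    have pi_a: "\<pi> (act g a) = \<pi> u" using u abW g by (simp add: \<pi>) (simp add: g_def m_assoc)
    have pi_b: "\<pi> (act g b) = \<pi> u \<otimes> x" using u abW g by (simp add: \<pi>) (simp add: g_def m_assoc ab \<delta>_def)
    have "p (act g a) = p u" using pi_a u abW g by (intro p_fiber act_closed)
    moreover have "p (act g b) = p (act g a) \<otimes>\<^bsub>?Q\<^esub> h (act g a) (act g b)" using ab g by (intro p(2) E_act)
    moreover have "h (act g a) (act g b) = \<kappa> (idx x)" using abW g ab by (simp add: h_def \<delta>_act)
    ultimately show ?thesis using pi_b act_closed[OF g abW(2)] by auto
  qed
  have p_word: "p v = p u \<otimes>\<^bsub>?Q\<^esub> word_eval ?Q \<kappa> w"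
    if "w \<in> words {..<n}" "u \<in> W" "v \<in> W" "\<pi> v = \<pi> u \<otimes> word_eval G f w" for u v w
    using that
  proof (induction w arbitrary: u)
    case Nil
    then show ?case using p_fiber[of v u] p(1) by (simp add: Pi_iff)
  next
    case (Cons l w)
    then have l: "fst l < n" "w \<in> words {..<n}" by auto
    have "\<exists>x\<in>X. letter_eval G f l = x \<and> letter_eval ?Q \<kappa> l = \<kappa> (idx x)"
    proof (cases "snd l")
      case True
      then show ?thesis using f_X[OF l(1)] idx_f[OF l(1)] by (auto simp: letter_eval_def)
    next
      case False
      have "inv\<^bsub>?Q\<^esub> \<kappa> (fst l) = \<kappa> (idx (inv f (fst l)))"
        using \<kappa>_inv[OF f_X[OF l(1)]] idx_f[OF l(1)] \<kappa>_closed[OF X_inv[OF f_X[OF l(1)]]] \<kappa>_closed[OF f_X[OF l(1)]]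
        by (metis Q.inv_equality Q.inv_inv)
      then show ?thesis using False X_inv[OF f_X[OF l(1)]] by (auto simp: letter_eval_def)
    qed
    then obtain x where x: "x \<in> X" "letter_eval G f l = x" "letter_eval ?Q \<kappa> l = \<kappa> (idx x)" by blast
    obtain u' where u': "u' \<in> W" "\<pi> u' = \<pi> u \<otimes> x" "p u' = p u \<otimes>\<^bsub>?Q\<^esub> \<kappa> (idx x)"
      using move[OF Cons.prems(2) x(1)] by blast
    have xG: "x \<in> carrier G" using x X_closed by auto
    have "p v = p u' \<otimes>\<^bsub>?Q\<^esub> word_eval ?Q \<kappa> w"
      using Cons.prems l u' x xG by (intro Cons.IH) (auto simp: m_assoc)
    then show ?case
      using u' x p(1) Cons.prems(2) l Q.word_eval_closed[OF \<kappa> l(2)] by (simp add: Q.m_assoc Pi_iff)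
  qed
  have reach: "\<exists>w\<in>words {..<n}. word_eval G f w = \<delta> u v" if "(u, v) \<in> E\<^sup>*" "u \<in> W" for u v
    using that
  proof (induction rule: rtrancl_induct)
    case base
    then show ?case using \<delta>_one[of u u] by (intro bexI[of _ "[]"]) auto
  next
    case (step y z)
    then obtain w where w: "w \<in> words {..<n}" "word_eval G f w = \<delta> u y" by blast
    have yz: "y \<in> W" "z \<in> W" "\<delta> y z \<in> X" using EW[OF step(2)] X_\<delta>[OF step(2)] by auto
    then show ?case using w step.prems \<delta>_mult[of u y z]
      by (intro bexI[of _ "w @ [L (\<delta> y z)]"]) auto
  qed
  obtain w1 where w1: "w1 \<in> W" using W_nonempty by auto
  have "is_presentation G n rs"
  proof (rule is_presentationI[OF group_axioms rs f])
    fix g assume g: "g \<in> carrier G"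
    \<comment> \<open>Since \<pi> need not send \<open>w1\<close> to the identity, \<open>g\<close>
      is conjugated by \<open>\<pi> w1\<close>; then the label from \<open>w1\<close> to its
      translate is exactly \<open>g\<close>.\<close>
    let ?g = "\<pi> w1 \<otimes> g \<otimes> inv \<pi> w1"
    have g': "?g \<in> carrier G" using g w1 by simp
    have "(w1, act ?g w1) \<in> E\<^sup>*" using simply_connected w1 act_closed[OF g' w1] by (auto simp: simply_connected_def)
    moreover have "\<delta> w1 (act ?g w1) = g"
      unfolding \<delta>_def \<pi>(2)[OF g' w1] using w1 g by (simp add: m_assoc) (simp add: m_assoc[symmetric])
    ultimately show "\<exists>w\<in>words {..<n}. word_eval G f w = g" using reach w1 by metis
  next
    fix r assume "r \<in> set rs"
    then consider "r = [L \<one>]" | x where "x \<in> X" "r = [L x, L (inv x)]"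
      | a b c where "(a, b, c) \<in> T0" "r = [L (\<delta> a b), L (\<delta> b c), letter_inv (L (\<delta> a c))]"
      using xs ts by (auto simp: rs_def)
    then show "word_eval G f r = \<one>"
    proof cases
      case 1
      then show ?thesis using X_one by simp
    next
      case (2 x)
      then show ?thesis using X_inv X_closed by auto
    next
      case (3 a b c)
      then have E: "(a, b) \<in> E" "(b, c) \<in> E" "(a, c) \<in> E" using T0_E by auto
      then have "a \<in> W" "b \<in> W" "c \<in> W" using EW by auto
      then show ?thesis using E X_\<delta> 3(2)
        by (simp add: letter_eval_inv[OF f] \<delta>_inv m_assoc[symmetric] \<delta>_mult \<delta>_one)
    qed
  next
    fix w assume w: "w \<in> words {..<n}" "word_eval G f w = \<one>"
    \<comment> \<open>A word that is trivial in \<open>G\<close> leads back to the fibre of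
      \<open>w1\<close> and therefore does not change the potential.\<close>
    have "p w1 = p w1 \<otimes>\<^bsub>?Q\<^esub> word_eval ?Q \<kappa> w" using w w1 by (intro p_word) auto
    then have "word_eval ?Q \<kappa> w = \<one>\<^bsub>?Q\<^esub>"
      using p(1) w1 Q.word_eval_closed[OF \<kappa> w(1)] by (metis Pi_mem Q.l_cancel_one)
    then show "word_eval ?Q (\<lambda>i. relator_coset n rs [(i, True)]) w = \<one>\<^bsub>?Q\<^esub>"
      by (simp add: \<kappa>_def[abs_def])
  qed
  then show ?thesis using cost by (metis order_refl)
qed

end

section \<open>Double cosets\<close>

text \<open>Compares numbers of cosets of different subgroups without an explicit bijection: it is
  enough that both maps identify the same pairs of elements.\<close>

lemma finite_card_image_cong:
  assumes "finite (\<phi> ` A)" and "\<And>x y. x \<in> A \<Longrightarrow> y \<in> A \<Longrightarrow> \<phi> x = \<phi> y \<longleftrightarrow> \<psi> x = \<psi> y"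
  shows "finite (\<psi> ` A)" "card (\<psi> ` A) = card (\<phi> ` A)"
proof -
  have inv: "inv_into A \<phi> y \<in> A" "\<phi> (inv_into A \<phi> y) = y" if "y \<in> \<phi> ` A" for y
    using that by (auto intro: inv_into_into f_inv_into_f)
  have "bij_betw (\<psi> \<circ> inv_into A \<phi>) (\<phi> ` A) (\<psi> ` A)"
  proof (rule bij_betw_imageI)
    show "inj_on (\<psi> \<circ> inv_into A \<phi>) (\<phi> ` A)"
      by (rule inj_onI) (metis assms(2) comp_apply inv)
    have "\<psi> x \<in> (\<psi> \<circ> inv_into A \<phi>) ` \<phi> ` A" if "x \<in> A" for x
    proof -
      have "\<psi> x = \<psi> (inv_into A \<phi> (\<phi> x))" using assms(2) inv[of "\<phi> x"] that by auto
      then show ?thesis using that by auto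
    qed
    then show "(\<psi> \<circ> inv_into A \<phi>) ` \<phi> ` A = \<psi> ` A" using inv by auto
  qed
  then show "finite (\<psi> ` A)" "card (\<psi> ` A) = card (\<phi> ` A)"
    using assms(1) bij_betw_finite bij_betw_same_card by metis+
qed

context group
begin

lemma r_coset_eq_iff:
  assumes "subgroup K G" "x \<in> carrier G" "y \<in> carrier G"
  shows "K #> x = K #> y \<longleftrightarrow> x \<otimes> inv y \<in> K"
proof -
  interpret K: subgroup K G by fact
  show ?thesis
    using K.rcos_module[OF is_group assms(3,2)] rcos_self[OF assms(2,1)] repr_independence[OF _ assms(3,1), of x]
    by metis
qed

lemma rcosets_eq_image: "rcosets K = (\<lambda>x. K #> x) ` carrier G"
  by (auto simp: RCOSETS_def)

lemma l_coset_eq_iff: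
  assumes K: "subgroup K G" and xy: "x \<in> carrier G" "y \<in> carrier G"
  shows "x <# K = y <# K \<longleftrightarrow> inv y \<otimes> x \<in> K"
proof
  interpret K: subgroup K G by fact
  show "inv y \<otimes> x \<in> K" if "x <# K = y <# K"
  proof -
    have "x \<otimes> \<one> \<in> x <# K" unfolding l_coset_def using K.one_closed by blast
    then have "x \<in> y <# K" unfolding that[symmetric] using xy(1) by (simp only: r_one)
    then obtain k where "k \<in> K" "x = y \<otimes> k" unfolding l_coset_def by blast
    then show ?thesis using xy by (simp add: m_assoc[symmetric])
  qed
  show "x <# K = y <# K" if "inv y \<otimes> x \<in> K"
  proof -
    have "x = y \<otimes> (inv y \<otimes> x)" using xy by (simp add: m_assoc[symmetric])
    then have "x \<in> y <# K" unfolding l_coset_def using that by blast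
    then show ?thesis using l_repr_independence[OF _ xy(2) K] by blast
  qed
qed

lemma finite_l_cosets:
  assumes K: "subgroup K G" and fin: "finite (rcosets K)"
  shows "finite ((\<lambda>x. x <# K) ` carrier G)"
proof (rule finite_card_image_cong(1))
  show "finite ((\<lambda>x. K #> inv x) ` carrier G)"
    using fin by (rule finite_subset[rotated]) (auto simp: rcosets_eq_image)
  fix x y assume xy: "x \<in> carrier G" "y \<in> carrier G"
  have "inv (inv y \<otimes> x) = inv x \<otimes> y" using xy by (simp add: inv_mult_group)
  then show "K #> inv x = K #> inv y \<longleftrightarrow> x <# K = y <# K"
    using xy r_coset_eq_iff[OF K, of "inv x" "inv y"] l_coset_eq_iff[OF K xy]
      subgroup.m_inv_closed[OF K] inv_inv by (metis inv_closed m_closed inv_mult_group)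
qed

text \<open>The intersection of \<open>A\<close> with the conjugate \<open>inv g K g\<close>, that
  is, the intersection of \<open>K\<close> with \<open>g A inv g\<close> moved back into
  \<open>A\<close>. In this form all parts are subgroups of one fixed group, in which their indices
  can be added up.\<close>

definition conj_part :: "'a set \<Rightarrow> 'a set \<Rightarrow> 'a \<Rightarrow> 'a set"
  where "conj_part K A g = {a \<in> A. g \<otimes> a \<otimes> inv g \<in> K}"

lemma conj_mult:
  "g \<in> carrier G \<Longrightarrow> a \<in> carrier G \<Longrightarrow> b \<in> carrier G \<Longrightarrow>
    g \<otimes> (a \<otimes> b) \<otimes> inv g = (g \<otimes> a \<otimes> inv g) \<otimes> (g \<otimes> b \<otimes> inv g)"
  by (simp add: m_assoc) (simp add: m_assoc[symmetric])

lemma conj_inv: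
  "g \<in> carrier G \<Longrightarrow> a \<in> carrier G \<Longrightarrow> g \<otimes> inv a \<otimes> inv g = inv (g \<otimes> a \<otimes> inv g)"
  by (simp add: inv_mult_group m_assoc)

lemma subgroup_conj_part:
  assumes K: "subgroup K G" and A: "subgroup A G" and g: "g \<in> carrier G"
  shows "subgroup (conj_part K A g) G" "subgroup (conj_part K A g) (G\<lparr>carrier := A\<rparr>)"
proof -
  interpret K: subgroup K G by fact
  interpret A: subgroup A G by fact
  have "\<one> \<in> conj_part K A g" using g A.one_closed K.one_closed by (simp add: conj_part_def)
  then have "conj_part K A g \<noteq> {}" by blast
  then show 1: "subgroup (conj_part K A g) G"
    by (rule subgroupI[rotated]) (use g in \<open>auto simp: conj_part_def conj_mult conj_inv\<close>)
  show "subgroup (conj_part K A g) (G\<lparr>carrier := A\<rparr>)"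
    by (rule subgroup_incl[OF 1 A]) (auto simp: conj_part_def)
qed

definition double_coset_reps :: "'a set \<Rightarrow> 'a set \<Rightarrow> 'a set \<Rightarrow> bool"
  where "double_coset_reps K A \<Gamma> \<longleftrightarrow> finite \<Gamma> \<and> \<Gamma> \<subseteq> carrier G \<and>
    (\<forall>x\<in>carrier G. \<exists>g\<in>\<Gamma>. \<exists>k\<in>K. \<exists>a\<in>A. x = k \<otimes> g \<otimes> a) \<and>
    (\<forall>g\<in>\<Gamma>. \<forall>g'\<in>\<Gamma>. \<forall>k\<in>K. \<forall>a\<in>A. g' = k \<otimes> g \<otimes> a \<longrightarrow> g' = g)"

text \<open>\<open>A\<close> acts on the right cosets of \<open>K\<close> by right multiplication.
  Orbits correspond to double cosets, and the stabiliser of the coset of \<open>g\<close> is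
  \<open>conj_part K A g\<close>, so the last equation is the decomposition into orbits.\<close>

lemma double_coset_reps_exist:
  assumes K: "subgroup K G" and A: "subgroup A G" and fin: "finite (rcosets K)"
  obtains \<Gamma> where "double_coset_reps K A \<Gamma>"
    "\<And>g. g \<in> \<Gamma> \<Longrightarrow> finite (rcosets\<^bsub>G\<lparr>carrier := A\<rparr>\<^esub> (conj_part K A g))"
    "(\<Sum>g\<in>\<Gamma>. card (rcosets\<^bsub>G\<lparr>carrier := A\<rparr>\<^esub> (conj_part K A g))) = card (rcosets K)"
proof -
  interpret K: subgroup K G by fact
  interpret A: subgroup A G by fact
  define DC where "DC x = {k \<otimes> x \<otimes> a | k a. k \<in> K \<and> a \<in> A}" for x
  have DC_self: "x \<in> DC x" if "x \<in> carrier G" for x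
  proof -
    have "x = \<one> \<otimes> x \<otimes> \<one>" using that by simp
    then show ?thesis using K.one_closed A.one_closed unfolding DC_def by blast
  qed
  have DC_mem: "DC y = DC x" if x: "x \<in> carrier G" and y: "y \<in> DC x" for x y
  proof -
    obtain k a where ka: "k \<in> K" "a \<in> A" "y = k \<otimes> x \<otimes> a" using y by (auto simp: DC_def)
    then have x': "x = inv k \<otimes> y \<otimes> inv a" using x by (simp add: m_assoc) (simp add: m_assoc[symmetric])
    have "k' \<otimes> y \<otimes> a' = (k' \<otimes> k) \<otimes> x \<otimes> (a \<otimes> a')" if "k' \<in> K" "a' \<in> A" for k' a'
      using that ka x by (simp add: m_assoc)
    moreover have "k' \<otimes> x \<otimes> a' = (k' \<otimes> inv k) \<otimes> y \<otimes> (inv a \<otimes> a')" if "k' \<in> K" "a' \<in> A" for k' a'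
    proof -
      have y: "y \<in> carrier G" using ka x by simp
      show ?thesis unfolding x' using that ka y by (simp add: m_assoc)
    qed
    ultimately show ?thesis using ka unfolding DC_def
      by (safe; metis K.m_closed A.m_closed K.m_inv_closed A.m_inv_closed)
  qed
  have DC_carrier: "DC x \<subseteq> carrier G" if "x \<in> carrier G" for x using that by (auto simp: DC_def)
  define r where "r x = (SOME y. y \<in> DC x)" for x
  have r: "r x \<in> DC x" if "x \<in> carrier G" for x using DC_self[OF that] by (auto simp: r_def intro: someI)
  define \<Gamma> where "\<Gamma> = r ` carrier G"
  have \<Gamma>: "\<Gamma> \<subseteq> carrier G" using r DC_carrier by (auto simp: \<Gamma>_def)
  have r_eq: "r y = r x" if "x \<in> carrier G" "y \<in> DC x" for x y
    unfolding r_def DC_mem[OF that] ..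
  have r_\<Gamma>: "r g = g" if "g \<in> \<Gamma>" for g
    using that r_eq[OF _ r] by (auto simp: \<Gamma>_def)
  have uniq: "g' = g" if "g \<in> \<Gamma>" "g' \<in> \<Gamma>" "g' \<in> DC g" for g g'
    using r_eq[of g g'] that r_\<Gamma> \<Gamma> by auto
  have cover: "\<exists>g\<in>\<Gamma>. x \<in> DC g" if "x \<in> carrier G" for x
  proof
    show "x \<in> DC (r x)" using DC_mem[OF that r[OF that]] DC_self[OF that] by simp
    show "r x \<in> \<Gamma>" using that by (simp add: \<Gamma>_def)
  qed
  define orb where "orb g = (\<lambda>a. K #> (g \<otimes> a)) ` A" for g
  have orb_union: "rcosets K = (\<Union>g\<in>\<Gamma>. orb g)"
  proof
    show "rcosets K \<subseteq> (\<Union>g\<in>\<Gamma>. orb g)"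
    proof
      fix X assume "X \<in> rcosets K"
      then obtain x where x: "x \<in> carrier G" "X = K #> x" by (auto simp: RCOSETS_def)
      obtain g k a where g: "g \<in> \<Gamma>" "k \<in> K" "a \<in> A" "x = k \<otimes> g \<otimes> a"
        using cover[OF x(1)] by (auto simp: DC_def)
      have gG: "g \<in> carrier G" using g \<Gamma> by auto
      have "x \<otimes> inv (g \<otimes> a) = k" using g gG by (simp add: m_assoc inv_mult_group) (simp add: m_assoc[symmetric])
      then have "X = K #> (g \<otimes> a)" using x g gG r_coset_eq_iff[OF K, of x "g \<otimes> a"] by simp
      then show "X \<in> (\<Union>g\<in>\<Gamma>. orb g)" using g by (auto simp: orb_def)
    qed
    show "(\<Union>g\<in>\<Gamma>. orb g) \<subseteq> rcosets K" using \<Gamma> by (auto simp: orb_def rcosets_eq_image intro!: imageI)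
  qed
  have orb_disj: "orb g \<inter> orb g' = {}" if g: "g \<in> \<Gamma>" "g' \<in> \<Gamma>" "g \<noteq> g'" for g g'
  proof (rule ccontr)
    assume "orb g \<inter> orb g' \<noteq> {}"
    then obtain a a' where a: "a \<in> A" "a' \<in> A" "K #> (g' \<otimes> a') = K #> (g \<otimes> a)" by (auto simp: orb_def)
    have gG: "g \<in> carrier G" "g' \<in> carrier G" using g \<Gamma> by auto
    define k where "k = (g' \<otimes> a') \<otimes> inv (g \<otimes> a)"
    have "k \<in> K" using r_coset_eq_iff[OF K, of "g' \<otimes> a'" "g \<otimes> a"] a gG by (simp add: k_def)
    moreover have "g' = k \<otimes> g \<otimes> (a \<otimes> inv a')"
      using a gG by (simp add: k_def inv_mult_group m_assoc) (simp add: m_assoc[symmetric])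
    ultimately have "g' \<in> DC g" using a by (auto simp: DC_def)
    then show False using uniq g by blast
  qed
  \<comment> \<open>Representatives of different double cosets lie in different right cosets of
    \<open>K\<close>, which bounds their number.\<close>
  have "inj_on (\<lambda>g. K #> g) \<Gamma>"
  proof (rule inj_onI)
    fix g g' assume g: "g \<in> \<Gamma>" "g' \<in> \<Gamma>" "K #> g = K #> g'"
    have "K #> x \<in> orb x" if "x \<in> \<Gamma>" for x
      unfolding orb_def using that \<Gamma> by (intro image_eqI[OF _ A.one_closed]) auto
    from this[OF g(1)] this[OF g(2)] have "K #> g \<in> orb g \<inter> orb g'" using g(3) by simp
    then show "g = g'" using orb_disj g by blast
  qed
  moreover have "(\<lambda>g. K #> g) ` \<Gamma> \<subseteq> rcosets K" using \<Gamma> by (auto simp: RCOSETS_def)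
  ultimately have fin_\<Gamma>: "finite \<Gamma>" using fin finite_imageD finite_subset by metis
  have orb: "finite (rcosets\<^bsub>G\<lparr>carrier := A\<rparr>\<^esub> (conj_part K A g)) \<and>
    card (rcosets\<^bsub>G\<lparr>carrier := A\<rparr>\<^esub> (conj_part K A g)) = card (orb g)" if g: "g \<in> \<Gamma>" for g
  proof -
    have gG: "g \<in> carrier G" using g \<Gamma> by auto
    have fin_orb: "finite (orb g)" using fin g unfolding orb_union by (meson UN_upper finite_subset)
    have eq: "K #> (g \<otimes> a) = K #> (g \<otimes> b) \<longleftrightarrow> conj_part K A g #> a = conj_part K A g #> b"
      if ab: "a \<in> A" "b \<in> A" for a b
    proof -
      have "(g \<otimes> a) \<otimes> inv (g \<otimes> b) = g \<otimes> (a \<otimes> inv b) \<otimes> inv g"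
        using ab gG by (simp add: inv_mult_group m_assoc)
      then show ?thesis
        using ab gG by (simp add: r_coset_eq_iff[OF K] r_coset_eq_iff[OF subgroup_conj_part(1)[OF K A gG]]) (simp add: conj_part_def)
    qed
    have "rcosets\<^bsub>G\<lparr>carrier := A\<rparr>\<^esub> (conj_part K A g) = (\<lambda>a. conj_part K A g #> a) ` A"
      by (auto simp: RCOSETS_def r_coset_def)
    then show ?thesis
      using finite_card_image_cong[of "\<lambda>a. K #> (g \<otimes> a)" A "\<lambda>a. conj_part K A g #> a"] eq fin_orb
      by (simp add: orb_def)
  qed
  show thesis
  proof
    show "double_coset_reps K A \<Gamma>"
      unfolding double_coset_reps_def
      using fin_\<Gamma> \<Gamma> cover uniq by (simp add: DC_def) blast
    have "card (rcosets K) = (\<Sum>g\<in>\<Gamma>. card (orb g))"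
      unfolding orb_union using fin_\<Gamma> fin orb_disj orb_union by (intro card_UN_disjoint) auto
    then show "(\<Sum>g\<in>\<Gamma>. card (rcosets\<^bsub>G\<lparr>carrier := A\<rparr>\<^esub> (conj_part K A g))) = card (rcosets K)"
      using orb by simp
  qed (use orb in auto)
qed

lemma right_transversal:
  assumes K: "subgroup K G" and fin: "finite (rcosets K)"
  obtains Z where "finite Z" "Z \<subseteq> carrier G" "\<And>x. x \<in> carrier G \<Longrightarrow> \<exists>k\<in>K. \<exists>z\<in>Z. x = k \<otimes> z"
proof -
  obtain \<Gamma> where \<Gamma>: "double_coset_reps K {\<one>} \<Gamma>"
    by (rule double_coset_reps_exist[OF K triv_subgroup fin])
  show thesis
  proof
    show "finite \<Gamma>" "\<Gamma> \<subseteq> carrier G" using \<Gamma> by (auto simp: double_coset_reps_def)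
    fix x assume "x \<in> carrier G"
    then obtain g k where g: "g \<in> \<Gamma>" "k \<in> K" "x = k \<otimes> g \<otimes> \<one>"
      using \<Gamma> unfolding double_coset_reps_def by blast
    moreover have "k \<otimes> g \<in> carrier G" using g \<Gamma> subgroup.subset[OF K] by (auto simp: double_coset_reps_def)
    ultimately show "\<exists>k\<in>K. \<exists>z\<in>\<Gamma>. x = k \<otimes> z" by auto
  qed
qed

section \<open>Finite presentability of finite index subgroups\<close>

lemma cayley_triangle_edges:
  assumes S: "S \<subseteq> carrier G" and P: "\<And>u v. (u, v) \<in> P \<Longrightarrow> u \<in> S \<and> v \<in> S \<and> inv u \<otimes> v \<in> S"
    and T: "(u, v, w) \<in> cayley_triangles G P"
  shows "(u, v) \<in> cayley_edges G S \<and> (v, w) \<in> cayley_edges G S \<and> (u, w) \<in> cayley_edges G S"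
proof -
  obtain a b where ab: "u \<in> carrier G" "(a, b) \<in> P" "v = u \<otimes> a" "w = u \<otimes> b"
    using T by (auto simp: cayley_triangles_def)
  then have abS: "a \<in> S" "b \<in> S" "inv a \<otimes> b \<in> S" "a \<in> carrier G" "b \<in> carrier G" using P[OF ab(2)] S by auto
  then have "w = v \<otimes> (inv a \<otimes> b)" using ab by (simp add: m_assoc) (simp add: m_assoc[symmetric])
  then have "(v, w) \<in> cayley_edges G S" using ab abS cayley_edgesI[of v G "inv a \<otimes> b" S] by simp
  then show ?thesis using ab abS by (auto intro: cayley_edgesI)
qed

text \<open>The Cayley complex of the whole group has finitely many orbits of cells under
  \<open>K\<close>. With \<open>q\<close> the identity, the collapse only contracts the translates
  of a transversal tree, as in the Reidemeister-Schreier method.\<close>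

lemma finite_index_presentable:
  assumes pres: "is_presentation G n rs" and K: "subgroup K G" and fin: "finite (rcosets K)"
  shows "\<exists>n rs. is_presentation (G\<lparr>carrier := K\<rparr>) n rs"
proof -
  obtain S P where S: "finite S" "S \<subseteq> carrier G" "\<And>s. s \<in> S \<Longrightarrow> inv s \<in> S" and
    P: "finite P" "\<And>u v. (u, v) \<in> P \<Longrightarrow> u \<in> S \<and> v \<in> S \<and> inv u \<otimes> v \<in> S" and
    sc: "simply_connected (carrier G) (cayley_edges G S) (cayley_triangles G P)"
    using presentation_complex[OF pres] by metis
  obtain Z where Z: "finite Z" "Z \<subseteq> carrier G" "\<And>x. x \<in> carrier G \<Longrightarrow> \<exists>k\<in>K. \<exists>z\<in>Z. x = k \<otimes> z"
    using right_transversal[OF K fin] by metis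
  interpret K: subgroup K G by fact
  interpret C: collapse "G\<lparr>carrier := K\<rparr>" "(\<otimes>)" "carrier G" "cayley_edges G S" "cayley_triangles G P" "\<lambda>x. x"
  proof (intro collapse.intro collapse_axioms.intro)
    show "group (G\<lparr>carrier := K\<rparr>)" by (rule K.subgroup_is_group) (rule is_group)
    show "sym (cayley_edges G S)" using S by (intro sym_cayley_edges)
    show "cayley_edges G S \<subseteq> carrier G \<times> carrier G" using S by (auto simp: cayley_edges_def)
    fix g u v assume g: "g \<in> carrier (G\<lparr>carrier := K\<rparr>)" "(u, v) \<in> cayley_edges G S"
    then obtain s where "u \<in> carrier G" "s \<in> S" "v = u \<otimes> s" by (auto simp: cayley_edges_def)
    then show "(g \<otimes> u, g \<otimes> v) \<in> cayley_edges G S"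
      using g S cayley_edgesI[of "g \<otimes> u" G s S] by (auto simp: m_assoc)
  next
    show "(u, v) \<in> cayley_edges G S \<and> (v, w) \<in> cayley_edges G S \<and> (u, w) \<in> cayley_edges G S"
      if "(u, v, w) \<in> cayley_triangles G P" for u v w
      by (rule cayley_triangle_edges[OF S(2) P(2) that])
  qed (use sc K.subset in \<open>auto simp: m_assoc\<close>)
  have "\<exists>n rs. is_presentation (G\<lparr>carrier := K\<rparr>) n rs \<and>
      (\<Sum>r\<leftarrow>rs. length r - 2) \<le> card ((\<lambda>(z, u, v). (z, z \<otimes> u, z \<otimes> v)) ` (Z \<times> P))"
  proof (rule C.presentation_exists)
    show "finite ((\<lambda>(z, s). (z, z \<otimes> s)) ` (Z \<times> S))" using Z S by auto
    show "(\<lambda>(z, s). (z, z \<otimes> s)) ` (Z \<times> S) \<subseteq> carrier G \<times> carrier G" using Z S by auto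
    show "finite ((\<lambda>(z, u, v). (z, z \<otimes> u, z \<otimes> v)) ` (Z \<times> P))" using Z P by auto
    show "(\<lambda>(z, u, v). (z, z \<otimes> u, z \<otimes> v)) ` (Z \<times> P) \<subseteq> cayley_triangles G P"
      using Z by (auto simp: cayley_triangles_def)
  next
    fix u v assume "(u, v) \<in> cayley_edges G S"
    then obtain s where s: "u \<in> carrier G" "s \<in> S" "v = u \<otimes> s" by (auto simp: cayley_edges_def)
    obtain k z where "k \<in> K" "z \<in> Z" "u = k \<otimes> z" using Z(3)[OF s(1)] by blast
    moreover from this have "v = k \<otimes> (z \<otimes> s)" using s S Z K.subset by (auto simp: m_assoc subset_eq)
    ultimately show "\<exists>g\<in>carrier (G\<lparr>carrier := K\<rparr>). \<exists>(a, b)\<in>(\<lambda>(z, s). (z, z \<otimes> s)) ` (Z \<times> S). u = g \<otimes> a \<and> v = g \<otimes> b"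
      using s by (intro bexI[of _ k] bexI[of _ "(z, z \<otimes> s)"] image_eqI[of _ _ "(z, s)"]) auto
  next
    fix u v w assume "(u, v, w) \<in> cayley_triangles G P"
    then obtain a b where ab: "u \<in> carrier G" "(a, b) \<in> P" "v = u \<otimes> a" "w = u \<otimes> b" by (auto simp: cayley_triangles_def)
    then have abG: "a \<in> carrier G" "b \<in> carrier G" using P(2)[OF ab(2)] S by auto
    obtain k z where "k \<in> K" "z \<in> Z" "u = k \<otimes> z" using Z(3)[OF ab(1)] by blast
    moreover from this have "v = k \<otimes> (z \<otimes> a)" "w = k \<otimes> (z \<otimes> b)" using ab abG Z K.subset by (auto simp: m_assoc subset_eq)
    ultimately show "\<exists>g\<in>carrier (G\<lparr>carrier := K\<rparr>). \<exists>(a, b, c)\<in>(\<lambda>(z, u, v). (z, z \<otimes> u, z \<otimes> v)) ` (Z \<times> P).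
        u = g \<otimes> a \<and> v = g \<otimes> b \<and> w = g \<otimes> c"
      using ab by (intro bexI[of _ k] bexI[of _ "(z, z \<otimes> a, z \<otimes> b)"] image_eqI[of _ _ "(z, a, b)"]) auto
  qed
  then show ?thesis by blast
qed

end

lemma presentation_length_le:
  assumes "is_presentation G n rs" "(\<Sum>r\<leftarrow>rs. length r - 2) \<le> t"
  shows "presentation_length G \<le> t"
  unfolding presentation_length_def using assms by (intro order_trans[OF Least_le]) blast+

lemma presentation_length_attained:
  assumes "\<exists>n rs. is_presentation G n rs"
  obtains n rs where "is_presentation G n rs" "presentation_length G = (\<Sum>r\<leftarrow>rs. length r - 2)"
proof -
  have "\<exists>k n rs. is_presentation G n rs \<and> k = (\<Sum>r\<leftarrow>rs. length r - 2)" using assms by blast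
  from LeastI_ex[OF this] show thesis using that unfolding presentation_length_def by blast
qed

section \<open>Splittings as free products\<close>

text \<open>The left cosets of the two factors are the vertices of the Bass--Serre tree of a free product, and the
  elements of the group are its edges.  The map \<open>p s\<close> is the projection of the edges onto the
  star of the vertex \<open>A s\<close>.  The assumption \<open>p_change\<close> says that the star of \<open>A s\<close> can only be
  crossed inside \<open>A s\<close>, which makes the graph a tree.\<close>

locale free_splitting = group G for G (structure) +
  fixes A :: "bool \<Rightarrow> 'a set" and p :: "bool \<Rightarrow> 'a \<Rightarrow> 'a"
  assumes subgroup_A: "subgroup (A s) G"
    and p_closed: "u \<in> carrier G \<Longrightarrow> p s u \<in> A s"
    and p_one: "p s \<one> = \<one>"
    and p_mult: "a \<in> A s \<Longrightarrow> u \<in> carrier G \<Longrightarrow> p s (a \<otimes> u) = a \<otimes> p s u"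
    and p_change: "x \<in> A t \<Longrightarrow> v \<in> carrier G \<Longrightarrow> p s (v \<otimes> x) \<noteq> p s v \<Longrightarrow> s = t \<and> v \<in> A s"
    and generated: "P \<one> \<Longrightarrow> (\<And>u x t. u \<in> carrier G \<Longrightarrow> x \<in> A t \<Longrightarrow> P u \<Longrightarrow> P (u \<otimes> x)) \<Longrightarrow> u \<in> carrier G \<Longrightarrow> P u"
    and glue: "group (Q :: nat letter list set monoid) \<Longrightarrow> (\<And>s u. u \<in> carrier G \<Longrightarrow> f s u \<in> carrier Q) \<Longrightarrow>
      \<exists>pot \<in> carrier G \<rightarrow> carrier Q. \<forall>s. \<forall>u\<in>carrier G. \<forall>a\<in>A s.
        pot (u \<otimes> a) = pot u \<otimes>\<^bsub>Q\<^esub> (inv\<^bsub>Q\<^esub> f s u \<otimes>\<^bsub>Q\<^esub> f s (u \<otimes> a))"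
begin

lemma A_closed: "a \<in> A s \<Longrightarrow> a \<in> carrier G"
  using subgroup.subset[OF subgroup_A] by auto

lemma A_one: "\<one> \<in> A s"
  using subgroup.one_closed[OF subgroup_A] .

lemma A_mult: "a \<in> A s \<Longrightarrow> b \<in> A s \<Longrightarrow> a \<otimes> b \<in> A s"
  using subgroup.m_closed[OF subgroup_A] .

lemma A_inv: "a \<in> A s \<Longrightarrow> inv a \<in> A s"
  using subgroup.m_inv_closed[OF subgroup_A] .

text \<open>A step that changes the projection starts and ends in \<open>A s\<close>, so every
  element is reached from some point of \<open>A s\<close> by steps along which the projection is
  constant.\<close>

lemma projection_induct [consumes 1, case_names base step]:
  assumes "u \<in> carrier G" "\<And>a. a \<in> A s \<Longrightarrow> P a"
    and "\<And>u x t. u \<in> carrier G \<Longrightarrow> x \<in> A t \<Longrightarrow> p s (u \<otimes> x) = p s u \<Longrightarrow> P u \<Longrightarrow> P (u \<otimes> x)"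
  shows "P u"
proof (rule generated[of P])
  fix u x t assume u: "u \<in> carrier G" "x \<in> A t" "P u"
  show "P (u \<otimes> x)"
  proof (cases "p s (u \<otimes> x) = p s u")
    case False
    then show ?thesis using p_change[OF u(2,1) False] u A_mult assms(2) by auto
  qed (rule assms(3)[OF u(1,2) _ u(3)])
qed (use assms A_one in auto)

text \<open>Write \<open>x\<close> as a product of factor elements. On the way from \<open>v\<close>
  to \<open>v \<otimes> x\<close> the projection changes only at a step that starts in
  \<open>A s\<close>, so \<open>v\<close> is an element of \<open>A s\<close> times the inverse of
  one of the finitely many prefixes of \<open>x\<close>.\<close>

lemma finite_crossing:
  assumes "x \<in> carrier G"
  obtains V where "finite V" "V \<subseteq> carrier G"
    "\<And>v. v \<in> carrier G \<Longrightarrow> p s (v \<otimes> x) \<noteq> p s v \<Longrightarrow> \<exists>a\<in>A s. \<exists>w\<in>V. v = a \<otimes> w"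
proof -
  have "\<exists>V. finite V \<and> V \<subseteq> carrier G \<and>
      (\<forall>v\<in>carrier G. p s (v \<otimes> x) \<noteq> p s v \<longrightarrow> (\<exists>a\<in>A s. \<exists>w\<in>V. v = a \<otimes> w))"
    using assms
  proof (rule generated[rotated 2])
    show "\<exists>V. finite V \<and> V \<subseteq> carrier G \<and>
      (\<forall>v\<in>carrier G. p s (v \<otimes> \<one>) \<noteq> p s v \<longrightarrow> (\<exists>a\<in>A s. \<exists>w\<in>V. v = a \<otimes> w))"
      by (intro exI[of _ "{}"]) auto
    fix u y t assume u: "u \<in> carrier G" "y \<in> A t" and "\<exists>V. finite V \<and> V \<subseteq> carrier G \<and>
      (\<forall>v\<in>carrier G. p s (v \<otimes> u) \<noteq> p s v \<longrightarrow> (\<exists>a\<in>A s. \<exists>w\<in>V. v = a \<otimes> w))"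
    then obtain V where V: "finite V" "V \<subseteq> carrier G"
      "\<And>v. v \<in> carrier G \<Longrightarrow> p s (v \<otimes> u) \<noteq> p s v \<Longrightarrow> \<exists>a\<in>A s. \<exists>w\<in>V. v = a \<otimes> w" by blast
    have "\<exists>a\<in>A s. \<exists>w\<in>insert (inv u) V. v = a \<otimes> w"
      if v: "v \<in> carrier G" "p s (v \<otimes> (u \<otimes> y)) \<noteq> p s v" for v
    proof (cases "p s (v \<otimes> u) = p s v")
      case True
      then have "p s (v \<otimes> u \<otimes> y) \<noteq> p s (v \<otimes> u)" using v u A_closed[OF u(2)] by (simp add: m_assoc)
      then have "v \<otimes> u \<in> A s" using p_change[OF u(2)] v u by simp
      moreover have "v = v \<otimes> u \<otimes> inv u" using v u by (simp add: m_assoc)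
      ultimately show ?thesis by blast
    next
      case False
      then show ?thesis using V(3)[OF v(1)] by blast
    qed
    then show "\<exists>V. finite V \<and> V \<subseteq> carrier G \<and>
      (\<forall>v\<in>carrier G. p s (v \<otimes> (u \<otimes> y)) \<noteq> p s v \<longrightarrow> (\<exists>a\<in>A s. \<exists>w\<in>V. v = a \<otimes> w))"
      using V u by (intro exI[of _ "insert (inv u) V"]) auto
  qed
  then show thesis using that by blast
qed

text \<open>Seen from the vertex \<open>A s\<close>, the whole coset \<open>g A s'\<close> lies over
  the single point \<open>p s g\<close>. An element over another point is separated from that coset
  by the vertex \<open>A s\<close>, so it projects to the same point of the coset as
  \<open>A s\<close> does, which contains the identity.\<close>

lemma branch_projection:
  assumes g: "g \<in> carrier G" "\<not> (s' = s \<and> g \<in> A s)" and u: "u \<in> carrier G" "p s u \<noteq> p s g"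
  shows "p s' (inv g \<otimes> u) = p s' (inv g)"
proof -
  have clique: "p s (g \<otimes> a) = p s g" if "a \<in> A s'" for a
    using p_change[OF that g(1), of s] g(2) by auto
  have base: "p s' (inv g \<otimes> a) = p s' (inv g)" if a: "a \<in> A s" for a
  proof (rule ccontr)
    assume "p s' (inv g \<otimes> a) \<noteq> p s' (inv g)"
    then have "s' = s" "inv g \<in> A s" using p_change[OF a, of "inv g" s'] g by auto
    then show False using g A_inv[of "inv g" s] by simp
  qed
  have "p s u \<noteq> p s g \<longrightarrow> p s' (inv g \<otimes> u) = p s' (inv g)"
    using u(1)
  proof (induction rule: projection_induct[of u s])
    case (base a)
    then show ?case using \<open>\<And>a. a \<in> A s \<Longrightarrow> p s' (inv g \<otimes> a) = p s' (inv g)\<close> by blast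
  next
    case (step u x t)
    show ?case
    proof
      assume ne: "p s (u \<otimes> x) \<noteq> p s g"
      \<comment> \<open>The projection could change only at a point of the coset
        \<open>g A s'\<close>, but all of these lie over \<open>p s g\<close>.\<close>
      have "p s' (inv g \<otimes> u \<otimes> x) = p s' (inv g \<otimes> u)"
      proof (rule ccontr)
        assume "p s' (inv g \<otimes> u \<otimes> x) \<noteq> p s' (inv g \<otimes> u)"
        then have "inv g \<otimes> u \<in> A s'" using p_change[OF step(2), of "inv g \<otimes> u" s'] g(1) step(1) by blast
        then have "p s (g \<otimes> (inv g \<otimes> u)) = p s g" by (rule clique)
        then show False using ne step g by (simp add: m_assoc[symmetric])
      qed
      then show "p s' (inv g \<otimes> (u \<otimes> x)) = p s' (inv g)"
        using step ne g A_closed[OF step(2)] by (simp add: m_assoc)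
    qed
  qed
  then show ?thesis using u(2) by blast
qed

section \<open>Tripods and the uniqueness of medians\<close>

definition tripod :: "bool \<Rightarrow> 'a \<Rightarrow> 'a \<Rightarrow> 'a \<Rightarrow> bool"
  where "tripod s u v w \<longleftrightarrow> p s u \<noteq> p s v \<and> p s v \<noteq> p s w \<and> p s u \<noteq> p s w"

text \<open>In a tripod at one vertex, at most one of the three points lies in the direction of a
  second vertex. By \<open>branch_projection\<close> the other two have equal projections to the
  second vertex, so there is no tripod there.\<close>

lemma tripod_unique:
  assumes g: "g \<in> carrier G" "g' \<in> carrier G" and uvw: "u \<in> carrier G" "v \<in> carrier G" "w \<in> carrier G"
    and tri: "tripod s (inv g \<otimes> u) (inv g \<otimes> v) (inv g \<otimes> w)"
    and tri': "tripod s' (inv g' \<otimes> u) (inv g' \<otimes> v) (inv g' \<otimes> w)"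
  shows "s' = s \<and> inv g \<otimes> g' \<in> A s"
proof (rule ccontr)
  assume neg: "\<not> ?thesis"
  let ?d = "inv g \<otimes> g'"
  have "p s' (inv g' \<otimes> x) = p s' (inv ?d)" if "x \<in> carrier G" "p s (inv g \<otimes> x) \<noteq> p s ?d" for x
  proof -
    have "inv ?d \<otimes> (inv g \<otimes> x) = inv g' \<otimes> x"
      using g that by (simp add: inv_mult_group m_assoc) (simp add: m_assoc[symmetric])
    then show ?thesis using branch_projection[of ?d s' s "inv g \<otimes> x"] g that neg by simp
  qed
  then show False using tri tri' uvw unfolding tripod_def by metis
qed

end

section \<open>Presentation length of finite index subgroups of a splitting\<close>

context free_splitting
begin

text \<open>Whether the translate by \<open>k\<close> of the triangle \<open>\<one>, u, v\<close> meets the star of \<open>g A s\<close> in a tripod.\<close>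

definition spans :: "bool \<Rightarrow> 'a \<Rightarrow> 'a \<Rightarrow> 'a \<Rightarrow> 'a \<Rightarrow> bool"
  where "spans s g k u v \<longleftrightarrow> tripod s (inv g \<otimes> k) (inv g \<otimes> (k \<otimes> u)) (inv g \<otimes> (k \<otimes> v))"

text \<open>Translating back by \<open>k\<close> and \<open>k'\<close> turns both tripods into
  tripods of the one triangle \<one>, \<open>u\<close>, \<open>v\<close>.\<close>

lemma spans_unique:
  assumes "g \<in> carrier G" "g' \<in> carrier G" "k \<in> carrier G" "k' \<in> carrier G" "u \<in> carrier G" "v \<in> carrier G"
    and "spans s g k u v" "spans s' g' k' u v"
  shows "s' = s \<and> inv g \<otimes> (k \<otimes> inv k') \<otimes> g' \<in> A s"
proof -
  have shift: "inv h \<otimes> (l \<otimes> x) = inv (inv l \<otimes> h) \<otimes> x" if "h \<in> carrier G" "l \<in> carrier G" "x \<in> carrier G" for h l x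
    using that by (simp add: inv_mult_group m_assoc)
  have "s' = s \<and> inv (inv k \<otimes> g) \<otimes> (inv k' \<otimes> g') \<in> A s"
  proof (rule tripod_unique)
    show "tripod s (inv (inv k \<otimes> g) \<otimes> \<one>) (inv (inv k \<otimes> g) \<otimes> u) (inv (inv k \<otimes> g) \<otimes> v)"
      using assms shift[of g k \<one>] by (simp add: spans_def shift)
    show "tripod s' (inv (inv k' \<otimes> g') \<otimes> \<one>) (inv (inv k' \<otimes> g') \<otimes> u) (inv (inv k' \<otimes> g') \<otimes> v)"
      using assms shift[of g' k' \<one>] by (simp add: spans_def shift)
  qed (use assms in auto)
  then show ?thesis using assms by (simp add: inv_mult_group m_assoc)
qed

text \<open>The complex of \<open>K\<close> is collapsed by the projection to the star of the vertex
  \<open>g A s\<close>. Crossing edges form finitely many orbits by \<open>finite_crossing\<close>.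
  The crossing triangles of one type \<open>(u, v)\<close> in \<open>P\<close> form a single orbit
  by \<open>spans_unique\<close>, so each type counts once although the subgroup may have infinite
  index in \<open>K\<close>.\<close>

lemma part_presentation_length:
  assumes K: "subgroup K G" and S: "finite S" "S \<subseteq> K" "\<And>x. x \<in> S \<Longrightarrow> inv x \<in> S"
    and P: "finite P" "\<And>u v. (u, v) \<in> P \<Longrightarrow> u \<in> S \<and> v \<in> S \<and> inv u \<otimes> v \<in> S"
    and sc: "simply_connected K (cayley_edges (G\<lparr>carrier := K\<rparr>) S) (cayley_triangles (G\<lparr>carrier := K\<rparr>) P)"
    and g: "g \<in> carrier G"
  shows "presentation_length (G\<lparr>carrier := conj_part K (A s) g\<rparr>) \<le> card {(u, v) \<in> P. \<exists>k\<in>K. spans s g k u v}"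
proof -
  let ?C = "conj_part K (A s) g" and ?K = "G\<lparr>carrier := K\<rparr>"
  let ?E = "cayley_edges ?K S" and ?T = "cayley_triangles ?K P"
  let ?P = "{(u, v) \<in> P. \<exists>k\<in>K. spans s g k u v}"
  \<comment> \<open>An element of \<open>?C\<close> lies in \<open>A s\<close> and its conjugate by
    \<open>g\<close> in \<open>K\<close>; it acts on \<open>K\<close> through this
    conjugate.\<close>
  define act where "act c k = g \<otimes> c \<otimes> inv g \<otimes> k" for c k
  define q where "q k = p s (inv g \<otimes> k)" for k
  interpret K: subgroup K G by fact
  interpret KG: group ?K by (rule K.subgroup_is_group) (rule is_group)
  have inv_K: "inv\<^bsub>?K\<^esub> x = inv x" if "x \<in> K" for x using that K m_inv_consistent by auto
  have C: "subgroup ?C G" using subgroup_conj_part(1)[OF K subgroup_A g] .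
  have C_closed: "c \<in> carrier G" "c \<in> A s" "g \<otimes> c \<otimes> inv g \<in> K" if "c \<in> ?C" for c
    using that A_closed by (auto simp: conj_part_def)
  have SP: "u \<in> K" "v \<in> K" if "(u, v) \<in> P" for u v using P(2)[OF that] S by auto
  have q_act: "q (act c k) = c \<otimes> q k" if "c \<in> ?C" "k \<in> K" for c k
  proof -
    have "inv g \<otimes> act c k = c \<otimes> (inv g \<otimes> k)"
      using that C_closed[OF that(1)] g by (simp add: act_def m_assoc) (simp add: m_assoc[symmetric])
    then show ?thesis using that C_closed[OF that(1)] g by (simp add: q_def p_mult)
  qed
  have q_closed: "q k \<in> carrier G" if "k \<in> K" for k unfolding q_def using that g by (intro A_closed[OF p_closed]) auto
  have act_right: "act c (k \<otimes> x) = act c k \<otimes> x" if "c \<in> ?C" "k \<in> K" "x \<in> K" for c k x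
    using that C_closed[OF that(1)] g by (simp add: act_def m_assoc)
  interpret C: collapse "G\<lparr>carrier := ?C\<rparr>" act K ?E ?T q
  proof (intro collapse.intro collapse_axioms.intro)
    show "group (G\<lparr>carrier := ?C\<rparr>)" by (rule subgroup.subgroup_is_group[OF C]) (rule is_group)
    show "act \<one>\<^bsub>G\<lparr>carrier := ?C\<rparr>\<^esub> w = w" if "w \<in> K" for w using that g by (simp add: act_def)
    show "act c w \<in> K" if "c \<in> carrier (G\<lparr>carrier := ?C\<rparr>)" "w \<in> K" for c w
      using that C_closed[of c] by (simp add: act_def)
    show "act (c \<otimes>\<^bsub>G\<lparr>carrier := ?C\<rparr>\<^esub> c') w = act c (act c' w)"
      if "c \<in> carrier (G\<lparr>carrier := ?C\<rparr>)" "c' \<in> carrier (G\<lparr>carrier := ?C\<rparr>)" "w \<in> K" for c c' w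
      using that C_closed[of c] C_closed[of c'] g
        m_assoc[of "g \<otimes> c \<otimes> inv g" "g \<otimes> c' \<otimes> inv g" w]
      by (simp add: act_def conj_mult)
    show "?E \<subseteq> K \<times> K" using S by (auto simp: cayley_edges_def)
    show "sym ?E" using S inv_K by (intro KG.sym_cayley_edges) auto
    show "K \<noteq> {}" using K.one_closed by blast
    show "simply_connected K ?E ?T" by fact
    show "(u, v) \<in> ?E \<and> (v, w) \<in> ?E \<and> (u, w) \<in> ?E" if "(u, v, w) \<in> ?T" for u v w
      using S P inv_K SP by (intro KG.cayley_triangle_edges[OF _ _ that]) auto
    show "q (act c u) = q (act c v)" if "c \<in> carrier (G\<lparr>carrier := ?C\<rparr>)" "u \<in> K" "v \<in> K" "q u = q v" for c u v
      using that q_act by simp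
    show "c = \<one>\<^bsub>G\<lparr>carrier := ?C\<rparr>\<^esub>" if "c \<in> carrier (G\<lparr>carrier := ?C\<rparr>)" "w \<in> K" "q (act c w) = q w" for c w
      using that q_act[of c w] C_closed[of c] q_closed by simp
    fix c u v assume c: "c \<in> carrier (G\<lparr>carrier := ?C\<rparr>)" and "(u, v) \<in> ?E"
    then obtain x where x: "u \<in> K" "x \<in> S" "v = u \<otimes> x" by (auto simp: cayley_edges_def)
    moreover have "act c u \<in> K" using c x C_closed[of c] by (simp add: act_def)
    ultimately show "(act c u, act c v) \<in> ?E"
      using c S act_right[of c u x] cayley_edgesI[of "act c u" ?K x S] by auto
  qed
  define V where "V x = (SOME V. finite V \<and> V \<subseteq> carrier G \<and>
    (\<forall>v\<in>carrier G. p s (v \<otimes> x) \<noteq> p s v \<longrightarrow> (\<exists>a\<in>A s. \<exists>w\<in>V. v = a \<otimes> w)))" for x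
  have V: "finite (V x)" "V x \<subseteq> carrier G" "\<And>v. v \<in> carrier G \<Longrightarrow> p s (v \<otimes> x) \<noteq> p s v \<Longrightarrow> \<exists>a\<in>A s. \<exists>w\<in>V x. v = a \<otimes> w"
    if "x \<in> carrier G" for x
  proof -
    have "\<exists>V. finite V \<and> V \<subseteq> carrier G \<and>
      (\<forall>v\<in>carrier G. p s (v \<otimes> x) \<noteq> p s v \<longrightarrow> (\<exists>a\<in>A s. \<exists>w\<in>V. v = a \<otimes> w))"
      using finite_crossing[OF that, of s] by metis
    from someI_ex[OF this]
    show "finite (V x)" "V x \<subseteq> carrier G" "\<And>v. v \<in> carrier G \<Longrightarrow> p s (v \<otimes> x) \<noteq> p s v \<Longrightarrow> \<exists>a\<in>A s. \<exists>w\<in>V x. v = a \<otimes> w"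
      unfolding V_def by blast+
  qed
  \<comment> \<open>Starting points of crossing edges are classified by their position relative to
    \<open>g\<close>, modulo \<open>A s\<close> on the left. One point of \<open>K\<close> is chosen
    in every class that contains one, and \<open>liftable\<close> marks these classes.\<close>
  define lift where "lift w = (SOME k. k \<in> K \<and> (\<exists>a\<in>A s. inv g \<otimes> k = a \<otimes> w))" for w
  define liftable where "liftable w \<longleftrightarrow> (\<exists>k\<in>K. \<exists>a\<in>A s. inv g \<otimes> k = a \<otimes> w)" for w
  have lift: "lift w \<in> K \<and> (\<exists>a\<in>A s. inv g \<otimes> lift w = a \<otimes> w)" if "liftable w" for w
  proof -
    have "\<exists>k. k \<in> K \<and> (\<exists>a\<in>A s. inv g \<otimes> k = a \<otimes> w)" using that unfolding liftable_def by blast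
    then show ?thesis unfolding lift_def by (rule someI_ex)
  qed
  define E0 where "E0 = (\<Union>x\<in>S. (\<lambda>w. (lift w, lift w \<otimes> x)) ` {w \<in> V x. liftable w})"
  define tri where "tri = (\<lambda>(u, v). SOME k. k \<in> K \<and> spans s g k u v)"
  have tri: "tri (u, v) \<in> K" "spans s g (tri (u, v)) u v" if "(u, v) \<in> ?P" for u v
  proof -
    have "\<exists>k. k \<in> K \<and> spans s g k u v" using that by auto
    from someI_ex[OF this] show "tri (u, v) \<in> K" "spans s g (tri (u, v)) u v" by (auto simp: tri_def)
  qed
  define T0 where "T0 = (\<lambda>(u, v). (tri (u, v), tri (u, v) \<otimes> u, tri (u, v) \<otimes> v)) ` ?P"
  have fin_P: "finite ?P" using finite_subset[OF _ P(1), of ?P] by auto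
  have "\<exists>n rs. is_presentation (G\<lparr>carrier := ?C\<rparr>) n rs \<and> (\<Sum>r\<leftarrow>rs. length r - 2) \<le> card T0"
  proof (rule C.presentation_exists)
    show "finite E0" using S(1) V(1) S(2) K.subset unfolding E0_def by (intro finite_UN_I finite_imageI) auto
    show "E0 \<subseteq> K \<times> K" using S lift unfolding E0_def by auto
    show "finite T0" using fin_P by (simp add: T0_def)
    show "T0 \<subseteq> ?T"
    proof
      fix t assume "t \<in> T0"
      then obtain u v where uv: "(u, v) \<in> ?P" "t = (tri (u, v), tri (u, v) \<otimes> u, tri (u, v) \<otimes> v)"
        unfolding T0_def by auto
      then show "t \<in> ?T" using tri(1)[OF uv(1)] cayley_trianglesI[of "tri (u, v)" ?K u v P] by simp
    qed
  next
    fix u v assume uv: "(u, v) \<in> ?E" "q u \<noteq> q v"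
    then obtain x where x: "u \<in> K" "x \<in> S" "v = u \<otimes> x" by (auto simp: cayley_edges_def)
    have xG: "x \<in> carrier G" "u \<in> carrier G" using x S K.subset by auto
    have "p s (inv g \<otimes> u \<otimes> x) \<noteq> p s (inv g \<otimes> u)" using uv x xG g by (simp add: q_def m_assoc)
    then obtain a w where aw: "a \<in> A s" "w \<in> V x" "inv g \<otimes> u = a \<otimes> w"
      using V(3)[OF xG(1), of "inv g \<otimes> u"] g xG by auto
    then have w: "liftable w" "w \<in> carrier G" using x V(2)[OF xG(1)] by (auto simp: liftable_def)
    obtain b where b: "lift w \<in> K" "b \<in> A s" "inv g \<otimes> lift w = b \<otimes> w" using lift[OF w(1)] by blast
    have lG: "lift w \<in> carrier G" "a \<in> carrier G" "b \<in> carrier G" using b aw A_closed K.subset by auto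
    \<comment> \<open>\<open>u\<close> and the chosen point both lie over \<open>w\<close>, so the
      quotient of \<open>a\<close> and \<open>b\<close> carries one to the other.\<close>
    define c where "c = a \<otimes> inv b"
    have cA: "c \<in> A s" using aw b A_mult A_inv by (simp add: c_def)
    have u: "u = g \<otimes> (a \<otimes> w)" using aw(3) g xG lG w by (metis inv_solve_left' m_closed)
    have l: "lift w = g \<otimes> (b \<otimes> w)" using b(3) g lG w by (metis inv_solve_left' m_closed)
    have act_c: "act c (lift w) = u"
      unfolding act_def l u c_def using g lG w by (simp add: m_assoc) (simp add: m_assoc[symmetric])
    have "g \<otimes> c \<otimes> inv g = u \<otimes> inv (lift w)"
      using act_c g lG A_closed[OF cA] by (simp add: act_def m_assoc inv_solve_right xG flip: act_c)
    then have cC: "c \<in> ?C" using cA x b by (simp add: conj_part_def)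
    moreover have "(lift w, lift w \<otimes> x) \<in> E0" using x aw w by (auto simp: E0_def)
    moreover have "v = act c (lift w \<otimes> x)" using act_c act_right[OF cC b(1), of x] x S by auto
    ultimately show "\<exists>c\<in>carrier (G\<lparr>carrier := ?C\<rparr>). \<exists>(a, b)\<in>E0. u = act c a \<and> v = act c b"
      using act_c by (intro bexI[of _ c] bexI[of _ "(lift w, lift w \<otimes> x)"]) auto
  next
    fix u v w assume T: "(u, v, w) \<in> ?T" and q: "q u \<noteq> q v" "q v \<noteq> q w" "q u \<noteq> q w"
    then obtain a b where ab: "u \<in> K" "(a, b) \<in> P" "v = u \<otimes> a" "w = u \<otimes> b" by (auto simp: cayley_triangles_def)
    have span: "spans s g u a b" using q ab by (simp add: spans_def tripod_def q_def)
    then have P': "(a, b) \<in> ?P" using ab by auto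
    let ?k = "tri (a, b)"
    define c where "c = inv g \<otimes> (u \<otimes> inv ?k) \<otimes> g"
    have k: "?k \<in> K" "?k \<in> carrier G" using tri[OF P'] K.subset by auto
    have abK: "a \<in> K" "b \<in> K" "u \<in> carrier G" "a \<in> carrier G" "b \<in> carrier G" using SP[OF ab(2)] ab(1) K.subset by auto
    \<comment> \<open>\<open>u\<close> and the chosen \<open>?k\<close> give tripods of the same
      type at the same vertex.\<close>
    have cA: "c \<in> A s"
      using spans_unique[OF g g abK(3) k(2) abK(4,5) span tri(2)[OF P']] by (simp add: c_def)
    have gc: "g \<otimes> c \<otimes> inv g = u \<otimes> inv ?k"
      using g k abK by (simp add: c_def m_assoc) (simp add: m_assoc[symmetric])
    then have cC: "c \<in> ?C" using cA k ab by (simp add: conj_part_def)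
    have "act c ?k = u" using g k abK by (simp add: act_def gc m_assoc)
    then show "\<exists>c\<in>carrier (G\<lparr>carrier := ?C\<rparr>). \<exists>(x, y, z)\<in>T0. u = act c x \<and> v = act c y \<and> w = act c z"
      using cC ab P' act_right[OF cC k(1)] abK
      by (intro bexI[of _ c] bexI[of _ "(?k, ?k \<otimes> a, ?k \<otimes> b)"]) (auto simp: T0_def intro!: image_eqI[of _ _ "(a, b)"])
  qed
  then have "presentation_length (G\<lparr>carrier := ?C\<rparr>) \<le> card T0" using presentation_length_le by blast
  also have "\<dots> \<le> card ?P" unfolding T0_def by (rule card_image_le[OF fin_P])
  finally show ?thesis .
qed

text \<open>A pair in \<open>P\<close> that spans tripods for two indices \<open>(s, g)\<close> and
  \<open>(s', g')\<close> forces \<open>s' = s\<close> and puts \<open>g\<close> and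
  \<open>g'\<close> into the same double coset. Hence the bounds for the parts count disjoint
  subsets of \<open>P\<close>.\<close>

theorem presentation_length_parts_le:
  assumes K: "subgroup K G" and pres: "is_presentation (G\<lparr>carrier := K\<rparr>) n rs"
    and \<Gamma>: "\<And>s. double_coset_reps K (A s) (\<Gamma> s)"
  shows "(\<Sum>(s, g)\<in>Sigma UNIV \<Gamma>. presentation_length (G\<lparr>carrier := conj_part K (A s) g\<rparr>)) \<le> (\<Sum>r\<leftarrow>rs. length r - 2)"
proof -
  let ?K = "G\<lparr>carrier := K\<rparr>"
  interpret K: subgroup K G by fact
  interpret KG: group ?K by (rule K.subgroup_is_group) (rule is_group)
  have inv_K: "inv\<^bsub>?K\<^esub> x = inv x" if "x \<in> K" for x using that K m_inv_consistent by auto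
  obtain S P where S: "finite S" "S \<subseteq> carrier ?K" "\<And>x. x \<in> S \<Longrightarrow> inv\<^bsub>?K\<^esub> x \<in> S"
    and P: "finite P" "card P \<le> (\<Sum>r\<leftarrow>rs. length r - 2)"
      "\<And>u v. (u, v) \<in> P \<Longrightarrow> u \<in> S \<and> v \<in> S \<and> inv\<^bsub>?K\<^esub> u \<otimes>\<^bsub>?K\<^esub> v \<in> S"
    and sc: "simply_connected (carrier ?K) (cayley_edges ?K S) (cayley_triangles ?K P)"
    by (rule KG.presentation_complex[OF pres]) (rule that; assumption)
  have SK: "S \<subseteq> K" using S by simp
  have S_inv: "inv x \<in> S" if "x \<in> S" for x using S(3)[OF that] inv_K[of x] SK that by auto
  have P_S: "u \<in> S \<and> v \<in> S \<and> inv u \<otimes> v \<in> S" if "(u, v) \<in> P" for u v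
    using P(3)[OF that] inv_K[of u] SK by auto
  define part where "part = (\<lambda>(s, g). {(u, v) \<in> P. \<exists>k\<in>K. spans s g k u v})"
  have \<Gamma>_carrier: "g \<in> carrier G" if "g \<in> \<Gamma> s" for g s using \<Gamma>[of s] that by (auto simp: double_coset_reps_def)
  have fin: "finite (Sigma UNIV \<Gamma>)" using \<Gamma> by (intro finite_SigmaI) (auto simp: double_coset_reps_def)
  have part_P: "part i \<subseteq> P" for i by (auto simp: part_def)
  have disj: "part i \<inter> part j = {}" if "i \<in> Sigma UNIV \<Gamma>" "j \<in> Sigma UNIV \<Gamma>" "i \<noteq> j" for i j
  proof (rule ccontr)
    assume "part i \<inter> part j \<noteq> {}"
    moreover obtain s g s' g' where ij: "i = (s, g)" "j = (s', g')" by (cases i, cases j) auto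
    ultimately obtain u v k k' where uv: "(u, v) \<in> P" "k \<in> K" "k' \<in> K" "spans s g k u v" "spans s' g' k' u v"
      by (auto simp: part_def)
    have g: "g \<in> \<Gamma> s" "g' \<in> \<Gamma> s'" "g \<in> carrier G" "g' \<in> carrier G" using that ij \<Gamma>_carrier by auto
    have "u \<in> carrier G" "v \<in> carrier G" "k \<in> carrier G" "k' \<in> carrier G" using P_S[OF uv(1)] uv SK K.subset by auto
    note closed = this
    define a where "a = inv g \<otimes> (k \<otimes> inv k') \<otimes> g'"
    have "s' = s" "a \<in> A s" using spans_unique[OF g(3,4) closed(3,4,1,2) uv(4,5)] by (auto simp: a_def)
    moreover have "g' = (k' \<otimes> inv k) \<otimes> g \<otimes> a"
      using g closed by (simp add: a_def m_assoc) (simp add: m_assoc[symmetric])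
    moreover have "k' \<otimes> inv k \<in> K" using uv by simp
    ultimately have "g' = g" using \<Gamma>[of s] g unfolding double_coset_reps_def by blast
    then show False using \<open>s' = s\<close> ij that by simp
  qed
  have "(\<Sum>(s, g)\<in>Sigma UNIV \<Gamma>. presentation_length (G\<lparr>carrier := conj_part K (A s) g\<rparr>)) \<le> (\<Sum>i\<in>Sigma UNIV \<Gamma>. card (part i))"
  proof (rule sum_mono)
    fix i assume "i \<in> Sigma UNIV \<Gamma>"
    then obtain s g where i: "i = (s, g)" "g \<in> carrier G" using \<Gamma>_carrier by auto
    show "(case i of (s, g) \<Rightarrow> presentation_length (G\<lparr>carrier := conj_part K (A s) g\<rparr>)) \<le> card (part i)"
      using part_presentation_length[OF K S(1) SK S_inv P(1) P_S _ i(2), of s] sc by (simp add: i part_def)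
  qed
  also have "\<dots> = card (\<Union>i\<in>Sigma UNIV \<Gamma>. part i)"
    using fin disj finite_subset[OF part_P P(1)] by (intro card_UN_disjoint[symmetric]) auto
  also have "\<dots> \<le> card P" using part_P P(1) by (intro card_mono) auto
  finally show ?thesis using P(2) by linarith
qed

end

section \<open>Filling the cosets of the factors\<close>

definition edge_translates :: "('a, 'c) monoid_scheme \<Rightarrow> 'a set \<Rightarrow> ('a \<times> 'a) set \<Rightarrow> ('a \<times> 'a) set"
  where "edge_translates G H E = {(h \<otimes>\<^bsub>G\<^esub> u, h \<otimes>\<^bsub>G\<^esub> v) | h u v. h \<in> H \<and> (u, v) \<in> E}"

definition triangle_translates :: "('a, 'c) monoid_scheme \<Rightarrow> 'a set \<Rightarrow> ('a \<times> 'a \<times> 'a) set \<Rightarrow> ('a \<times> 'a \<times> 'a) set"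
  where "triangle_translates G H T =
    {(h \<otimes>\<^bsub>G\<^esub> u, h \<otimes>\<^bsub>G\<^esub> v, h \<otimes>\<^bsub>G\<^esub> w) | h u v w. h \<in> H \<and> (u, v, w) \<in> T}"

lemma edge_translatesI:
  "h \<in> H \<Longrightarrow> (u, v) \<in> E \<Longrightarrow> (h \<otimes>\<^bsub>G\<^esub> u, h \<otimes>\<^bsub>G\<^esub> v) \<in> edge_translates G H E"
  unfolding edge_translates_def by blast

lemma triangle_translatesI:
  "h \<in> H \<Longrightarrow> (u, v, w) \<in> T \<Longrightarrow> (h \<otimes>\<^bsub>G\<^esub> u, h \<otimes>\<^bsub>G\<^esub> v, h \<otimes>\<^bsub>G\<^esub> w) \<in> triangle_translates G H T"
  unfolding triangle_translates_def by blast

lemma translates_consistent [simp]: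
  "edge_translates (G\<lparr>carrier := A\<rparr>) H E = edge_translates G H E"
  "triangle_translates (G\<lparr>carrier := A\<rparr>) H T = triangle_translates G H T"
  by (simp_all add: edge_translates_def triangle_translates_def)

text \<open>A complex for \<open>H\<close> with vertex set \<open>G\<close>: the Cayley complex of \<open>H\<close>, with a hair attached to it for every
  further vertex.\<close>

lemma (in group) coset_complex:
  assumes H: "subgroup H G" and fin: "finite (rcosets H)" and pres: "is_presentation (G\<lparr>carrier := H\<rparr>) n rs"
  obtains E T where "finite E" "E \<subseteq> carrier G \<times> carrier G" "finite T" "card T \<le> (\<Sum>r\<leftarrow>rs. length r - 2)"
    "sym (edge_translates G H E)"
    "\<And>u v w. (u, v, w) \<in> T \<Longrightarrow> (u, v) \<in> edge_translates G H E \<and> (v, w) \<in> edge_translates G H E \<and> (u, w) \<in> edge_translates G H E"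
    "simply_connected (carrier G) (edge_translates G H E) (triangle_translates G H T)"
proof -
  let ?H = "G\<lparr>carrier := H\<rparr>"
  interpret H: subgroup H G by fact
  interpret HG: group ?H by (rule H.subgroup_is_group) (rule is_group)
  have inv_H: "inv\<^bsub>?H\<^esub> x = inv x" if "x \<in> H" for x using that H m_inv_consistent by auto
  obtain S P where S: "finite S" "S \<subseteq> carrier ?H" "\<And>x. x \<in> S \<Longrightarrow> inv\<^bsub>?H\<^esub> x \<in> S"
    and P: "finite P" "card P \<le> (\<Sum>r\<leftarrow>rs. length r - 2)"
      "\<And>u v. (u, v) \<in> P \<Longrightarrow> u \<in> S \<and> v \<in> S \<and> inv\<^bsub>?H\<^esub> u \<otimes>\<^bsub>?H\<^esub> v \<in> S"
    and sc: "simply_connected (carrier ?H) (cayley_edges ?H S) (cayley_triangles ?H P)"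
    by (rule HG.presentation_complex[OF pres]) (rule that; assumption)
  obtain Z0 where Z0: "double_coset_reps H {\<one>} Z0"
    by (rule double_coset_reps_exist[OF H triv_subgroup fin])
  \<comment> \<open>\<open>H\<close> itself carries the Cayley complex, so only points outside of it
    receive a hair.\<close>
  define Z where "Z = Z0 - H"
  have SH: "S \<subseteq> H" using S by simp
  have Z: "finite Z" "Z \<subseteq> carrier G" using Z0 by (auto simp: Z_def double_coset_reps_def)
  have hair_ex: "\<exists>h\<in>H. \<exists>z\<in>Z. x = h \<otimes> z" if x: "x \<in> carrier G" "x \<notin> H" for x
  proof -
    obtain h z where hz: "h \<in> H" "z \<in> Z0" "x = h \<otimes> z \<otimes> \<one>"
      using Z0 x unfolding double_coset_reps_def by blast
    then have "z \<in> carrier G" using Z0 by (auto simp: double_coset_reps_def)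
    then have "x = h \<otimes> z" using hz by simp
    moreover from this have "z \<notin> H" using hz x by auto
    ultimately show ?thesis using hz by (auto simp: Z_def)
  qed
  have hair_unique: "h' = h" if "h \<in> H" "h' \<in> H" "z \<in> Z" "z' \<in> Z" "h \<otimes> z = h' \<otimes> z'" for h h' z z'
  proof -
    have zG: "z \<in> carrier G" "z' \<in> carrier G" using that Z by auto
    have "z' = (inv h' \<otimes> h) \<otimes> z \<otimes> \<one>" using that zG by (simp add: m_assoc) (simp add: m_assoc[symmetric])
    then have "z' = z" using Z0 that unfolding double_coset_reps_def Z_def
      by (metis DiffD1 H.m_closed H.m_inv_closed singletonI)
    then show ?thesis using that zG by simp
  qed
  have hair_out: "h \<otimes> z \<notin> H" if "h \<in> H" "z \<in> Z" for h z
  proof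
    assume "h \<otimes> z \<in> H"
    then have "inv h \<otimes> (h \<otimes> z) \<in> H" using that by simp
    moreover have "inv h \<otimes> (h \<otimes> z) = z" using that Z by (auto simp: m_assoc[symmetric])
    ultimately show False using that by (simp add: Z_def)
  qed
  \<comment> \<open>The hairs are inserted in both directions to make the set of edges symmetric;
    \<open>S\<close> is already closed under inverses.\<close>
  define E where "E = Pair \<one> ` S \<union> Pair \<one> ` Z \<union> (\<lambda>z. (z, \<one>)) ` Z"
  define T where "T = (\<lambda>(u, v). (\<one>, u, v)) ` P"
  let ?E = "edge_translates G H E" and ?T = "triangle_translates G H T"
  have E_iff: "(x, y) \<in> ?E \<longleftrightarrow> (x, y) \<in> cayley_edges ?H S \<or>
      (\<exists>h\<in>H. \<exists>z\<in>Z. (x = h \<and> y = h \<otimes> z) \<or> (y = h \<and> x = h \<otimes> z))" for x y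
  proof
    assume "(x, y) \<in> ?E"
    then obtain h u v where huv: "h \<in> H" "(u, v) \<in> E" "x = h \<otimes> u" "y = h \<otimes> v"
      unfolding edge_translates_def by blast
    then consider "u = \<one>" "v \<in> S" | "u = \<one>" "v \<in> Z" | "u \<in> Z" "v = \<one>" by (auto simp: E_def)
    then show "(x, y) \<in> cayley_edges ?H S \<or> (\<exists>h\<in>H. \<exists>z\<in>Z. (x = h \<and> y = h \<otimes> z) \<or> (y = h \<and> x = h \<otimes> z))"
    proof cases
      case 1
      then show ?thesis using huv cayley_edgesI[of h ?H v S] by simp
    next
      case 2
      then have "x = h \<and> y = h \<otimes> v" using huv by simp
      then show ?thesis using huv(1) 2 by blast
    next
      case 3
      then have "y = h \<and> x = h \<otimes> u" using huv by simp
      then show ?thesis using huv(1) 3 by blast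
    qed
  next
    assume "(x, y) \<in> cayley_edges ?H S \<or> (\<exists>h\<in>H. \<exists>z\<in>Z. (x = h \<and> y = h \<otimes> z) \<or> (y = h \<and> x = h \<otimes> z))"
    then consider s where "x \<in> H" "s \<in> S" "y = x \<otimes> s" | h z where "h \<in> H" "z \<in> Z" "x = h" "y = h \<otimes> z"
      | h z where "h \<in> H" "z \<in> Z" "y = h" "x = h \<otimes> z" by (auto simp: cayley_edges_def)
    then show "(x, y) \<in> ?E"
    proof cases
      case (1 s)
      then show ?thesis using edge_translatesI[of x H \<one> s E G] by (auto simp: E_def)
    next
      case (2 h z)
      then show ?thesis using edge_translatesI[of h H \<one> z E G] by (auto simp: E_def)
    next
      case (3 h z)
      then show ?thesis using edge_translatesI[of h H z \<one> E G] by (auto simp: E_def)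
    qed
  qed
  have T_cayley: "?T = cayley_triangles ?H P"
  proof -
    have "u \<in> carrier G" "v \<in> carrier G" if "(u, v) \<in> P" for u v using P(3)[OF that] SH by auto
    then show ?thesis unfolding triangle_translates_def cayley_triangles_def T_def by (auto; force)
  qed
  have cayley_sub: "cayley_edges ?H S \<subseteq> ?E" by (auto simp: E_iff)
  have sym_cayley: "sym (cayley_edges ?H S)" using S by (intro HG.sym_cayley_edges) auto
  have sym: "sym ?E"
    using symD[OF sym_cayley] by (intro symI) (auto simp only: E_iff)
  have "simply_connected (carrier G) ?E ?T"
    unfolding simply_connected_def
  proof (intro conjI ballI allI impI)
    have to_H: "\<exists>h\<in>H. (h, x) \<in> ?E\<^sup>* \<and> (x, h) \<in> ?E\<^sup>*" if "x \<in> carrier G" for x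
    proof (cases "x \<in> H")
      case False
      then obtain h z where "h \<in> H" "z \<in> Z" "x = h \<otimes> z" using hair_ex[OF \<open>x \<in> carrier G\<close>] by blast
      then have "(h, x) \<in> ?E" "(x, h) \<in> ?E" unfolding E_iff by auto
      then show ?thesis using \<open>h \<in> H\<close> by blast
    qed auto
    have "(cayley_edges ?H S)\<^sup>* \<subseteq> ?E\<^sup>*" using cayley_sub by (rule rtrancl_mono)
    then have H_conn: "(h, h') \<in> ?E\<^sup>*" if "h \<in> H" "h' \<in> H" for h h'
      using simply_connectedD[OF sc, of h h'] that by auto
    show "(x, y) \<in> ?E\<^sup>*" if "x \<in> carrier G" "y \<in> carrier G" for x y
      using to_H[OF that(1)] to_H[OF that(2)] H_conn by (meson rtrancl_trans)
  next
    fix Q :: "nat letter list set monoid" and c assume Q: "group Q" and c: "cocycle Q ?E ?T c"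
    interpret Q: group Q by fact
    have cE: "c u v \<in> carrier Q" "c u v \<otimes>\<^bsub>Q\<^esub> c v u = \<one>\<^bsub>Q\<^esub>" if "(u, v) \<in> ?E" for u v
      using that c by (auto simp: cocycle_def)
    have "cocycle Q (cayley_edges ?H S) (cayley_triangles ?H P) c"
      using c cayley_sub T_cayley by (elim cocycle_mono) auto
    then obtain p where p: "p \<in> H \<rightarrow> carrier Q"
      "\<And>u v. (u, v) \<in> cayley_edges ?H S \<Longrightarrow> p v = p u \<otimes>\<^bsub>Q\<^esub> c u v"
      using simply_connected_potential[OF sc Q] by auto
    define base where "base x = (THE h. h \<in> H \<and> (\<exists>z\<in>Z. x = h \<otimes> z))" for x
    have base: "base (h \<otimes> z) = h" if "h \<in> H" "z \<in> Z" for h z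
      unfolding base_def using that hair_unique by (intro the_equality) blast+
    \<comment> \<open>Up to direction, a point outside \<open>H\<close> lies on a single edge, so
      its value is forced by that of the base of its hair.\<close>
    define p' where "p' x = (if x \<in> H then p x else p (base x) \<otimes>\<^bsub>Q\<^esub> c (base x) x)" for x
    have p'_hair: "p' (h \<otimes> z) = p h \<otimes>\<^bsub>Q\<^esub> c h (h \<otimes> z)" if "h \<in> H" "z \<in> Z" for h z
      using that hair_out base by (simp add: p'_def)
    have "potential Q (carrier G) ?E c p'"
      unfolding potential_def
    proof (intro conjI ballI funcsetI; clarify?)
      fix x assume x: "x \<in> carrier G"
      show "p' x \<in> carrier Q"
      proof (cases "x \<in> H")
        case True
        then show ?thesis using p by (auto simp: p'_def)
      next
        case False
        then obtain h z where hz: "h \<in> H" "z \<in> Z" "x = h \<otimes> z" using hair_ex x by blast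
        then have "(h, x) \<in> ?E" unfolding E_iff by auto
        then show ?thesis using hz p'_hair cE(1) p(1) by auto
      qed
    next
      fix x y assume xy: "(x, y) \<in> ?E"
      then consider "(x, y) \<in> cayley_edges ?H S" | h z where "h \<in> H" "z \<in> Z" "x = h" "y = h \<otimes> z"
        | h z where "h \<in> H" "z \<in> Z" "y = h" "x = h \<otimes> z" unfolding E_iff by blast
      then show "p' y = p' x \<otimes>\<^bsub>Q\<^esub> c x y"
      proof cases
        case 1
        then have "x \<in> H" "y \<in> H" using SH by (auto simp: cayley_edges_def)
        then show ?thesis using p(2)[OF 1] by (simp add: p'_def)
      next
        case (2 h z)
        then show ?thesis using p'_hair[of h z] by (simp add: p'_def)
      next
        case (3 h z)
        have "(y, x) \<in> ?E" using symD[OF sym xy] .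
        moreover have "p y \<in> carrier Q" using 3 p by auto
        ultimately show ?thesis
          using 3 p'_hair[of h z] cE(1)[OF xy] cE[of y x] by (simp add: p'_def Q.m_assoc)
      qed
    qed
    then show "\<exists>p. potential Q (carrier G) ?E c p" by blast
  qed
  moreover have "finite E" "E \<subseteq> carrier G \<times> carrier G" "finite T"
    using S SH Z P by (auto simp: E_def T_def)
  moreover have "card T \<le> (\<Sum>r\<leftarrow>rs. length r - 2)"
    using P(2) card_image_le[OF P(1)] unfolding T_def by (rule order_trans[rotated])
  moreover have "(u, v) \<in> ?E \<and> (v, w) \<in> ?E \<and> (u, w) \<in> ?E" if uvw: "(u, v, w) \<in> T" for u v w
  proof -
    have PH: "a \<in> carrier G" if "(a, b) \<in> P" for a b using P(3)[OF that] SH by auto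
    have PH': "b \<in> carrier G" if "(a, b) \<in> P" for a b using P(3)[OF that] SH by auto
    have "(u, v, w) \<in> cayley_triangles ?H P"
      using uvw cayley_trianglesI[of \<one> ?H v w P] PH PH' H.one_closed unfolding T_def by auto
    then show ?thesis
      using HG.cayley_triangle_edges[of S P u v w] S P(3) unfolding E_iff by blast
  qed
  ultimately show thesis using that[of E T] sym by blast
qed

context free_splitting
begin

text \<open>The stabiliser in \<open>K\<close> of the coset \<open>g A s\<close> is the conjugate by
  \<open>g\<close> of \<open>conj_part K (A s) g\<close>, so the translates under \<open>K\<close>
  of one complex for each \<open>(s, g)\<close> fill every coset of the factors exactly once. Every
  coset has a potential of its own, and \<open>glue\<close> assembles these because the cosets form
  a tree.\<close>

theorem presentation_of_parts:
  assumes K: "subgroup K G" and \<Gamma>: "\<And>s. double_coset_reps K (A s) (\<Gamma> s)"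
    and fin: "\<And>s g. g \<in> \<Gamma> s \<Longrightarrow> finite (rcosets\<^bsub>G\<lparr>carrier := A s\<rparr>\<^esub> (conj_part K (A s) g))"
    and pres: "\<And>s g. g \<in> \<Gamma> s \<Longrightarrow> \<exists>n rs. is_presentation (G\<lparr>carrier := conj_part K (A s) g\<rparr>) n rs"
  shows "\<exists>n rs. is_presentation (G\<lparr>carrier := K\<rparr>) n rs \<and> (\<Sum>r\<leftarrow>rs. length r - 2) \<le>
    (\<Sum>(s, g)\<in>Sigma UNIV \<Gamma>. presentation_length (G\<lparr>carrier := conj_part K (A s) g\<rparr>))"
proof -
  interpret K: subgroup K G by fact
  let ?C = "\<lambda>s g. conj_part K (A s) g"
  have \<Gamma>_carrier: "g \<in> carrier G" if "g \<in> \<Gamma> s" for g s using \<Gamma>[of s] that by (auto simp: double_coset_reps_def)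
  have fin_\<Gamma>: "finite (Sigma UNIV \<Gamma>)" using \<Gamma> by (intro finite_SigmaI) (auto simp: double_coset_reps_def)
  \<comment> \<open>Edges and triangles have to be chosen jointly, so one predicate collects all
    requirements on the pair.\<close>
  define adequate where "adequate s g E T \<longleftrightarrow> finite E \<and> E \<subseteq> A s \<times> A s \<and> finite T \<and> card T \<le> presentation_length (G\<lparr>carrier := ?C s g\<rparr>) \<and>
      sym (edge_translates G (?C s g) E) \<and>
      (\<forall>u v w. (u, v, w) \<in> T \<longrightarrow> (u, v) \<in> edge_translates G (?C s g) E \<and>
        (v, w) \<in> edge_translates G (?C s g) E \<and> (u, w) \<in> edge_translates G (?C s g) E) \<and>
      simply_connected (A s) (edge_translates G (?C s g) E) (triangle_translates G (?C s g) T)" for s g E T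
  have "\<exists>E T. adequate s g E T"
    if g: "g \<in> \<Gamma> s" for s g
  proof -
    have C: "subgroup (?C s g) (G\<lparr>carrier := A s\<rparr>)"
      using subgroup_conj_part(2)[OF K subgroup_A \<Gamma>_carrier[OF g]] .
    obtain n rs where "is_presentation (G\<lparr>carrier := ?C s g\<rparr>) n rs"
      "presentation_length (G\<lparr>carrier := ?C s g\<rparr>) = (\<Sum>r\<leftarrow>rs. length r - 2)"
      using presentation_length_attained[OF pres[OF g]] by blast
    then show ?thesis
      using group.coset_complex[OF subgroup.subgroup_is_group[OF subgroup_A is_group] C fin[OF g], of n rs]
      unfolding adequate_def by simp metis
  qed
  then have choice: "\<exists>ET. adequate s g (fst ET) (snd ET)" if "g \<in> \<Gamma> s" for s g using that by simp
  define E where "E s g = fst (SOME ET. adequate s g (fst ET) (snd ET))" for s g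
  define T where "T s g = snd (SOME ET. adequate s g (fst ET) (snd ET))" for s g
  have ET: "adequate s g (E s g) (T s g)" if "g \<in> \<Gamma> s" for s g
    unfolding E_def T_def using choice[OF that] by (rule someI_ex)
  have E: "\<And>s g. g \<in> \<Gamma> s \<Longrightarrow> finite (E s g)" "\<And>s g. g \<in> \<Gamma> s \<Longrightarrow> E s g \<subseteq> A s \<times> A s"
    and T: "\<And>s g. g \<in> \<Gamma> s \<Longrightarrow> finite (T s g)"
      "\<And>s g. g \<in> \<Gamma> s \<Longrightarrow> card (T s g) \<le> presentation_length (G\<lparr>carrier := ?C s g\<rparr>)"
    and sym: "\<And>s g. g \<in> \<Gamma> s \<Longrightarrow> sym (edge_translates G (?C s g) (E s g))"
    and TE: "\<And>s g u v w. g \<in> \<Gamma> s \<Longrightarrow> (u, v, w) \<in> T s g \<Longrightarrow> (u, v) \<in> edge_translates G (?C s g) (E s g) \<and>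
        (v, w) \<in> edge_translates G (?C s g) (E s g) \<and> (u, w) \<in> edge_translates G (?C s g) (E s g)"
    and sc: "\<And>s g. g \<in> \<Gamma> s \<Longrightarrow>
      simply_connected (A s) (edge_translates G (?C s g) (E s g)) (triangle_translates G (?C s g) (T s g))"
    using ET unfolding adequate_def by blast+
  define E0 where "E0 = (\<Union>(s, g)\<in>Sigma UNIV \<Gamma>. (\<lambda>(u, v). (g \<otimes> u, g \<otimes> v)) ` E s g)"
  define T0 where "T0 = (\<Union>(s, g)\<in>Sigma UNIV \<Gamma>. (\<lambda>(u, v, w). (g \<otimes> u, g \<otimes> v, g \<otimes> w)) ` T s g)"
  let ?E = "edge_translates G K E0" and ?T = "triangle_translates G K T0"
  have E_A: "u \<in> A s" "v \<in> A s" if "g \<in> \<Gamma> s" "(u, v) \<in> E s g" for u v s g using E(2)[OF that(1)] that(2) by auto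
  have EC_A: "u \<in> A s" "v \<in> A s" if "g \<in> \<Gamma> s" "(u, v) \<in> edge_translates G (?C s g) (E s g)" for u v s g
    using that E_A[OF that(1)] A_mult unfolding edge_translates_def conj_part_def by auto
  have T_A: "u \<in> A s" "v \<in> A s" "w \<in> A s" if "g \<in> \<Gamma> s" "(u, v, w) \<in> T s g" for u v w s g
    using TE[OF that] EC_A[OF that(1)] by blast+
  have E0_I: "(g \<otimes> u, g \<otimes> v) \<in> E0" if "g \<in> \<Gamma> s" "(u, v) \<in> E s g" for g s u v
    using that unfolding E0_def by force
  have E0_carrier: "E0 \<subseteq> carrier G \<times> carrier G"
  proof
    fix e assume "e \<in> E0"
    then obtain s g u v where g: "g \<in> \<Gamma> s" "(u, v) \<in> E s g" "e = (g \<otimes> u, g \<otimes> v)"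
      unfolding E0_def by auto
    then show "e \<in> carrier G \<times> carrier G"
      using E_A[OF g(1,2)] A_closed[of _ s] \<Gamma>_carrier[OF g(1)] by simp
  qed
  have T0_I: "(g \<otimes> u, g \<otimes> v, g \<otimes> w) \<in> T0" if "g \<in> \<Gamma> s" "(u, v, w) \<in> T s g" for g s u v w
    using that unfolding T0_def by force
  \<comment> \<open>Translation by \<open>c\<close> inside the coset \<open>g A s\<close> amounts to
    translation by the conjugate of \<open>c\<close>, which is absorbed into
    \<open>k\<close>.\<close>
  have shift: "k \<otimes> (g \<otimes> (c \<otimes> u)) = (k \<otimes> (g \<otimes> c \<otimes> inv g)) \<otimes> (g \<otimes> u)"
    if "k \<in> carrier G" "g \<in> carrier G" "c \<in> carrier G" "u \<in> carrier G" for k g c u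
    using that by (simp add: m_assoc) (simp add: m_assoc[symmetric])
  have C_D: "c \<in> A s" "c \<in> carrier G" "g \<otimes> c \<otimes> inv g \<in> K" if "c \<in> ?C s g" for c s g
    using that A_closed by (auto simp: conj_part_def)
  have E_I: "(k \<otimes> (g \<otimes> u), k \<otimes> (g \<otimes> v)) \<in> ?E"
    if k: "k \<in> K" and g: "g \<in> \<Gamma> s" and uv: "(u, v) \<in> edge_translates G (?C s g) (E s g)" for k g s u v
  proof -
    obtain c a b where c: "c \<in> ?C s g" "(a, b) \<in> E s g" "u = c \<otimes> a" "v = c \<otimes> b"
      using uv unfolding edge_translates_def by blast
    have "a \<in> carrier G" "b \<in> carrier G" using E_A[OF g c(2)] A_closed by auto
    then have "k \<otimes> (g \<otimes> u) = (k \<otimes> (g \<otimes> c \<otimes> inv g)) \<otimes> (g \<otimes> a)" "k \<otimes> (g \<otimes> v) = (k \<otimes> (g \<otimes> c \<otimes> inv g)) \<otimes> (g \<otimes> b)"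
      using shift k C_D[OF c(1)] \<Gamma>_carrier[OF g] c K.subset by auto
    moreover have "k \<otimes> (g \<otimes> c \<otimes> inv g) \<in> K" by (rule K.m_closed[OF k C_D(3)[OF c(1)]])
    ultimately show ?thesis using edge_translatesI[OF _ E0_I[OF g c(2)], of _ K G] by (simp only:)
  qed
  have T_I: "(k \<otimes> (g \<otimes> u), k \<otimes> (g \<otimes> v), k \<otimes> (g \<otimes> w)) \<in> ?T"
    if k: "k \<in> K" and g: "g \<in> \<Gamma> s" and uvw: "(u, v, w) \<in> triangle_translates G (?C s g) (T s g)" for k g s u v w
  proof -
    obtain c a b d where c: "c \<in> ?C s g" "(a, b, d) \<in> T s g" "u = c \<otimes> a" "v = c \<otimes> b" "w = c \<otimes> d"
      using uvw unfolding triangle_translates_def by blast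
    have "a \<in> carrier G" "b \<in> carrier G" "d \<in> carrier G" using T_A[OF g c(2)] A_closed by auto
    then have "k \<otimes> (g \<otimes> u) = (k \<otimes> (g \<otimes> c \<otimes> inv g)) \<otimes> (g \<otimes> a)" "k \<otimes> (g \<otimes> v) = (k \<otimes> (g \<otimes> c \<otimes> inv g)) \<otimes> (g \<otimes> b)"
      "k \<otimes> (g \<otimes> w) = (k \<otimes> (g \<otimes> c \<otimes> inv g)) \<otimes> (g \<otimes> d)"
      using shift k C_D[OF c(1)] \<Gamma>_carrier[OF g] c K.subset by auto
    moreover have "k \<otimes> (g \<otimes> c \<otimes> inv g) \<in> K" by (rule K.m_closed[OF k C_D(3)[OF c(1)]])
    ultimately show ?thesis using triangle_translatesI[OF _ T0_I[OF g c(2)], of _ K G] by (simp only:)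
  qed
  have E_D: "\<exists>k\<in>K. \<exists>s. \<exists>g\<in>\<Gamma> s. \<exists>(u, v)\<in>E s g. x = k \<otimes> (g \<otimes> u) \<and> y = k \<otimes> (g \<otimes> v)" if "(x, y) \<in> ?E" for x y
    using that unfolding edge_translates_def E0_def by fastforce
  have T_D: "\<exists>k\<in>K. \<exists>s. \<exists>g\<in>\<Gamma> s. \<exists>(u, v, w)\<in>T s g. x = k \<otimes> (g \<otimes> u) \<and> y = k \<otimes> (g \<otimes> v) \<and> z = k \<otimes> (g \<otimes> w)"
    if "(x, y, z) \<in> ?T" for x y z
    using that unfolding triangle_translates_def T0_def by fastforce
  have E_base: "(u, v) \<in> edge_translates G (?C s g) (E s g)" if "g \<in> \<Gamma> s" "(u, v) \<in> E s g" for u v s g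
  proof -
    have "\<one> \<in> ?C s g" using subgroup.one_closed[OF subgroup_conj_part(1)[OF K subgroup_A \<Gamma>_carrier[OF that(1)]]] .
    from edge_translatesI[OF this that(2), of G] show ?thesis using E_A[OF that] A_closed by simp
  qed
  have sym_E: "sym ?E"
  proof (rule symI)
    fix x y assume "(x, y) \<in> ?E"
    then obtain k s g u v where kg: "k \<in> K" "g \<in> \<Gamma> s" "(u, v) \<in> E s g" "x = k \<otimes> (g \<otimes> u)" "y = k \<otimes> (g \<otimes> v)"
      using E_D by blast
    then show "(y, x) \<in> ?E" using E_I[OF kg(1,2) symD[OF sym[OF kg(2)] E_base[OF kg(2,3)]]] by simp
  qed
  have E_carrier: "?E \<subseteq> carrier G \<times> carrier G"
  proof
    fix xy assume "xy \<in> ?E"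
    then obtain k s g u v where "k \<in> K" "g \<in> \<Gamma> s" "(u, v) \<in> E s g" "xy = (k \<otimes> (g \<otimes> u), k \<otimes> (g \<otimes> v))"
      using E_D by (cases xy) blast
    then show "xy \<in> carrier G \<times> carrier G" using E_A[of g s u v] \<Gamma>_carrier[of g s] A_closed[of _ s] K.subset by auto
  qed
  have clique: "(x, x \<otimes> b) \<in> ?E\<^sup>*" if x: "x \<in> carrier G" and b: "b \<in> A s" for x b s
  proof -
    obtain k g a where kga: "k \<in> K" "g \<in> \<Gamma> s" "a \<in> A s" "x = k \<otimes> g \<otimes> a"
      using \<Gamma>[of s] x unfolding double_coset_reps_def by blast
    have "(a, a \<otimes> b) \<in> (edge_translates G (?C s g) (E s g))\<^sup>*"
      using simply_connectedD[OF sc[OF kga(2)]] kga b A_mult by blast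
    then have "(k \<otimes> (g \<otimes> a), k \<otimes> (g \<otimes> (a \<otimes> b))) \<in> ?E\<^sup>*"
    proof (induction rule: rtrancl_induct)
      case (step y z)
      show ?case using step(3) E_I[OF kga(1,2) step(2)] by (rule rtrancl_into_rtrancl)
    qed simp
    moreover have "k \<otimes> (g \<otimes> a) = x" "k \<otimes> (g \<otimes> (a \<otimes> b)) = x \<otimes> b"
      using kga b A_closed \<Gamma>_carrier[OF kga(2)] K.subset by (auto simp: m_assoc)
    ultimately show ?thesis by simp
  qed
  have conn: "(\<one>, u) \<in> ?E\<^sup>*" if "u \<in> carrier G" for u
    using _ _ that
  proof (rule generated)
    show "(\<one>, u \<otimes> x) \<in> ?E\<^sup>*" if "u \<in> carrier G" "x \<in> A t" "(\<one>, u) \<in> ?E\<^sup>*" for u x t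
      using clique[OF that(1,2)] that(3) by (rule rtrancl_trans[rotated])
  qed simp
  have sc_G: "simply_connected (carrier G) ?E ?T"
    unfolding simply_connected_def
  proof (intro conjI ballI allI impI)
    show "(x, y) \<in> ?E\<^sup>*" if "x \<in> carrier G" "y \<in> carrier G" for x y
      using symD[OF sym_rtrancl[OF sym_E] conn[OF that(1)]] conn[OF that(2)] by (rule rtrancl_trans)
  next
    fix Q :: "nat letter list set monoid" and h assume Q: "group Q" and h: "cocycle Q ?E ?T h"
    interpret Q: group Q by fact
    \<comment> \<open>A potential on the coset \<open>k g A s\<close>, transported to
      \<open>A s\<close>.\<close>
    define good where "good s k g p \<longleftrightarrow> p \<in> A s \<rightarrow> carrier Q \<and>
        (\<forall>(u, v)\<in>edge_translates G (?C s g) (E s g). p v = p u \<otimes>\<^bsub>Q\<^esub> h (k \<otimes> (g \<otimes> u)) (k \<otimes> (g \<otimes> v)))" for s k g p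
    have ex_good: "\<exists>p. good s k g p"
      if k: "k \<in> K" and g: "g \<in> \<Gamma> s" for s k g
    proof -
      let ?h = "\<lambda>u v. h (k \<otimes> (g \<otimes> u)) (k \<otimes> (g \<otimes> v))"
      have "cocycle Q (edge_translates G (?C s g) (E s g)) (triangle_translates G (?C s g) (T s g)) ?h"
        unfolding cocycle_def
      proof (intro conjI ballI; clarify)
        fix u v assume "(u, v) \<in> edge_translates G (?C s g) (E s g)"
        from E_I[OF k g this] show "?h u v \<in> carrier Q \<and> ?h u v \<otimes>\<^bsub>Q\<^esub> ?h v u = \<one>\<^bsub>Q\<^esub> \<and> (u = v \<longrightarrow> ?h u v = \<one>\<^bsub>Q\<^esub>)"
          using cocycle_edge[OF h] by simp
      next
        fix u v w assume "(u, v, w) \<in> triangle_translates G (?C s g) (T s g)"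
        from T_I[OF k g this] show "?h u v \<otimes>\<^bsub>Q\<^esub> ?h v w = ?h u w"
          by (rule cocycle_triangle[OF h])
      qed
      then obtain p where "p \<in> A s \<rightarrow> carrier Q"
        "\<And>u v. (u, v) \<in> edge_translates G (?C s g) (E s g) \<Longrightarrow> p v = p u \<otimes>\<^bsub>Q\<^esub> ?h u v"
        by (rule simply_connected_potential[OF sc[OF g] Q]) (rule that; assumption)
      then show ?thesis unfolding good_def by (intro exI[of _ p]) blast
    qed
    define p' where "p' s k g = (SOME p. good s k g p)" for s k g
    have good: "good s k g (p' s k g)" if "k \<in> K" "g \<in> \<Gamma> s" for s k g
      unfolding p'_def using ex_good[OF that] by (rule someI_ex)
    have p'_closed: "p' s k g a \<in> carrier Q" if "k \<in> K" "g \<in> \<Gamma> s" "a \<in> A s" for s k g a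
      using good[OF that(1,2)] that(3) unfolding good_def by auto
    have p'_edge: "p' s k g v = p' s k g u \<otimes>\<^bsub>Q\<^esub> h (k \<otimes> (g \<otimes> u)) (k \<otimes> (g \<otimes> v))"
      if "k \<in> K" "g \<in> \<Gamma> s" "(u, v) \<in> edge_translates G (?C s g) (E s g)" for s k g u v
      using good[OF that(1,2)] that(3) unfolding good_def by blast
    define frames where "frames s x = {(k, g). k \<in> K \<and> g \<in> \<Gamma> s \<and> inv (k \<otimes> g) \<otimes> x \<in> A s}" for s x
    \<comment> \<open>A coset has many descriptions \<open>k g A s\<close>, whose potentials may
      disagree. The set \<open>frames s x\<close> depends only on the coset of \<open>x\<close>, so
      this choice fixes one description for all of its points.\<close>
    define frame where "frame s x = (SOME kg. kg \<in> frames s x)" for s x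
    define f where "f s x = (case frame s x of (k, g) \<Rightarrow> p' s k g (inv (k \<otimes> g) \<otimes> x))" for s x
    have frame_ex: "\<exists>k g. frame s x = (k, g) \<and> k \<in> K \<and> g \<in> \<Gamma> s \<and> inv (k \<otimes> g) \<otimes> x \<in> A s" if x: "x \<in> carrier G" for s x
    proof -
      obtain k g a where kga: "k \<in> K" "g \<in> \<Gamma> s" "a \<in> A s" "x = k \<otimes> g \<otimes> a"
        using \<Gamma>[of s] x unfolding double_coset_reps_def by blast
      moreover have "k \<in> carrier G" "g \<in> carrier G" "a \<in> carrier G"
        using kga K.subset \<Gamma>_carrier A_closed by blast+
      ultimately have "inv (k \<otimes> g) \<otimes> x = a" using x by (simp add: inv_solve_left')
      then have "(k, g) \<in> frames s x" using kga by (simp add: frames_def)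
      then have "frame s x \<in> frames s x" unfolding frame_def by (rule someI)
      then show ?thesis unfolding frames_def by auto
    qed
    have frame_cong: "frame s (x \<otimes> a) = frame s x" if x: "x \<in> carrier G" "a \<in> A s" for s x a
    proof -
      have "inv (k \<otimes> g) \<otimes> (x \<otimes> a) \<in> A s \<longleftrightarrow> inv (k \<otimes> g) \<otimes> x \<in> A s" if "k \<in> K" "g \<in> \<Gamma> s" for k g
      proof -
        have kgx: "inv (k \<otimes> g) \<otimes> x \<in> carrier G" "a \<in> carrier G" "k \<otimes> g \<in> carrier G"
          using x that \<Gamma>_carrier[OF that(2)] K.subset A_closed by auto
        then have "inv (k \<otimes> g) \<otimes> (x \<otimes> a) = inv (k \<otimes> g) \<otimes> x \<otimes> a" using x by (simp add: m_assoc)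
        moreover have "inv (k \<otimes> g) \<otimes> x = inv (k \<otimes> g) \<otimes> x \<otimes> a \<otimes> inv a" using kgx x(1) by (simp add: m_assoc)
        ultimately show ?thesis using A_mult[OF _ x(2)] A_mult[OF _ A_inv[OF x(2)]] by metis
      qed
      then have "frames s (x \<otimes> a) = frames s x" unfolding frames_def by blast
      then show ?thesis unfolding frame_def by simp
    qed
    have f_closed: "f s x \<in> carrier Q" if "x \<in> carrier G" for s x
      using frame_ex[OF that, of s] p'_closed[of _ _ s] by (auto simp: f_def)
    obtain pot where pot: "pot \<in> carrier G \<rightarrow> carrier Q"
      "\<And>s u a. u \<in> carrier G \<Longrightarrow> a \<in> A s \<Longrightarrow>
        pot (u \<otimes> a) = pot u \<otimes>\<^bsub>Q\<^esub> (inv\<^bsub>Q\<^esub> f s u \<otimes>\<^bsub>Q\<^esub> f s (u \<otimes> a))"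
      using glue[OF Q, of f] f_closed by blast
    have "pot y = pot x \<otimes>\<^bsub>Q\<^esub> h x y" if xy: "(x, y) \<in> ?E" for x y
    proof -
      obtain k' s g' u v where kg': "k' \<in> K" "g' \<in> \<Gamma> s" "(u, v) \<in> E s g'" "x = k' \<otimes> (g' \<otimes> u)" "y = k' \<otimes> (g' \<otimes> v)"
        using E_D[OF xy] by blast
      have uv: "u \<in> A s" "v \<in> A s" using E_A[OF kg'(2,3)] by auto
      have xG: "x \<in> carrier G" "y \<in> carrier G" using xy E_carrier by auto
      obtain k g where kg: "frame s x = (k, g)" "k \<in> K" "g \<in> \<Gamma> s" "inv (k \<otimes> g) \<otimes> x \<in> A s"
        using frame_ex[OF xG(1)] by blast
      have G [simp]: "k \<in> carrier G" "g \<in> carrier G" "k' \<in> carrier G" "g' \<in> carrier G" "u \<in> carrier G" "v \<in> carrier G"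
        using kg kg' uv A_closed \<Gamma>_carrier K.subset by blast+
      define a where "a = inv (k \<otimes> g) \<otimes> x"
      have a: "a \<in> A s" "a \<in> carrier G" using kg(4) A_closed by (auto simp: a_def)
      have x_a: "x = k \<otimes> g \<otimes> a" using xG by (simp add: a_def m_assoc[symmetric])
      \<comment> \<open>The edge comes with a frame \<open>(k', g')\<close> that may differ from the
        chosen one. Both describe the same coset, so the representatives agree and the frames differ
        by an element of \<open>?C s g\<close>.\<close>
      have "g' = (inv k' \<otimes> k) \<otimes> g \<otimes> (a \<otimes> inv u)"
      proof -
        have "(inv k' \<otimes> k) \<otimes> g \<otimes> (a \<otimes> inv u) = inv k' \<otimes> x \<otimes> inv u" using a by (simp add: x_a m_assoc)
        also have "\<dots> = g'" unfolding kg'(4) by (simp add: m_assoc) (simp add: m_assoc[symmetric])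
        finally show ?thesis ..
      qed
      moreover have "inv k' \<otimes> k \<in> K" "a \<otimes> inv u \<in> A s" using kg kg' a uv A_mult A_inv by auto
      ultimately have g_eq: "g' = g" using \<Gamma>[of s] kg(3) kg'(2) unfolding double_coset_reps_def by blast
      define c where "c = a \<otimes> inv u"
      have cA: "c \<in> A s" "c \<in> carrier G" using a uv A_mult A_inv by (auto simp: c_def)
      have "g \<otimes> c \<otimes> inv g = inv k \<otimes> k'"
      proof -
        have "k \<otimes> (g \<otimes> c \<otimes> inv g) = x \<otimes> inv u \<otimes> inv g" using a by (simp add: c_def x_a m_assoc)
        also have "\<dots> = k'" unfolding kg'(4) g_eq by (simp add: m_assoc)
        finally show ?thesis using cA by (simp add: inv_solve_left)
      qed
      then have cC: "c \<in> ?C s g" using cA kg kg' by (simp add: conj_part_def)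
      have a_c: "a = c \<otimes> u" using a by (simp add: c_def m_assoc)
      have y_b: "y = k \<otimes> g \<otimes> (c \<otimes> v)"
      proof -
        have "y = x \<otimes> (inv u \<otimes> v)" unfolding kg' by (simp add: m_assoc) (simp add: m_assoc[symmetric])
        then show ?thesis using a by (simp add: x_a c_def m_assoc)
      qed
      have y_x: "y = x \<otimes> (inv u \<otimes> v)" unfolding kg' by (simp add: m_assoc) (simp add: m_assoc[symmetric])
      have d: "inv u \<otimes> v \<in> A s" using uv A_mult A_inv by auto
      have edge: "(a, c \<otimes> v) \<in> edge_translates G (?C s g) (E s g)"
        unfolding a_c using edge_translatesI[OF cC] kg'(3) g_eq by auto
      have "inv (k \<otimes> g) \<otimes> y = c \<otimes> v" unfolding y_b using cA by (simp add: inv_solve_left')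
      then have fy: "f s y = p' s k g (c \<otimes> v)" using frame_cong[OF xG(1) d] kg(1) y_x by (simp add: f_def)
      have fx: "f s x = p' s k g a" using kg(1) by (simp add: f_def a_def)
      have "p' s k g (c \<otimes> v) = p' s k g a \<otimes>\<^bsub>Q\<^esub> h (k \<otimes> (g \<otimes> a)) (k \<otimes> (g \<otimes> (c \<otimes> v)))"
        by (rule p'_edge[OF kg(2,3) edge])
      also have "k \<otimes> (g \<otimes> a) = x" using a by (simp add: x_a m_assoc)
      also have "k \<otimes> (g \<otimes> (c \<otimes> v)) = y" using cA by (simp add: y_b m_assoc)
      finally have "f s y = f s x \<otimes>\<^bsub>Q\<^esub> h x y" by (simp add: fx fy)
      moreover have "pot y = pot x \<otimes>\<^bsub>Q\<^esub> (inv\<^bsub>Q\<^esub> f s x \<otimes>\<^bsub>Q\<^esub> f s y)" using pot(2)[OF xG(1) d] y_x by simp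
      moreover have "h x y \<in> carrier Q" using cocycle_edge[OF h xy] by blast
      ultimately show ?thesis using f_closed[OF xG(1), of s] by (simp add: Q.m_assoc[symmetric])
    qed
    then show "\<exists>p. potential Q (carrier G) ?E h p" unfolding potential_def using pot(1) by blast
  qed
  \<comment> \<open>With \<open>q\<close> the identity nothing is collapsed but the translates of a
    transversal tree, and every triangle is a translate of one in \<open>T0\<close>.\<close>
  interpret C: collapse "G\<lparr>carrier := K\<rparr>" "(\<otimes>)" "carrier G" ?E ?T "\<lambda>x. x"
  proof (intro collapse.intro collapse_axioms.intro)
    show "group (G\<lparr>carrier := K\<rparr>)" by (rule K.subgroup_is_group) (rule is_group)
    show "(k \<otimes> x, k \<otimes> y) \<in> ?E" if "k \<in> carrier (G\<lparr>carrier := K\<rparr>)" "(x, y) \<in> ?E" for k x y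
    proof -
      obtain l a b where l: "l \<in> K" "(a, b) \<in> E0" "x = l \<otimes> a" "y = l \<otimes> b"
        using \<open>(x, y) \<in> ?E\<close> unfolding edge_translates_def by blast
      have "a \<in> carrier G" "b \<in> carrier G"
        using l(2) E0_carrier by auto
      then show ?thesis using l that edge_translatesI[of "k \<otimes> l" K a b E0 G] K.subset by (auto simp: m_assoc)
    qed
    show "(x, y) \<in> ?E \<and> (y, z) \<in> ?E \<and> (x, z) \<in> ?E" if "(x, y, z) \<in> ?T" for x y z
    proof -
      obtain k s g u v w where k: "k \<in> K" "g \<in> \<Gamma> s" "(u, v, w) \<in> T s g"
        and xyz: "x = k \<otimes> (g \<otimes> u)" "y = k \<otimes> (g \<otimes> v)" "z = k \<otimes> (g \<otimes> w)"
        using T_D[OF \<open>(x, y, z) \<in> ?T\<close>] by blast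
      show ?thesis unfolding xyz using TE[OF k(2,3)] E_I[OF k(1,2)] by blast
    qed
    show "carrier G \<noteq> {}" using one_closed by blast
  qed (use sc_G sym_E E_carrier K.subset in \<open>auto simp: m_assoc\<close>)
  have fin_T0: "finite T0" unfolding T0_def using fin_\<Gamma> T by auto
  have "\<exists>n rs. is_presentation (G\<lparr>carrier := K\<rparr>) n rs \<and> (\<Sum>r\<leftarrow>rs. length r - 2) \<le> card T0"
  proof (rule C.presentation_exists)
    show "finite E0" unfolding E0_def using fin_\<Gamma> E by auto
    show "E0 \<subseteq> carrier G \<times> carrier G" by (rule E0_carrier)
    show "finite T0" by (rule fin_T0)
    show "T0 \<subseteq> ?T"
    proof
      fix t assume "t \<in> T0"
      then obtain s g u v w where g: "g \<in> \<Gamma> s" "(u, v, w) \<in> T s g" "t = (g \<otimes> u, g \<otimes> v, g \<otimes> w)"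
        unfolding T0_def by auto
      then show "t \<in> ?T"
        using triangle_translatesI[OF K.one_closed T0_I[OF g(1,2)], of G] T_A[OF g(1,2)] A_closed \<Gamma>_carrier[OF g(1)]
        by simp
    qed
    show "\<exists>k\<in>carrier (G\<lparr>carrier := K\<rparr>). \<exists>(a, b)\<in>E0. x = k \<otimes> a \<and> y = k \<otimes> b" if "(x, y) \<in> ?E" for x y
      using that unfolding edge_translates_def by fastforce
    show "\<exists>k\<in>carrier (G\<lparr>carrier := K\<rparr>). \<exists>(a, b, c)\<in>T0. x = k \<otimes> a \<and> y = k \<otimes> b \<and> z = k \<otimes> c"
      if "(x, y, z) \<in> ?T" for x y z
      using that unfolding triangle_translates_def by fastforce
  qed
  moreover have "card T0 \<le> (\<Sum>(s, g)\<in>Sigma UNIV \<Gamma>. presentation_length (G\<lparr>carrier := ?C s g\<rparr>))"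
  proof -
    have "card T0 \<le> (\<Sum>i\<in>Sigma UNIV \<Gamma>. card (case i of (s, g) \<Rightarrow> (\<lambda>(u, v, w). (g \<otimes> u, g \<otimes> v, g \<otimes> w)) ` T s g))"
      unfolding T0_def by (rule card_UN_le[OF fin_\<Gamma>])
    also have "\<dots> \<le> (\<Sum>(s, g)\<in>Sigma UNIV \<Gamma>. presentation_length (G\<lparr>carrier := ?C s g\<rparr>))"
      using T by (intro sum_mono) (auto intro: order_trans[OF card_image_le])
    finally show ?thesis .
  qed
  ultimately show ?thesis by (meson order_trans)
qed

end

section \<open>The free product as a splitting\<close>

text \<open>\<open>True\<close> stands for the left factor, in accordance with
  \<open>isl\<close>.\<close>

definition free_factor :: "('a, 'c) monoid_scheme \<Rightarrow> ('b, 'd) monoid_scheme \<Rightarrow> bool \<Rightarrow> ('a + 'b) list set"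
  where "free_factor G H s = {w \<in> carrier (free_product G H). w = [] \<or> (\<exists>x. w = [x] \<and> isl x = s)}"

text \<open>The projection to the star of the vertex given by the factor \<open>s\<close>: the path
  from there to \<open>w\<close> leaves through the first syllable of \<open>w\<close> if that
  belongs to \<open>s\<close>, and through the identity otherwise.\<close>

definition leading :: "bool \<Rightarrow> ('a + 'b) list \<Rightarrow> ('a + 'b) list"
  where "leading s w = (case w of [] \<Rightarrow> [] | x # _ \<Rightarrow> if isl x = s then [x] else [])"

definition embed_left :: "('a, 'c) monoid_scheme \<Rightarrow> 'a \<Rightarrow> ('a + 'b) list"
  where "embed_left G a = (if a = \<one>\<^bsub>G\<^esub> then [] else [Inl a])"

definition embed_right :: "('b, 'd) monoid_scheme \<Rightarrow> 'b \<Rightarrow> ('a + 'b) list"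
  where "embed_right H b = (if b = \<one>\<^bsub>H\<^esub> then [] else [Inr b])"

lemma leading_simps [simp]:
  "leading s [] = []" "leading s (x # w) = (if isl x = s then [x] else [])"
  by (auto simp: leading_def)

lemma leading_append: "u \<noteq> [] \<Longrightarrow> leading s (u @ v) = leading s u"
  by (cases u) auto

lemma successively_snoc_cong:
  "successively P (w @ [y]) \<Longrightarrow> (\<And>u. P u y = P u z) \<Longrightarrow> successively P (w @ [z])"
  by (auto simp: successively_append_iff)

context
  fixes G :: "('a, 'c) monoid_scheme" and H :: "('b, 'd) monoid_scheme"
  assumes G: "group G" and H: "group H"
begin

interpretation G: group G by (rule G)
interpretation H: group H by (rule H)

private abbreviation (input) "F \<equiv> free_product G H"

interpretation F: group F by (rule group_free_product[OF G H])

lemma free_product_simps: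
  "mult F u v = foldr (syllable_mult G H) u v" "\<one>\<^bsub>F\<^esub> = []"
  by (simp_all add: free_product_def)

lemma free_product_carrier: "w \<in> carrier F \<longleftrightarrow> set w \<subseteq> syllables G H \<and> alternating w"
  by (rule FP_iff[OF G H])

lemma syllable_mult_other:
  "x \<in> syllables G H \<Longrightarrow> w = [] \<or> isl (hd w) \<noteq> isl x \<Longrightarrow> syllable_mult G H x w = x # w"
  by (cases x) (auto simp: syllables_def sm_Inl[OF G H] sm_Inr[OF G H])

text \<open>Merging two syllables of one factor does not depend on the rest of the word: the same
  \<open>r\<close> serves for every \<open>w\<close>.\<close>

lemma syllable_mult_same:
  assumes "x \<in> syllables G H" "y \<in> syllables G H" "isl x = isl y"
  obtains r where "\<And>w. syllable_mult G H x (y # w) = r @ w"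
    "r = [] \<or> (\<exists>z\<in>syllables G H. r = [z] \<and> isl z = isl x)"
proof (cases x)
  case (Inl a)
  then obtain b where b: "y = Inl b" using assms by (cases y) auto
  show thesis
  proof (rule that)
    show "syllable_mult G H x (y # w) = (if a \<otimes>\<^bsub>G\<^esub> b = \<one>\<^bsub>G\<^esub> then [] else [Inl (a \<otimes>\<^bsub>G\<^esub> b)]) @ w" for w
      by (simp add: Inl b)
  qed (use assms Inl b in \<open>auto simp: syllables_def\<close>)
next
  case (Inr a)
  then obtain b where b: "y = Inr b" using assms by (cases y) auto
  show thesis
  proof (rule that)
    show "syllable_mult G H x (y # w) = (if a \<otimes>\<^bsub>H\<^esub> b = \<one>\<^bsub>H\<^esub> then [] else [Inr (a \<otimes>\<^bsub>H\<^esub> b)]) @ w" for w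
      by (simp add: Inr b)
  qed (use assms Inr b in \<open>auto simp: syllables_def\<close>)
qed

lemma free_product_append:
  assumes "w @ z \<in> carrier F"
  shows "mult F w z = w @ z"
proof -
  have "z \<in> carrier F" using assms by (auto simp: free_product_carrier alternating_def successively_append_iff)
  then show ?thesis
    using foldr_sm_Nil[OF G H assms] foldr_sm_Nil[OF G H, of z] by (simp add: free_product_simps)
qed

text \<open>Products are defined by multiplying syllables on the left, while steps between the
  cosets multiply on the right. There the normal form changes only at its end; \<open>r\<close> is
  what remains of two merged syllables and is empty if they cancel.\<close>

lemma free_product_mult_syllable:
  assumes u: "u \<in> carrier F" and x: "[x] \<in> carrier F"
  obtains (append) "u @ [x] \<in> carrier F" "mult F u [x] = u @ [x]" "u = [] \<or> isl (last u) \<noteq> isl x"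
    | (merge) w y r where "u = w @ [y]" "isl y = isl x" "w \<in> carrier F" "w @ r \<in> carrier F" "mult F u [x] = w @ r"
      "r = [] \<or> (\<exists>z. r = [z] \<and> isl z = isl x)"
proof (cases "u = [] \<or> isl (last u) \<noteq> isl x")
  case True
  then have "u @ [x] \<in> carrier F"
    using u x by (auto simp: free_product_carrier alternating_def successively_append_iff)
  then show thesis using append True free_product_append by blast
next
  case False
  define w y where "w = butlast u" and "y = last u"
  have wy: "u = w @ [y]" "isl y = isl x" using False by (auto simp: w_def y_def)
  have syl: "x \<in> syllables G H" "y \<in> syllables G H" using u x wy by (auto simp: free_product_carrier)
  obtain r where r: "\<And>w. syllable_mult G H y (x # w) = r @ w"
    "r = [] \<or> (\<exists>z\<in>syllables G H. r = [z] \<and> isl z = isl y)"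
    using syllable_mult_same[OF syl(2,1) wy(2)] by metis
  have w: "w \<in> carrier F" using u wy by (auto simp: free_product_carrier alternating_def successively_append_iff)
  have wr: "w @ r \<in> carrier F"
    using r(2) u w wy(1) by (auto simp: free_product_carrier alternating_def intro: successively_snoc_cong)
  have "mult F u [x] = mult F w r" using r(1)[of "[]"] wy by (simp add: free_product_simps)
  then show thesis using merge[OF wy w wr] free_product_append[OF wr] r(2) wy(2) by auto
qed

lemma free_product_snoc_induct [consumes 1, case_names Nil snoc]:
  assumes "u \<in> carrier F" "P []"
    "\<And>w x. w \<in> carrier F \<Longrightarrow> [x] \<in> carrier F \<Longrightarrow> mult F w [x] = w @ [x] \<Longrightarrow> P w \<Longrightarrow> P (w @ [x])"
  shows "P u"
  using assms(1)
proof (induction u rule: rev_induct)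
  case (snoc x w)
  then have "w \<in> carrier F" "[x] \<in> carrier F" by (auto simp: free_product_carrier alternating_def successively_append_iff)
  then show ?case using snoc assms(3) free_product_append by blast
qed (rule assms(2))

section \<open>The two factors as subgroups\<close>

lemma embed_left_hom: "embed_left G \<in> hom G F"
  by (rule homI) (auto simp: embed_left_def free_product_carrier free_product_simps syllables_def alternating_def)

lemma embed_right_hom: "embed_right H \<in> hom H F"
  by (rule homI) (auto simp: embed_right_def free_product_carrier free_product_simps syllables_def alternating_def)

lemma embed_left_inj: "inj_on (embed_left G) (carrier G)"
  by (auto simp: inj_on_def embed_left_def split: if_splits)

lemma embed_right_inj: "inj_on (embed_right H) (carrier H)"
  by (auto simp: inj_on_def embed_right_def split: if_splits)

lemma embed_left_image: "embed_left G ` carrier G = free_factor G H True"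
proof
  show "embed_left G ` carrier G \<subseteq> free_factor G H True"
  proof
    fix w :: "('a + 'b) list" assume "w \<in> embed_left G ` carrier G"
    then obtain a where a: "a \<in> carrier G" "w = embed_left G a" by auto
    then show "w \<in> free_factor G H True"
      using hom_in_carrier[OF embed_left_hom a(1)] by (simp add: free_factor_def embed_left_def split: if_splits)
  qed
  show "free_factor G H True \<subseteq> embed_left G ` carrier G"
  proof
    fix w assume w: "w \<in> free_factor G H True"
    show "w \<in> embed_left G ` carrier G"
    proof (cases "w = []")
      case True
      then show ?thesis by (intro image_eqI[of _ _ "\<one>\<^bsub>G\<^esub>"]) (auto simp: embed_left_def)
    next
      case False
      then obtain a where "w = [Inl a]" using w by (auto simp: free_factor_def isl_def)
      then show ?thesis using w
        by (intro image_eqI[of _ _ a]) (auto simp: embed_left_def free_factor_def free_product_carrier syllables_def)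
    qed
  qed
qed

lemma embed_right_image: "embed_right H ` carrier H = free_factor G H False"
proof
  show "embed_right H ` carrier H \<subseteq> free_factor G H False"
  proof
    fix w :: "('a + 'b) list" assume "w \<in> embed_right H ` carrier H"
    then obtain a where a: "a \<in> carrier H" "w = embed_right H a" by auto
    then show "w \<in> free_factor G H False"
      using hom_in_carrier[OF embed_right_hom a(1)] by (simp add: free_factor_def embed_right_def split: if_splits)
  qed
  show "free_factor G H False \<subseteq> embed_right H ` carrier H"
  proof
    fix w assume w: "w \<in> free_factor G H False"
    show "w \<in> embed_right H ` carrier H"
    proof (cases "w = []")
      case True
      then show ?thesis by (intro image_eqI[of _ _ "\<one>\<^bsub>H\<^esub>"]) (auto simp: embed_right_def)
    next
      case False
      then obtain x where x: "w = [x]" "\<not> isl x" using w by (auto simp: free_factor_def)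
      then obtain a where "w = [Inr a]" by (cases x) auto
      then show ?thesis using w
        by (intro image_eqI[of _ _ a]) (auto simp: embed_right_def free_factor_def free_product_carrier syllables_def)
    qed
  qed
qed

lemma subgroup_free_factor: "subgroup (free_factor G H s) F"
proof (cases s)
  case True
  interpret group_hom G F "embed_left G" by unfold_locales (rule embed_left_hom)
  show ?thesis using img_is_subgroup True by (simp add: embed_left_image)
next
  case False
  interpret group_hom H F "embed_right H" by unfold_locales (rule embed_right_hom)
  show ?thesis using img_is_subgroup False by (simp add: embed_right_image)
qed

section \<open>Projection to the leading syllable and gluing of potentials\<close>

lemma leading_mult:
  assumes a: "a \<in> free_factor G H s" and u: "u \<in> carrier F"
  shows "leading s (mult F a u) = mult F a (leading s u)"
proof (cases "a = []")
  case False
  then obtain x where x: "a = [x]" "isl x = s" "x \<in> syllables G H" using a by (auto simp: free_factor_def free_product_carrier)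
  show ?thesis
  proof (cases "u = [] \<or> isl (hd u) \<noteq> isl x")
    case True
    then have "leading s u = []" using x by (cases u) auto
    then show ?thesis using True x syllable_mult_other[of x u] syllable_mult_other[of x "[]"]
      by (simp add: free_product_simps)
  next
    case False
    then obtain y v where y: "u = y # v" "isl y = isl x" by (cases u) auto
    then have yv: "y \<in> syllables G H" "v = [] \<or> isl (hd v) \<noteq> isl y"
      using u by (auto simp: free_product_carrier alternating_Cons)
    obtain r where r: "\<And>w. syllable_mult G H x (y # w) = r @ w"
      "r = [] \<or> (\<exists>z\<in>syllables G H. r = [z] \<and> isl z = isl x)"
      using syllable_mult_same[OF x(3) yv(1)] y(2) by metis
    have "leading s v = []" using yv y x by (cases v) auto
    then show ?thesis using r x y by (auto simp: free_product_simps)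
  qed
qed (simp add: free_product_simps)

text \<open>Right multiplication by a factor element affects only the last syllable, so the first
  one can change only in a word of at most one syllable.\<close>

lemma leading_change:
  assumes x: "x \<in> free_factor G H t" and v: "v \<in> carrier F" and ne: "leading s (mult F v x) \<noteq> leading s v"
  shows "s = t \<and> v \<in> free_factor G H s"
proof -
  have "x \<noteq> []" using ne v F.r_one[of v] by (auto simp: free_product_simps)
  then obtain x' where x': "x = [x']" "isl x' = t" "[x'] \<in> carrier F" using x by (auto simp: free_factor_def)
  from v x'(3) show ?thesis
  proof (cases rule: free_product_mult_syllable)
    case append
    then have "v = []" using ne x' leading_append by metis
    then show ?thesis using append ne x' v by (auto simp: free_factor_def split: if_splits)
  next
    case (merge w y r)
    then have "w = []" using ne x' leading_append by metis
    then show ?thesis using merge ne x' v by (auto simp: free_factor_def split: if_splits)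
  qed
qed

text \<open>A normal form is the reduced path from the identity through the cosets of the factors,
  and the potential multiplies the increments of the functions \<open>f s\<close> along it. A step
  that merges with the last syllable stays in the coset of that syllable, where increments
  telescope.\<close>

lemma free_product_glue:
  assumes Q: "group Q" and f: "\<And>s u. u \<in> carrier F \<Longrightarrow> f s u \<in> carrier Q"
  shows "\<exists>pot \<in> carrier F \<rightarrow> carrier Q. \<forall>s. \<forall>u\<in>carrier F. \<forall>a\<in>free_factor G H s.
    pot (mult F u a) = pot u \<otimes>\<^bsub>Q\<^esub> (inv\<^bsub>Q\<^esub> f s u \<otimes>\<^bsub>Q\<^esub> f s (mult F u a))"
proof -
  interpret Q: group Q by fact
  \<comment> \<open>Recursion on the reversed word strips the last syllable; \<open>rev r\<close> is
    the word that precedes it.\<close>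
  define pot where "pot u = rec_list \<one>\<^bsub>Q\<^esub> (\<lambda>x r q. q \<otimes>\<^bsub>Q\<^esub> (inv\<^bsub>Q\<^esub> f (isl x) (rev r) \<otimes>\<^bsub>Q\<^esub> f (isl x) (rev r @ [x]))) (rev u)" for u
  have pot_Nil: "pot [] = \<one>\<^bsub>Q\<^esub>"
    and pot_snoc: "pot (u @ [x]) = pot u \<otimes>\<^bsub>Q\<^esub> (inv\<^bsub>Q\<^esub> f (isl x) u \<otimes>\<^bsub>Q\<^esub> f (isl x) (u @ [x]))" for u x
    by (simp_all add: pot_def)
  have pot_closed: "pot u \<in> carrier Q" if "u \<in> carrier F" for u
    using that
  proof (induction rule: free_product_snoc_induct)
    case (snoc w x)
    then have "w @ [x] \<in> carrier F" using F.m_closed by metis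
    then show ?case using snoc f by (simp add: pot_snoc)
  qed (simp add: pot_Nil)
  have "pot (mult F u a) = pot u \<otimes>\<^bsub>Q\<^esub> (inv\<^bsub>Q\<^esub> f s u \<otimes>\<^bsub>Q\<^esub> f s (mult F u a))"
    if u: "u \<in> carrier F" and a: "a \<in> free_factor G H s" for s u a
  proof (cases "a = []")
    case True
    then have "mult F u a = u" using F.r_one[OF u] by (simp add: free_product_simps)
    then show ?thesis using f[OF u] pot_closed[OF u] by simp
  next
    case False
    then obtain x where x: "a = [x]" "isl x = s" "[x] \<in> carrier F" using a by (auto simp: free_factor_def)
    from u x(3) show ?thesis
    proof (cases rule: free_product_mult_syllable)
      case append
      then show ?thesis using x by (simp add: pot_snoc)
    next
      case (merge w y r)
      have "pot (w @ r) = pot w \<otimes>\<^bsub>Q\<^esub> (inv\<^bsub>Q\<^esub> f s w \<otimes>\<^bsub>Q\<^esub> f s (w @ r))"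
        using merge(3,4,6) x f pot_closed by (auto simp: pot_snoc)
      moreover have "pot u = pot w \<otimes>\<^bsub>Q\<^esub> (inv\<^bsub>Q\<^esub> f s w \<otimes>\<^bsub>Q\<^esub> f s u)"
        using merge(1,2) x by (simp add: pot_snoc)
      \<comment> \<open>\<open>w\<close>, \<open>u\<close> and the product lie in one coset, so the
        increment from \<open>w\<close> to \<open>u\<close> followed by that from \<open>u\<close>
        to the product is the increment from \<open>w\<close> to the product.\<close>
      moreover have "f s u \<otimes>\<^bsub>Q\<^esub> (inv\<^bsub>Q\<^esub> f s u \<otimes>\<^bsub>Q\<^esub> f s (w @ r)) = f s (w @ r)"
        using f[OF u] f[OF merge(4)] by (simp add: Q.m_assoc[symmetric])
      ultimately show ?thesis
        using f[OF u] f[OF merge(3)] f[OF merge(4)] pot_closed[OF merge(3)] merge(5) x(1) by (simp add: Q.m_assoc)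
    qed
  qed
  then show ?thesis using pot_closed by blast
qed

lemma free_splitting_free_product: "free_splitting F (free_factor G H) leading"
proof (intro free_splitting.intro free_splitting_axioms.intro)
  show "subgroup (free_factor G H s) F" for s by (rule subgroup_free_factor)
  show "leading s u \<in> free_factor G H s" if "u \<in> carrier F" for s u
    using that by (cases u) (auto simp: free_factor_def free_product_carrier alternating_Cons)
  show "leading s \<one>\<^bsub>F\<^esub> = \<one>\<^bsub>F\<^esub>" for s by (simp add: free_product_simps)
  fix P u assume P: "P \<one>\<^bsub>F\<^esub>"
    "\<And>u x t. u \<in> carrier F \<Longrightarrow> x \<in> free_factor G H t \<Longrightarrow> P u \<Longrightarrow> P (mult F u x)" "u \<in> carrier F"
  from P(3) show "P u"
  proof (induction rule: free_product_snoc_induct)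
    case Nil
    then show ?case using P(1) by (simp add: free_product_simps)
  next
    case (snoc w x)
    then show ?case using P(2)[of w "[x]" "isl x"] by (simp add: free_factor_def)
  qed
qed (fact F.is_group leading_mult leading_change free_product_glue)+


section \<open>Finite index subgroups with prescribed intersections\<close>

fun factor_act :: "'a + 'b \<Rightarrow> 'a set \<times> 'b set \<Rightarrow> 'a set \<times> 'b set"
  where
    "factor_act (Inl a) (X, Y) = (a <#\<^bsub>G\<^esub> X, Y)"
  | "factor_act (Inr b) (X, Y) = (X, b <#\<^bsub>H\<^esub> Y)"

text \<open>Each factor acts on its own coordinate of a product of two coset spaces, and normal
  forms act by composition. Conjugating the stabiliser of the base point moves the point. An element
  of \<open>G\<close> fixes the new point if it fixes its first coordinate \<open>c A'\<close>, that
  is, if it lies in the conjugate of \<open>A'\<close> by \<open>c\<close>; likewise for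
  \<open>H\<close>.\<close>

lemma conj_stabiliser_exists:
  assumes A': "subgroup A' G" "finite (rcosets\<^bsub>G\<^esub> A')" and B': "subgroup B' H" "finite (rcosets\<^bsub>H\<^esub> B')"
  obtains K where "subgroup K F" "finite (rcosets\<^bsub>F\<^esub> K)"
    "\<And>g. g \<in> carrier F \<Longrightarrow> \<exists>c\<in>carrier G. \<forall>a\<in>carrier G.
      g \<otimes>\<^bsub>F\<^esub> embed_left G a \<otimes>\<^bsub>F\<^esub> inv\<^bsub>F\<^esub> g \<in> K \<longleftrightarrow> inv\<^bsub>G\<^esub> c \<otimes>\<^bsub>G\<^esub> a \<otimes>\<^bsub>G\<^esub> c \<in> A'"
    "\<And>g. g \<in> carrier F \<Longrightarrow> \<exists>c\<in>carrier H. \<forall>b\<in>carrier H.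
      g \<otimes>\<^bsub>F\<^esub> embed_right H b \<otimes>\<^bsub>F\<^esub> inv\<^bsub>F\<^esub> g \<in> K \<longleftrightarrow> inv\<^bsub>H\<^esub> c \<otimes>\<^bsub>H\<^esub> b \<otimes>\<^bsub>H\<^esub> c \<in> B'"
proof -
  define LA where "LA = (\<lambda>a. a <#\<^bsub>G\<^esub> A') ` carrier G"
  define LB where "LB = (\<lambda>b. b <#\<^bsub>H\<^esub> B') ` carrier H"
  let ?Y = "LA \<times> LB"
  let ?act = "foldr factor_act"
  let ?U = "carrier G <+> carrier H"
  define pt where "pt = (A', B')"
  have A'G: "A' \<subseteq> carrier G" and B'H: "B' \<subseteq> carrier H" using A' B' subgroup.subset by auto
  have fin: "finite LA" "finite LB"
    unfolding LA_def LB_def using G.finite_l_cosets[OF A'] H.finite_l_cosets[OF B'] by auto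
  have pt: "pt \<in> ?Y"
    unfolding pt_def LA_def LB_def
    using G.lcos_mult_one[OF A'G] H.lcos_mult_one[OF B'H] by (auto intro!: image_eqI[of _ _ "\<one>\<^bsub>G\<^esub>"] image_eqI[of _ _ "\<one>\<^bsub>H\<^esub>"])
  have LA_carrier: "X \<subseteq> carrier G" if "X \<in> LA" for X
    using that G.l_coset_subset_G[OF A'G] by (auto simp: LA_def)
  have LB_carrier: "X \<subseteq> carrier H" if "X \<in> LB" for X
    using that H.l_coset_subset_G[OF B'H] by (auto simp: LB_def)
  have act1: "factor_act x y \<in> ?Y" if "x \<in> ?U" "y \<in> ?Y" for x y
    using that by (cases x; cases y) (auto simp: LA_def LB_def G.lcos_m_assoc[OF A'G] H.lcos_m_assoc[OF B'H])
  have act: "?act u y \<in> ?Y" if "set u \<subseteq> ?U" "y \<in> ?Y" for u y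
    using that by (induction u) (auto simp del: mem_Sigma_iff intro!: act1)
  have act_Inl: "factor_act (Inl a) (factor_act (Inl b) y) = factor_act (Inl (a \<otimes>\<^bsub>G\<^esub> b)) y" "factor_act (Inl \<one>\<^bsub>G\<^esub>) y = y"
    if "a \<in> carrier G" "b \<in> carrier G" "y \<in> ?Y" for a b y
    using that LA_carrier by (cases y; simp add: G.lcos_m_assoc G.lcos_mult_one)+
  have act_Inr: "factor_act (Inr a) (factor_act (Inr b) y) = factor_act (Inr (a \<otimes>\<^bsub>H\<^esub> b)) y" "factor_act (Inr \<one>\<^bsub>H\<^esub>) y = y"
    if "a \<in> carrier H" "b \<in> carrier H" "y \<in> ?Y" for a b y
    using that LB_carrier by (cases y; simp add: H.lcos_m_assoc H.lcos_mult_one)+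
  \<comment> \<open>A merged syllable acts like its two components one after the other, which makes
    the action compatible with the multiplication of normal forms.\<close>
  have act_syllable: "?act (syllable_mult G H x u) y = factor_act x (?act u y)"
    if x: "x \<in> ?U" and u: "u \<in> carrier F" and y: "y \<in> ?Y" for x u y
  proof -
    have uy: "?act u y \<in> ?Y" using act[OF FP_factors[OF G H u] y] .
    show ?thesis
    proof (cases x)
      case (Inl a)
      then have a: "a \<in> carrier G" using x by auto
      show ?thesis
      proof (cases "u = [] \<or> \<not> isl (hd u)")
        case True
        then show ?thesis using act_Inl(2)[OF a a uy] Inl by (simp add: sm_Inl[OF G H])
      next
        case False
        then obtain b v where b: "u = Inl b # v" by (cases u; cases "hd u") auto
        then have bv: "b \<in> carrier G" "?act v y \<in> ?Y"
          using act[of v y] FP_factors[OF G H u] y by auto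
        then show ?thesis using act_Inl[OF a bv(1) bv(2)] Inl b by auto
      qed
    next
      case (Inr a)
      then have a: "a \<in> carrier H" using x by auto
      show ?thesis
      proof (cases "u = [] \<or> isl (hd u)")
        case True
        then show ?thesis using act_Inr(2)[OF a a uy] Inr by (simp add: sm_Inr[OF G H])
      next
        case False
        then obtain b v where b: "u = Inr b # v" by (cases u; cases "hd u") auto
        then have bv: "b \<in> carrier H" "?act v y \<in> ?Y"
          using act[of v y] FP_factors[OF G H u] y by auto
        then show ?thesis using act_Inr[OF a bv(1) bv(2)] Inr b by auto
      qed
    qed
  qed
  have act_foldr: "?act (foldr (syllable_mult G H) u v) y = ?act u (?act v y)"
    if "set u \<subseteq> ?U" "v \<in> carrier F" "y \<in> ?Y" for u v y
    using that(1)
  proof (induction u)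
    case (Cons x u)
    then have "foldr (syllable_mult G H) u v \<in> carrier F" using foldr_sm_closed[OF G H _ that(2)] by simp
    then show ?case using act_syllable[of x _ y] Cons that(3) by simp
  qed simp
  have act_mult: "?act (u \<otimes>\<^bsub>F\<^esub> v) y = ?act u (?act v y)" if "u \<in> carrier F" "v \<in> carrier F" "y \<in> ?Y" for u v y
    using act_foldr[OF FP_factors[OF G H that(1)] that(2,3)] by (simp add: free_product_simps)
  have act_Y: "?act u y \<in> ?Y" if "u \<in> carrier F" "y \<in> ?Y" for u y
    using act[OF FP_factors[OF G H that(1)] that(2)] .
  have act_inv: "?act (inv\<^bsub>F\<^esub> u) (?act u y) = y" "?act u (?act (inv\<^bsub>F\<^esub> u) y) = y" if "u \<in> carrier F" "y \<in> ?Y" for u y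
    using act_mult[of "inv\<^bsub>F\<^esub> u" u y] act_mult[of u "inv\<^bsub>F\<^esub> u" y] that
    by (simp_all add: free_product_simps(2) del: mem_Sigma_iff)
  define K where "K = {g \<in> carrier F. ?act g pt = pt}"
  have K: "subgroup K F"
  proof (rule F.subgroupI)
    show "K \<noteq> {}" using F.one_closed by (auto simp: K_def free_product_simps)
    show "inv\<^bsub>F\<^esub> g \<in> K" if "g \<in> K" for g
      using that act_inv(1)[of g pt] pt by (auto simp: K_def simp del: mem_Sigma_iff)
    show "g \<otimes>\<^bsub>F\<^esub> h \<in> K" if "g \<in> K" "h \<in> K" for g h
      using that act_mult[of g h pt] pt F.m_closed[of g h] by (simp add: K_def del: mem_Sigma_iff)
  qed (auto simp: K_def)
  \<comment> \<open>Cosets of \<open>K\<close> correspond to points of the orbit of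
    \<open>pt\<close>, which lies in a finite set. The inverses appear because these are right
    cosets.\<close>
  have coset_eq: "?act (inv\<^bsub>F\<^esub> x) pt = ?act (inv\<^bsub>F\<^esub> y) pt \<longleftrightarrow> K #>\<^bsub>F\<^esub> x = K #>\<^bsub>F\<^esub> y"
    if "x \<in> carrier F" "y \<in> carrier F" for x y
  proof -
    have "?act (x \<otimes>\<^bsub>F\<^esub> inv\<^bsub>F\<^esub> y) pt = ?act x (?act (inv\<^bsub>F\<^esub> y) pt)" using that pt by (intro act_mult) auto
    then have "x \<otimes>\<^bsub>F\<^esub> inv\<^bsub>F\<^esub> y \<in> K \<longleftrightarrow> ?act (inv\<^bsub>F\<^esub> x) pt = ?act (inv\<^bsub>F\<^esub> y) pt"
      using that act_inv[OF that(1), of pt] act_inv[OF that(1) act_Y[OF F.inv_closed[OF that(2)] pt]] pt F.m_closed[of x "inv\<^bsub>F\<^esub> y"] 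
      unfolding K_def by (metis (mono_tags, lifting) F.inv_closed mem_Collect_eq)
    then show ?thesis using F.r_coset_eq_iff[OF K that] by simp
  qed
  have "finite ((\<lambda>x. ?act (inv\<^bsub>F\<^esub> x) pt) ` carrier F)"
  proof (rule finite_subset)
    show "(\<lambda>x. ?act (inv\<^bsub>F\<^esub> x) pt) ` carrier F \<subseteq> ?Y"
      using act_Y[OF F.inv_closed pt] by blast
    show "finite ?Y" using fin by (rule finite_cartesian_product)
  qed
  then have fin_K: "finite (rcosets\<^bsub>F\<^esub> K)"
    unfolding F.rcosets_eq_image using coset_eq by (rule finite_card_image_cong(1))
  have conj: "g \<otimes>\<^bsub>F\<^esub> w \<otimes>\<^bsub>F\<^esub> inv\<^bsub>F\<^esub> g \<in> K \<longleftrightarrow> ?act w (?act (inv\<^bsub>F\<^esub> g) pt) = ?act (inv\<^bsub>F\<^esub> g) pt"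
    if g: "g \<in> carrier F" and w: "w \<in> carrier F" for g w
  proof -
    let ?z = "?act (inv\<^bsub>F\<^esub> g) pt"
    have z: "?z \<in> ?Y" using act_Y[OF F.inv_closed[OF g] pt] .
    have "?act (g \<otimes>\<^bsub>F\<^esub> w \<otimes>\<^bsub>F\<^esub> inv\<^bsub>F\<^esub> g) pt = ?act g (?act w ?z)"
      using act_mult[of "g \<otimes>\<^bsub>F\<^esub> w" "inv\<^bsub>F\<^esub> g" pt] act_mult[OF g w z] g w pt by (simp del: mem_Sigma_iff)
    then have "g \<otimes>\<^bsub>F\<^esub> w \<otimes>\<^bsub>F\<^esub> inv\<^bsub>F\<^esub> g \<in> K \<longleftrightarrow> ?act g (?act w ?z) = pt" using g w by (simp add: K_def)
    also have "\<dots> \<longleftrightarrow> ?act w ?z = ?z"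
      using act_inv(1)[OF g act_Y[OF w z]] act_inv(2)[OF g pt] by metis
    finally show ?thesis .
  qed
  have left: "\<exists>c\<in>carrier G. \<forall>a\<in>carrier G.
      g \<otimes>\<^bsub>F\<^esub> embed_left G a \<otimes>\<^bsub>F\<^esub> inv\<^bsub>F\<^esub> g \<in> K \<longleftrightarrow> inv\<^bsub>G\<^esub> c \<otimes>\<^bsub>G\<^esub> a \<otimes>\<^bsub>G\<^esub> c \<in> A'" if g: "g \<in> carrier F" for g
  proof -
    obtain c Y where c: "c \<in> carrier G" "?act (inv\<^bsub>F\<^esub> g) pt = (c <#\<^bsub>G\<^esub> A', Y)" "Y \<in> LB"
      using act_Y[OF F.inv_closed[OF g] pt] by (auto simp: LA_def)
    have "g \<otimes>\<^bsub>F\<^esub> embed_left G a \<otimes>\<^bsub>F\<^esub> inv\<^bsub>F\<^esub> g \<in> K \<longleftrightarrow> inv\<^bsub>G\<^esub> c \<otimes>\<^bsub>G\<^esub> a \<otimes>\<^bsub>G\<^esub> c \<in> A'" if a: "a \<in> carrier G" for a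
    proof -
      have z: "(c <#\<^bsub>G\<^esub> A', Y) \<in> ?Y" using c by (auto simp: LA_def)
      have "?act (embed_left G a) (c <#\<^bsub>G\<^esub> A', Y) = factor_act (Inl a) (c <#\<^bsub>G\<^esub> A', Y)"
        using act_Inl(2)[OF a a z] by (simp add: embed_left_def)
      also have "\<dots> = ((a \<otimes>\<^bsub>G\<^esub> c) <#\<^bsub>G\<^esub> A', Y)" using a c by (simp add: G.lcos_m_assoc[OF A'G])
      finally show ?thesis
        using conj[OF g hom_in_carrier[OF embed_left_hom a]] G.l_coset_eq_iff[OF A'(1), of "a \<otimes>\<^bsub>G\<^esub> c" c] a c
        by (simp add: G.m_assoc)
    qed
    then show ?thesis using c by blast
  qed
  have right: "\<exists>c\<in>carrier H. \<forall>b\<in>carrier H.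
      g \<otimes>\<^bsub>F\<^esub> embed_right H b \<otimes>\<^bsub>F\<^esub> inv\<^bsub>F\<^esub> g \<in> K \<longleftrightarrow> inv\<^bsub>H\<^esub> c \<otimes>\<^bsub>H\<^esub> b \<otimes>\<^bsub>H\<^esub> c \<in> B'" if g: "g \<in> carrier F" for g
  proof -
    obtain c X where c: "c \<in> carrier H" "?act (inv\<^bsub>F\<^esub> g) pt = (X, c <#\<^bsub>H\<^esub> B')" "X \<in> LA"
      using act_Y[OF F.inv_closed[OF g] pt] by (auto simp: LB_def)
    have "g \<otimes>\<^bsub>F\<^esub> embed_right H b \<otimes>\<^bsub>F\<^esub> inv\<^bsub>F\<^esub> g \<in> K \<longleftrightarrow> inv\<^bsub>H\<^esub> c \<otimes>\<^bsub>H\<^esub> b \<otimes>\<^bsub>H\<^esub> c \<in> B'" if b: "b \<in> carrier H" for b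
    proof -
      have z: "(X, c <#\<^bsub>H\<^esub> B') \<in> ?Y" using c by (auto simp: LB_def)
      have "?act (embed_right H b) (X, c <#\<^bsub>H\<^esub> B') = factor_act (Inr b) (X, c <#\<^bsub>H\<^esub> B')"
        using act_Inr(2)[OF b b z] by (simp add: embed_right_def)
      also have "\<dots> = (X, (b \<otimes>\<^bsub>H\<^esub> c) <#\<^bsub>H\<^esub> B')" using b c by (simp add: H.lcos_m_assoc[OF B'H])
      finally show ?thesis
        using conj[OF g hom_in_carrier[OF embed_right_hom b]] H.l_coset_eq_iff[OF B'(1), of "b \<otimes>\<^bsub>H\<^esub> c" c] b c
        by (simp add: H.m_assoc)
    qed
    then show ?thesis using c by blast
  qed
  show thesis by (rule that[OF K fin_K left right])
qed

end

section \<open>Stable presentation length\<close>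

lemma card_rcosets_pos:
  assumes "group G" "finite (rcosets\<^bsub>G\<^esub> H)"
  shows "card (rcosets\<^bsub>G\<^esub> H) > 0"
  using assms group.rcosets_eq_image[OF assms(1), of H] monoid.one_closed[OF group.is_monoid[OF assms(1)]]
  by (auto simp: card_gt_0_iff)

lemma stable_presentation_length_le:
  assumes "subgroup H G" "finite (rcosets\<^bsub>G\<^esub> H)"
  shows "stable_presentation_length G \<le> real (presentation_length (G\<lparr>carrier := H\<rparr>)) / real (card (rcosets\<^bsub>G\<^esub> H))"
  unfolding stable_presentation_length_def
  by (rule cINF_lower) (use assms in \<open>auto intro!: bdd_belowI[of _ 0]\<close>)

lemma stable_presentation_length_greatest:
  assumes "group G"
    and "\<And>H. subgroup H G \<Longrightarrow> finite (rcosets\<^bsub>G\<^esub> H) \<Longrightarrow>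
      b \<le> real (presentation_length (G\<lparr>carrier := H\<rparr>)) / real (card (rcosets\<^bsub>G\<^esub> H))"
  shows "b \<le> stable_presentation_length G"
  unfolding stable_presentation_length_def
proof (rule cINF_greatest)
  interpret group G by fact
  \<comment> \<open>The whole group has a single coset, so the infimum is taken over a nonempty
    set.\<close>
  have "carrier G #>\<^bsub>G\<^esub> x = carrier G" if "x \<in> carrier G" for x
    using coset_join2[OF that subgroup_self that] .
  then have "rcosets\<^bsub>G\<^esub> (carrier G) \<subseteq> {carrier G}" by (auto simp: rcosets_eq_image)
  then have "finite (rcosets\<^bsub>G\<^esub> (carrier G))" by (rule finite_subset) simp
  then show "{H. subgroup H G \<and> finite (rcosets\<^bsub>G\<^esub> H)} \<noteq> {}" using subgroup_self by blast
qed (use assms(2) in auto)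

lemma presentation_length_iso:
  assumes "group G" "group H" "G \<cong> H"
  shows "presentation_length G = presentation_length H"
proof -
  have "is_presentation G n rs \<longleftrightarrow> is_presentation H n rs" for n rs
    by (rule iffI) (erule is_presentation_iso[OF _ assms(3)], erule is_presentation_iso[OF _ group.iso_sym[OF assms(1,3)]])
  then show ?thesis by (simp add: presentation_length_def)
qed

section \<open>Parts of a factor as subgroups of the abstract group\<close>

locale embedding = G: group G + F: group F for G (structure) and F (structure) and e +
  assumes hom: "e \<in> hom G F" and inj: "inj_on e (carrier G)"
begin

text \<open>The isomorphism is conjugation by \<open>c\<close> followed by \<open>e\<close>. The
  case \<open>c = \<one>\<close> pulls an arbitrary part back to \<open>G\<close>; other
  \<open>c\<close> occur for the stabiliser, all of whose parts come from conjugates of a single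
  subgroup.\<close>

lemma conj_part_twisted:
  assumes K: "subgroup K F" and g: "g \<in> carrier F" and A: "subgroup A G" and c: "c \<in> carrier G"
    and conj: "\<And>a. a \<in> carrier G \<Longrightarrow>
      g \<otimes>\<^bsub>F\<^esub> e a \<otimes>\<^bsub>F\<^esub> inv\<^bsub>F\<^esub> g \<in> K \<longleftrightarrow> inv\<^bsub>G\<^esub> c \<otimes>\<^bsub>G\<^esub> a \<otimes>\<^bsub>G\<^esub> c \<in> A"
  shows "G\<lparr>carrier := A\<rparr> \<cong> F\<lparr>carrier := F.conj_part K (e ` carrier G) g\<rparr>"
    and "finite (rcosets\<^bsub>F\<lparr>carrier := e ` carrier G\<rparr>\<^esub> (F.conj_part K (e ` carrier G) g)) \<longleftrightarrow> finite (rcosets\<^bsub>G\<^esub> A)"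
    and "card (rcosets\<^bsub>F\<lparr>carrier := e ` carrier G\<rparr>\<^esub> (F.conj_part K (e ` carrier G) g)) = card (rcosets\<^bsub>G\<^esub> A)"
proof -
  interpret A: subgroup A G by fact
  interpret hom: group_hom G F e by unfold_locales (rule hom)
  let ?C = "F.conj_part K (e ` carrier G) g"
  have C: "subgroup ?C F" by (rule F.subgroup_conj_part(1)[OF K hom.img_is_subgroup g])
  have C_iff: "e a \<in> ?C \<longleftrightarrow> inv\<^bsub>G\<^esub> c \<otimes>\<^bsub>G\<^esub> a \<otimes>\<^bsub>G\<^esub> c \<in> A" if "a \<in> carrier G" for a
    using conj[OF that] that by (simp add: F.conj_part_def)
  define tw where "tw a = e (c \<otimes>\<^bsub>G\<^esub> a \<otimes>\<^bsub>G\<^esub> inv\<^bsub>G\<^esub> c)" for a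
  have untw: "inv\<^bsub>G\<^esub> c \<otimes>\<^bsub>G\<^esub> (c \<otimes>\<^bsub>G\<^esub> a \<otimes>\<^bsub>G\<^esub> inv\<^bsub>G\<^esub> c) \<otimes>\<^bsub>G\<^esub> c = a"
    "c \<otimes>\<^bsub>G\<^esub> (inv\<^bsub>G\<^esub> c \<otimes>\<^bsub>G\<^esub> a \<otimes>\<^bsub>G\<^esub> c) \<otimes>\<^bsub>G\<^esub> inv\<^bsub>G\<^esub> c = a" if "a \<in> carrier G" for a
    using that c by (simp_all add: G.m_assoc) (simp_all add: G.m_assoc[symmetric])
  have "tw \<in> iso (G\<lparr>carrier := A\<rparr>) (F\<lparr>carrier := ?C\<rparr>)"
  proof (rule isoI)
    show "tw \<in> hom (G\<lparr>carrier := A\<rparr>) (F\<lparr>carrier := ?C\<rparr>)"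
    proof (rule homI)
      fix a b assume "a \<in> carrier (G\<lparr>carrier := A\<rparr>)" "b \<in> carrier (G\<lparr>carrier := A\<rparr>)"
      then have ab: "a \<in> A" "b \<in> A" "a \<in> carrier G" "b \<in> carrier G" using A.subset by auto
      show "tw a \<in> carrier (F\<lparr>carrier := ?C\<rparr>)"
        using C_iff[of "c \<otimes>\<^bsub>G\<^esub> a \<otimes>\<^bsub>G\<^esub> inv\<^bsub>G\<^esub> c"] untw(1)[OF ab(3)] ab c by (simp add: tw_def)
      show "tw (a \<otimes>\<^bsub>G\<lparr>carrier := A\<rparr>\<^esub> b) = tw a \<otimes>\<^bsub>F\<lparr>carrier := ?C\<rparr>\<^esub> tw b"
        using ab c G.conj_mult[OF c ab(3,4)] hom.hom_mult[of "c \<otimes>\<^bsub>G\<^esub> a \<otimes>\<^bsub>G\<^esub> inv\<^bsub>G\<^esub> c" "c \<otimes>\<^bsub>G\<^esub> b \<otimes>\<^bsub>G\<^esub> inv\<^bsub>G\<^esub> c"]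
        by (simp add: tw_def)
    qed
    have "inj_on tw A"
    proof (rule inj_onI)
      fix a b assume "a \<in> A" "b \<in> A" and eq: "tw a = tw b"
      then have ab: "a \<in> carrier G" "b \<in> carrier G" using A.subset by auto
      then have "c \<otimes>\<^bsub>G\<^esub> a \<otimes>\<^bsub>G\<^esub> inv\<^bsub>G\<^esub> c = c \<otimes>\<^bsub>G\<^esub> b \<otimes>\<^bsub>G\<^esub> inv\<^bsub>G\<^esub> c"
        using eq c by (intro inj_onD[OF inj]) (auto simp: tw_def)
      then show "a = b" using untw(1) ab by metis
    qed
    moreover have "tw ` A = ?C"
    proof
      show "?C \<subseteq> tw ` A"
      proof
        fix x assume x: "x \<in> ?C"
        then obtain a where a: "a \<in> carrier G" "x = e a" by (auto simp: F.conj_part_def)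
        then have "inv\<^bsub>G\<^esub> c \<otimes>\<^bsub>G\<^esub> a \<otimes>\<^bsub>G\<^esub> c \<in> A" "x = tw (inv\<^bsub>G\<^esub> c \<otimes>\<^bsub>G\<^esub> a \<otimes>\<^bsub>G\<^esub> c)"
          using C_iff[OF a(1)] x untw(2)[OF a(1)] by (auto simp: tw_def)
        then show "x \<in> tw ` A" by blast
      qed
      show "tw ` A \<subseteq> ?C"
      proof
        fix x assume "x \<in> tw ` A"
        then obtain a where a: "a \<in> A" "x = tw a" by blast
        then show "x \<in> ?C"
          using C_iff[of "c \<otimes>\<^bsub>G\<^esub> a \<otimes>\<^bsub>G\<^esub> inv\<^bsub>G\<^esub> c"] untw(1)[of a] c by (simp add: tw_def)
      qed
    qed
    ultimately show "bij_betw tw (carrier (G\<lparr>carrier := A\<rparr>)) (carrier (F\<lparr>carrier := ?C\<rparr>))"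
      by (simp add: bij_betw_def)
  qed
  then show "G\<lparr>carrier := A\<rparr> \<cong> F\<lparr>carrier := ?C\<rparr>" by (auto simp: is_iso_def)
  have C_cosets: "rcosets\<^bsub>F\<lparr>carrier := e ` carrier G\<rparr>\<^esub> ?C = (\<lambda>a. ?C #>\<^bsub>F\<^esub> e a) ` carrier G"
    by (auto simp: RCOSETS_def r_coset_def)
  \<comment> \<open>The part corresponds to the conjugate of \<open>A\<close> by \<open>c\<close>;
    shifting representatives by the inverse of \<open>c\<close> turns its right cosets into those of
    \<open>A\<close>.\<close>
  have "(\<lambda>a. A #>\<^bsub>G\<^esub> (inv\<^bsub>G\<^esub> c \<otimes>\<^bsub>G\<^esub> a)) ` carrier G = (\<lambda>a. A #>\<^bsub>G\<^esub> a) ` ((\<lambda>a. inv\<^bsub>G\<^esub> c \<otimes>\<^bsub>G\<^esub> a) ` carrier G)"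
    by (simp add: image_image)
  also have "(\<lambda>a. inv\<^bsub>G\<^esub> c \<otimes>\<^bsub>G\<^esub> a) ` carrier G = carrier G"
    using G.surj_const_mult[of "inv\<^bsub>G\<^esub> c"] c by simp
  finally have A_cosets: "rcosets\<^bsub>G\<^esub> A = (\<lambda>a. A #>\<^bsub>G\<^esub> (inv\<^bsub>G\<^esub> c \<otimes>\<^bsub>G\<^esub> a)) ` carrier G"
    by (simp add: G.rcosets_eq_image)
  have eq: "?C #>\<^bsub>F\<^esub> e a = ?C #>\<^bsub>F\<^esub> e b \<longleftrightarrow> A #>\<^bsub>G\<^esub> (inv\<^bsub>G\<^esub> c \<otimes>\<^bsub>G\<^esub> a) = A #>\<^bsub>G\<^esub> (inv\<^bsub>G\<^esub> c \<otimes>\<^bsub>G\<^esub> b)"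
    if ab: "a \<in> carrier G" "b \<in> carrier G" for a b
  proof -
    have "e a \<otimes>\<^bsub>F\<^esub> inv\<^bsub>F\<^esub> e b = e (a \<otimes>\<^bsub>G\<^esub> inv\<^bsub>G\<^esub> b)" using ab by simp
    moreover have "inv\<^bsub>G\<^esub> c \<otimes>\<^bsub>G\<^esub> a \<otimes>\<^bsub>G\<^esub> inv\<^bsub>G\<^esub> (inv\<^bsub>G\<^esub> c \<otimes>\<^bsub>G\<^esub> b) = inv\<^bsub>G\<^esub> c \<otimes>\<^bsub>G\<^esub> (a \<otimes>\<^bsub>G\<^esub> inv\<^bsub>G\<^esub> b) \<otimes>\<^bsub>G\<^esub> c"
      using ab c by (simp add: G.inv_mult_group G.m_assoc)
    ultimately show ?thesis
      using ab c C_iff[of "a \<otimes>\<^bsub>G\<^esub> inv\<^bsub>G\<^esub> b"] by (simp add: F.r_coset_eq_iff[OF C] G.r_coset_eq_iff[OF A] del: hom.hom_mult)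
  qed
  show "finite (rcosets\<^bsub>F\<lparr>carrier := e ` carrier G\<rparr>\<^esub> ?C) \<longleftrightarrow> finite (rcosets\<^bsub>G\<^esub> A)"
    unfolding C_cosets A_cosets
    using finite_card_image_cong(1)[of "\<lambda>a. ?C #>\<^bsub>F\<^esub> e a" "carrier G" "\<lambda>a. A #>\<^bsub>G\<^esub> (inv\<^bsub>G\<^esub> c \<otimes>\<^bsub>G\<^esub> a)"]
      finite_card_image_cong(1)[of "\<lambda>a. A #>\<^bsub>G\<^esub> (inv\<^bsub>G\<^esub> c \<otimes>\<^bsub>G\<^esub> a)" "carrier G" "\<lambda>a. ?C #>\<^bsub>F\<^esub> e a"] eq
    by blast
  \<comment> \<open>If there are infinitely many cosets, both cardinalities are 0.\<close>
  then show "card (rcosets\<^bsub>F\<lparr>carrier := e ` carrier G\<rparr>\<^esub> ?C) = card (rcosets\<^bsub>G\<^esub> A)"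
    unfolding C_cosets A_cosets
    using finite_card_image_cong(2)[of "\<lambda>a. ?C #>\<^bsub>F\<^esub> e a" "carrier G" "\<lambda>a. A #>\<^bsub>G\<^esub> (inv\<^bsub>G\<^esub> c \<otimes>\<^bsub>G\<^esub> a)"] eq
    by (metis (lifting) card.infinite)
qed

text \<open>The preimage of the part in \<open>G\<close> is one of the subgroups over which the
  infimum for \<open>G\<close> is taken. The inequality is the resulting comparison with the index
  multiplied out.\<close>

lemma conj_part_pullback:
  assumes K: "subgroup K F" and g: "g \<in> carrier F"
    and fin: "finite (rcosets\<^bsub>F\<lparr>carrier := e ` carrier G\<rparr>\<^esub> (F.conj_part K (e ` carrier G) g))"
    and pres: "\<exists>n rs. is_presentation G n rs"
  shows "\<exists>n rs. is_presentation (F\<lparr>carrier := F.conj_part K (e ` carrier G) g\<rparr>) n rs"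
    and "stable_presentation_length G * real (card (rcosets\<^bsub>F\<lparr>carrier := e ` carrier G\<rparr>\<^esub> (F.conj_part K (e ` carrier G) g)))
      \<le> real (presentation_length (F\<lparr>carrier := F.conj_part K (e ` carrier G) g\<rparr>))"
proof -
  interpret hom: group_hom G F e by unfold_locales (rule hom)
  interpret K: subgroup K F by fact
  let ?C = "F.conj_part K (e ` carrier G) g"
  define A where "A = {a \<in> carrier G. g \<otimes>\<^bsub>F\<^esub> e a \<otimes>\<^bsub>F\<^esub> inv\<^bsub>F\<^esub> g \<in> K}"
  have "\<one>\<^bsub>G\<^esub> \<in> A" using g by (simp add: A_def)
  then have A: "subgroup A G"
    using g by (intro G.subgroupI) (auto simp: A_def F.conj_mult F.conj_inv)
  have conj: "g \<otimes>\<^bsub>F\<^esub> e a \<otimes>\<^bsub>F\<^esub> inv\<^bsub>F\<^esub> g \<in> K \<longleftrightarrow> inv\<^bsub>G\<^esub> \<one>\<^bsub>G\<^esub> \<otimes>\<^bsub>G\<^esub> a \<otimes>\<^bsub>G\<^esub> \<one>\<^bsub>G\<^esub> \<in> A" if "a \<in> carrier G" for a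
    using that by (simp add: A_def)
  note twisted = conj_part_twisted[OF K g A G.one_closed conj]
  have fin_A: "finite (rcosets\<^bsub>G\<^esub> A)" using twisted(2) fin by blast
  have "\<exists>n rs. is_presentation (G\<lparr>carrier := A\<rparr>) n rs" using G.finite_index_presentable[OF _ A fin_A] pres by blast
  then show "\<exists>n rs. is_presentation (F\<lparr>carrier := ?C\<rparr>) n rs" using is_presentation_iso[OF _ twisted(1)] by blast
  have T: "presentation_length (G\<lparr>carrier := A\<rparr>) = presentation_length (F\<lparr>carrier := ?C\<rparr>)"
    by (rule presentation_length_iso) (use A F.subgroup_conj_part(1)[OF K hom.img_is_subgroup g] twisted(1) in
      \<open>auto intro: subgroup.subgroup_is_group G.is_group F.is_group\<close>)
  have "stable_presentation_length G \<le> real (presentation_length (G\<lparr>carrier := A\<rparr>)) / real (card (rcosets\<^bsub>G\<^esub> A))"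
    by (rule stable_presentation_length_le[OF A fin_A])
  then show "stable_presentation_length G * real (card (rcosets\<^bsub>F\<lparr>carrier := e ` carrier G\<rparr>\<^esub> ?C))
      \<le> real (presentation_length (F\<lparr>carrier := ?C\<rparr>))"
    using card_rcosets_pos[OF G.is_group fin_A] T twisted(3) by (simp add: field_simps)
qed

end

theorem theorem5p1:
  fixes G1 :: "('a, 'c) monoid_scheme" and G2 :: "('b, 'd) monoid_scheme"
  assumes "finitely_presentable G1" and "finitely_presentable G2"
  shows "stable_presentation_length (free_product G1 G2) =
    stable_presentation_length G1 + stable_presentation_length G2"
proof -
  have G1: "group G1" "\<exists>n rs. is_presentation G1 n rs" and G2: "group G2" "\<exists>n rs. is_presentation G2 n rs"
    using assms by (auto simp: finitely_presentable_def)
  let ?F = "free_product G1 G2" and ?A = "free_factor G1 G2"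
  interpret free_splitting ?F ?A leading by (rule free_splitting_free_product[OF G1(1) G2(1)])
  interpret left: embedding G1 ?F "embed_left G1"
    using G1(1) embed_left_hom[OF G1(1) G2(1)] embed_left_inj[OF G1(1) G2(1)]
    by (simp add: embedding_def embedding_axioms_def is_group)
  interpret right: embedding G2 ?F "embed_right G2"
    using G2(1) embed_right_hom[OF G1(1) G2(1)] embed_right_inj[OF G1(1) G2(1)]
    by (simp add: embedding_def embedding_axioms_def is_group)
  note image = embed_left_image[OF G1(1) G2(1)] embed_right_image[OF G1(1) G2(1)]
  define idx where "idx K s g = card (rcosets\<^bsub>?F\<lparr>carrier := ?A s\<rparr>\<^esub> (conj_part K (?A s) g))" for K s g
  define len where "len K s g = presentation_length (?F\<lparr>carrier := conj_part K (?A s) g\<rparr>)" for K s g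
  define reps where "reps K s = (SOME \<Gamma>. double_coset_reps K (?A s) \<Gamma> \<and>
    (\<forall>g\<in>\<Gamma>. finite (rcosets\<^bsub>?F\<lparr>carrier := ?A s\<rparr>\<^esub> (conj_part K (?A s) g))) \<and>
    (\<Sum>g\<in>\<Gamma>. idx K s g) = card (rcosets\<^bsub>?F\<^esub> K))" for K s
  have reps: "double_coset_reps K (?A s) (reps K s)"
    "\<forall>g\<in>reps K s. finite (rcosets\<^bsub>?F\<lparr>carrier := ?A s\<rparr>\<^esub> (conj_part K (?A s) g))"
    "(\<Sum>g\<in>reps K s. idx K s g) = card (rcosets\<^bsub>?F\<^esub> K)"
    if K: "subgroup K ?F" "finite (rcosets\<^bsub>?F\<^esub> K)" for K s
  proof -
    obtain \<Gamma> where "double_coset_reps K (?A s) \<Gamma>"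
      "\<And>g. g \<in> \<Gamma> \<Longrightarrow> finite (rcosets\<^bsub>?F\<lparr>carrier := ?A s\<rparr>\<^esub> (conj_part K (?A s) g))"
      "(\<Sum>g\<in>\<Gamma>. card (rcosets\<^bsub>?F\<lparr>carrier := ?A s\<rparr>\<^esub> (conj_part K (?A s) g))) = card (rcosets\<^bsub>?F\<^esub> K)"
      by (rule double_coset_reps_exist[OF K(1) subgroup_A[of s] K(2)]) (rule that; assumption)
    then have "\<exists>\<Gamma>. double_coset_reps K (?A s) \<Gamma> \<and>
      (\<forall>g\<in>\<Gamma>. finite (rcosets\<^bsub>?F\<lparr>carrier := ?A s\<rparr>\<^esub> (conj_part K (?A s) g))) \<and>
      (\<Sum>g\<in>\<Gamma>. idx K s g) = card (rcosets\<^bsub>?F\<^esub> K)" unfolding idx_def by blast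
    from someI_ex[OF this]
    show "double_coset_reps K (?A s) (reps K s)"
      "\<forall>g\<in>reps K s. finite (rcosets\<^bsub>?F\<lparr>carrier := ?A s\<rparr>\<^esub> (conj_part K (?A s) g))"
      "(\<Sum>g\<in>reps K s. idx K s g) = card (rcosets\<^bsub>?F\<^esub> K)"
      unfolding reps_def by blast+
  qed
  have reps_carrier: "g \<in> carrier ?F" if "subgroup K ?F" "finite (rcosets\<^bsub>?F\<^esub> K)" "g \<in> reps K s" for K s g
    using reps(1)[OF that(1,2), of s] that(3) by (auto simp: double_coset_reps_def)
  have pres: "\<exists>n rs. is_presentation (?F\<lparr>carrier := conj_part K (?A s) g\<rparr>) n rs"
    if K: "subgroup K ?F" "finite (rcosets\<^bsub>?F\<^esub> K)" and g: "g \<in> reps K s" for K s g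
    using left.conj_part_pullback(1)[OF K(1) reps_carrier[OF K g] _ G1(2)]
      right.conj_part_pullback(1)[OF K(1) reps_carrier[OF K g] _ G2(2)] reps(2)[OF K, of s] g
    by (cases s) (auto simp: image)
  have kurosh: "presentation_length (?F\<lparr>carrier := K\<rparr>) = (\<Sum>g\<in>reps K True. len K True g) + (\<Sum>g\<in>reps K False. len K False g)"
    if K: "subgroup K ?F" "finite (rcosets\<^bsub>?F\<^esub> K)" for K
  proof -
    have fin: "finite (reps K s)" for s using reps(1)[OF K, of s] by (simp add: double_coset_reps_def)
    have sum: "(\<Sum>(s, g)\<in>Sigma UNIV (reps K). len K s g) = (\<Sum>g\<in>reps K True. len K True g) + (\<Sum>g\<in>reps K False. len K False g)"
      using fin by (simp add: sum.Sigma[symmetric] UNIV_bool)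
    obtain n rs where rs: "is_presentation (?F\<lparr>carrier := K\<rparr>) n rs" "(\<Sum>r\<leftarrow>rs. length r - 2) \<le> (\<Sum>(s, g)\<in>Sigma UNIV (reps K). len K s g)"
      using presentation_of_parts[OF K(1) reps(1)[OF K]] reps(2)[OF K] pres[OF K] unfolding len_def by blast
    \<comment> \<open>The presentation \<open>rs\<close> guarantees that a shortest one exists, and
      the lower bound is applied to the latter.\<close>
    obtain m ts where ts: "is_presentation (?F\<lparr>carrier := K\<rparr>) m ts" "presentation_length (?F\<lparr>carrier := K\<rparr>) = (\<Sum>r\<leftarrow>ts. length r - 2)"
      using presentation_length_attained rs(1) by blast
    have "(\<Sum>(s, g)\<in>Sigma UNIV (reps K). len K s g) \<le> presentation_length (?F\<lparr>carrier := K\<rparr>)"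
      using presentation_length_parts_le[OF K(1) ts(1) reps(1)[OF K]] ts(2) unfolding len_def by simp
    moreover have "presentation_length (?F\<lparr>carrier := K\<rparr>) \<le> (\<Sum>(s, g)\<in>Sigma UNIV (reps K). len K s g)"
      by (rule presentation_length_le[OF rs])
    ultimately show ?thesis using sum by simp
  qed
  show ?thesis
  proof (rule antisym)
    show "stable_presentation_length G1 + stable_presentation_length G2 \<le> stable_presentation_length ?F"
    proof (rule stable_presentation_length_greatest[OF is_group])
      fix K assume K: "subgroup K ?F" "finite (rcosets\<^bsub>?F\<^esub> K)"
      let ?d = "card (rcosets\<^bsub>?F\<^esub> K)"
      have "stable_presentation_length G1 * real (idx K True g) \<le> real (len K True g)" if "g \<in> reps K True" for g
        using left.conj_part_pullback(2)[OF K(1) reps_carrier[OF K that] _ G1(2)] reps(2)[OF K] that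
        by (simp add: image idx_def len_def)
      then have "(\<Sum>g\<in>reps K True. stable_presentation_length G1 * real (idx K True g)) \<le> (\<Sum>g\<in>reps K True. real (len K True g))"
        by (rule sum_mono)
      then have 1: "stable_presentation_length G1 * real ?d \<le> (\<Sum>g\<in>reps K True. real (len K True g))"
        using reps(3)[OF K, of True] by (simp flip: sum_distrib_left of_nat_sum)
      have "stable_presentation_length G2 * real (idx K False g) \<le> real (len K False g)" if "g \<in> reps K False" for g
        using right.conj_part_pullback(2)[OF K(1) reps_carrier[OF K that] _ G2(2)] reps(2)[OF K] that
        by (simp add: image idx_def len_def)
      then have "(\<Sum>g\<in>reps K False. stable_presentation_length G2 * real (idx K False g)) \<le> (\<Sum>g\<in>reps K False. real (len K False g))"
        by (rule sum_mono)
      then have 2: "stable_presentation_length G2 * real ?d \<le> (\<Sum>g\<in>reps K False. real (len K False g))"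
        using reps(3)[OF K, of False] by (simp flip: sum_distrib_left of_nat_sum)
      have "real ?d > 0" using card_rcosets_pos[OF is_group K(2)] by simp
      then show "stable_presentation_length G1 + stable_presentation_length G2
          \<le> real (presentation_length (?F\<lparr>carrier := K\<rparr>)) / real ?d"
        using 1 2 kurosh[OF K] by (simp add: pos_le_divide_eq distrib_right)
    qed
    have upper: "stable_presentation_length ?F \<le>
        real (presentation_length (G1\<lparr>carrier := A\<rparr>)) / real (card (rcosets\<^bsub>G1\<^esub> A)) +
        real (presentation_length (G2\<lparr>carrier := B\<rparr>)) / real (card (rcosets\<^bsub>G2\<^esub> B))"
      if A: "subgroup A G1" "finite (rcosets\<^bsub>G1\<^esub> A)" and B: "subgroup B G2" "finite (rcosets\<^bsub>G2\<^esub> B)" for A B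
    proof -
      let ?a = "presentation_length (G1\<lparr>carrier := A\<rparr>)" and ?b = "presentation_length (G2\<lparr>carrier := B\<rparr>)"
      let ?m = "card (rcosets\<^bsub>G1\<^esub> A)" and ?n = "card (rcosets\<^bsub>G2\<^esub> B)"
      obtain K where K: "subgroup K ?F" "finite (rcosets\<^bsub>?F\<^esub> K)"
        and conj1: "\<And>g. g \<in> carrier ?F \<Longrightarrow> \<exists>c\<in>carrier G1. \<forall>a\<in>carrier G1.
          g \<otimes>\<^bsub>?F\<^esub> embed_left G1 a \<otimes>\<^bsub>?F\<^esub> inv\<^bsub>?F\<^esub> g \<in> K \<longleftrightarrow> inv\<^bsub>G1\<^esub> c \<otimes>\<^bsub>G1\<^esub> a \<otimes>\<^bsub>G1\<^esub> c \<in> A"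
        and conj2: "\<And>g. g \<in> carrier ?F \<Longrightarrow> \<exists>c\<in>carrier G2. \<forall>b\<in>carrier G2.
          g \<otimes>\<^bsub>?F\<^esub> embed_right G2 b \<otimes>\<^bsub>?F\<^esub> inv\<^bsub>?F\<^esub> g \<in> K \<longleftrightarrow> inv\<^bsub>G2\<^esub> c \<otimes>\<^bsub>G2\<^esub> b \<otimes>\<^bsub>G2\<^esub> c \<in> B"
        by (rule conj_stabiliser_exists[OF G1(1) G2(1) A B]) (rule that; assumption)
      let ?d = "card (rcosets\<^bsub>?F\<^esub> K)"
      have part1: "len K True g = ?a \<and> idx K True g = ?m" if g: "g \<in> reps K True" for g
      proof -
        obtain c where c: "c \<in> carrier G1" "\<And>a. a \<in> carrier G1 \<Longrightarrow>
          g \<otimes>\<^bsub>?F\<^esub> embed_left G1 a \<otimes>\<^bsub>?F\<^esub> inv\<^bsub>?F\<^esub> g \<in> K \<longleftrightarrow> inv\<^bsub>G1\<^esub> c \<otimes>\<^bsub>G1\<^esub> a \<otimes>\<^bsub>G1\<^esub> c \<in> A"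
          using conj1[OF reps_carrier[OF K g]] by blast
        note twisted = left.conj_part_twisted[OF K(1) reps_carrier[OF K g] A(1) c, unfolded image]
        have "?a = len K True g"
          unfolding len_def
          by (rule presentation_length_iso[OF subgroup.subgroup_is_group[OF A(1) G1(1)] _ twisted(1)])
            (rule subgroup.subgroup_is_group[OF subgroup_conj_part(1)[OF K(1) subgroup_A reps_carrier[OF K g]] is_group])
        then show ?thesis using twisted(3) by (simp add: idx_def)
      qed
      have part2: "len K False g = ?b \<and> idx K False g = ?n" if g: "g \<in> reps K False" for g
      proof -
        obtain c where c: "c \<in> carrier G2" "\<And>a. a \<in> carrier G2 \<Longrightarrow>
          g \<otimes>\<^bsub>?F\<^esub> embed_right G2 a \<otimes>\<^bsub>?F\<^esub> inv\<^bsub>?F\<^esub> g \<in> K \<longleftrightarrow> inv\<^bsub>G2\<^esub> c \<otimes>\<^bsub>G2\<^esub> a \<otimes>\<^bsub>G2\<^esub> c \<in> B"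
          using conj2[OF reps_carrier[OF K g]] by blast
        note twisted = right.conj_part_twisted[OF K(1) reps_carrier[OF K g] B(1) c, unfolded image]
        have "?b = len K False g"
          unfolding len_def
          by (rule presentation_length_iso[OF subgroup.subgroup_is_group[OF B(1) G2(1)] _ twisted(1)])
            (rule subgroup.subgroup_is_group[OF subgroup_conj_part(1)[OF K(1) subgroup_A reps_carrier[OF K g]] is_group])
        then show ?thesis using twisted(3) by (simp add: idx_def)
      qed
      \<comment> \<open>All parts in one factor have the same index, so the index of
        \<open>K\<close> is the number of double cosets times this index, and the number of double
        cosets cancels from the quotients below.\<close>
      have d: "?d = card (reps K True) * ?m" "?d = card (reps K False) * ?n"
        using reps(3)[OF K, of True] reps(3)[OF K, of False] part1 part2 by simp_all
      have T: "presentation_length (?F\<lparr>carrier := K\<rparr>) = card (reps K True) * ?a + card (reps K False) * ?b"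
        using kurosh[OF K] part1 part2 by simp
      have pos: "?d > 0" "?m > 0" "?n > 0"
        using card_rcosets_pos[OF is_group K(2)] card_rcosets_pos[OF G1(1) A(2)] card_rcosets_pos[OF G2(1) B(2)] by auto
      have "real (card (reps K True) * ?a) / real ?d = real ?a / real ?m"
        using pos unfolding d(1) by simp
      moreover have "real (card (reps K False) * ?b) / real ?d = real ?b / real ?n"
        using pos unfolding d(2) by simp
      ultimately have "real (presentation_length (?F\<lparr>carrier := K\<rparr>)) / real ?d = real ?a / real ?m + real ?b / real ?n"
        unfolding T of_nat_add add_divide_distrib by simp
      then show ?thesis using stable_presentation_length_le[OF K] by simp
    qed
    \<comment> \<open>The infima need not be attained, so they are taken one after the other: over
      the subgroups of \<open>G1\<close> for fixed \<open>B\<close>, and then over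
      \<open>B\<close>.\<close>
    have "stable_presentation_length ?F - real (presentation_length (G2\<lparr>carrier := B\<rparr>)) / real (card (rcosets\<^bsub>G2\<^esub> B))
        \<le> stable_presentation_length G1" if "subgroup B G2" "finite (rcosets\<^bsub>G2\<^esub> B)" for B
      by (rule stable_presentation_length_greatest[OF G1(1)]) (use upper[OF _ _ that] in \<open>simp add: algebra_simps\<close>)
    then have "stable_presentation_length ?F - stable_presentation_length G1 \<le> stable_presentation_length G2"
      by (intro stable_presentation_length_greatest[OF G2(1)]) (simp add: algebra_simps)
    then show "stable_presentation_length ?F \<le> stable_presentation_length G1 + stable_presentation_length G2" by simp
  qed
qed

end
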